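(* Let $G$ be a compact connected semisimple Lie group equipped with a fixed bi-invariant Riemannian metric, let $\Delta$ be its Laplace--Beltrami operator, and let $\sigma$ be a finite-dimensional real linear representation of $G$ in a real linear space $V_\sigma$. Let $\Lambda_\sigma$ be the spectrum of $\Delta$ on the space $M_\sigma$ of matrix elements of $\sigma$. Suppose that $\Lambda_\sigma$ is a single point $\lambda\neq 0$. Then the orbit $\{\sigma(g)x:\ g\in G\}$ of any vector $x\in V_\sigma$ meets each linear subspace of $V_\sigma$ of (real) codimension $2$.
   Context: The space $V_\sigma$ is endowed with a $G$-invariant inner product $\langle\cdot,\cdot\rangle$. The space of matrix elements $M_\sigma$ is the (real) linear span of the functions $t_{xy}(g)=\langle\sigma(g)x,y\rangle$ on $G$, where $x,y\in V_\sigma$. For an irreducible real representation $\tau$ of $G$, one has $\Delta u=\lambda_\tau u$ for each $u\in M_\tau$, with a constant $\lambda_\tau$ depending only on $\tau$ (and the metric); the spectrum $\Lambda_\sigma$ of $\Delta$ on $M_\sigma$ is the set of all $\lambda_\tau$, where $\tau$ runs over all irreducible components of $\sigma$. *)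

theory Defs
  imports "HOL-Analysis.Analysis" "HOL-Algebra.Group_Action"
begin

text \<open>Differentiability classes for maps on open subsets of Euclidean spaces.\<close>

fun Ck_on :: "nat \<Rightarrow> 'a::euclidean_space set \<Rightarrow> ('a \<Rightarrow> 'b::real_normed_vector) \<Rightarrow> bool" where
  "Ck_on 0 S f \<longleftrightarrow> continuous_on S f"
| "Ck_on (Suc k) S f \<longleftrightarrow>
     (\<forall>x\<in>S. f differentiable (at x)) \<and> (\<forall>v. Ck_on k S (\<lambda>x. frechet_derivative f (at x) v))"

definition smooth_on :: "'a::euclidean_space set \<Rightarrow> ('a \<Rightarrow> 'b::real_normed_vector) \<Rightarrow> bool" where
  "smooth_on S f \<longleftrightarrow> (\<forall>k. Ck_on k S f)"

definition partial_deriv :: "'n \<Rightarrow> (real^'n \<Rightarrow> real) \<Rightarrow> real^'n \<Rightarrow> real" where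
  "partial_deriv i f x = frechet_derivative f (at x) (axis i 1)"


text \<open>
  Manifolds are types \<open>'g\<close> carrying a smooth atlas, which need not be maximal. A chart is a
  pair of its domain and its coordinate map; the values of the latter off the domain are junk.
\<close>

type_synonym ('g, 'n) chart = "'g set \<times> ('g \<Rightarrow> real^'n)"

abbreviation param :: "('g, 'n::finite) chart \<Rightarrow> real^'n \<Rightarrow> 'g" where
  "param c \<equiv> inv_into (fst c) (snd c)"

abbreviation coord_range :: "('g, 'n::finite) chart \<Rightarrow> (real^'n) set" where
  "coord_range c \<equiv> snd c ` fst c"

definition smooth_atlas :: "('g::topological_space, 'n::finite) chart set \<Rightarrow> bool" where
  "smooth_atlas A \<longleftrightarrow>
     (\<Union>c\<in>A. fst c) = UNIV \<and>
     (\<forall>c\<in>A. open (fst c) \<and> open (coord_range c) \<and>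
        homeomorphism (fst c) (coord_range c) (snd c) (param c)) \<and>
     (\<forall>c\<in>A. \<forall>d\<in>A. smooth_on (snd c ` (fst c \<inter> fst d)) (\<lambda>x. snd d (param c x)))"

definition smooth_fun :: "('g, 'n::finite) chart set \<Rightarrow> ('g \<Rightarrow> real) \<Rightarrow> bool" where
  "smooth_fun A f \<longleftrightarrow> (\<forall>c\<in>A. smooth_on (coord_range c) (\<lambda>x. f (param c x)))"


definition lie_group :: "'g::topological_space monoid \<Rightarrow> ('g, 'n::finite) chart set \<Rightarrow> bool" where
  "lie_group G A \<longleftrightarrow>
     group G \<and> carrier G = UNIV \<and> smooth_atlas A \<and>
     continuous_on UNIV (\<lambda>(g, h). g \<otimes>\<^bsub>G\<^esub> h) \<and>
     (\<forall>a\<in>A. \<forall>b\<in>A. \<forall>c\<in>A.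
        smooth_on {(x, y). x \<in> coord_range a \<and> y \<in> coord_range b \<and>
                           param a x \<otimes>\<^bsub>G\<^esub> param b y \<in> fst c}
                  (\<lambda>(x, y). snd c (param a x \<otimes>\<^bsub>G\<^esub> param b y))) \<and>
     continuous_on UNIV (\<lambda>g. inv\<^bsub>G\<^esub> g) \<and>
     (\<forall>a\<in>A. \<forall>c\<in>A.
        smooth_on {x \<in> coord_range a. inv\<^bsub>G\<^esub> (param a x) \<in> fst c}
                  (\<lambda>x. snd c (inv\<^bsub>G\<^esub> (param a x))))"


text \<open>
  Smooth vector fields are derivations of the algebra of smooth functions. They are total
  functions here, so they are normalised to be zero on functions that are not smooth;
  otherwise distinct elements could represent the same derivation.
\<close>

definition vector_field ::
  "('g, 'n::finite) chart set \<Rightarrow> (('g \<Rightarrow> real) \<Rightarrow> ('g \<Rightarrow> real)) \<Rightarrow> bool" where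
  "vector_field A D \<longleftrightarrow>
     (\<forall>f. smooth_fun A f \<longrightarrow> smooth_fun A (D f)) \<and>
     (\<forall>f. \<not> smooth_fun A f \<longrightarrow> D f = (\<lambda>p. 0)) \<and>
     (\<forall>f h r s. smooth_fun A f \<and> smooth_fun A h \<longrightarrow>
        D (\<lambda>p. r * f p + s * h p) = (\<lambda>p. r * D f p + s * D h p)) \<and>
     (\<forall>f h. smooth_fun A f \<and> smooth_fun A h \<longrightarrow>
        D (\<lambda>p. f p * h p) = (\<lambda>p. f p * D h p + h p * D f p))"

definition lie_bracket ::
  "(('g \<Rightarrow> real) \<Rightarrow> ('g \<Rightarrow> real)) \<Rightarrow> (('g \<Rightarrow> real) \<Rightarrow> ('g \<Rightarrow> real)) \<Rightarrow> (('g \<Rightarrow> real) \<Rightarrow> ('g \<Rightarrow> real))"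
  where "lie_bracket D E = (\<lambda>f p. D (E f) p - E (D f) p)"

text \<open>The Lie algebra of \<open>G\<close>: the left-invariant vector fields.\<close>

definition lie_algebra ::
  "'g monoid \<Rightarrow> ('g, 'n::finite) chart set \<Rightarrow> (('g \<Rightarrow> real) \<Rightarrow> ('g \<Rightarrow> real)) set" where
  "lie_algebra G A =
     {D. vector_field A D \<and>
         (\<forall>g f. smooth_fun A f \<longrightarrow> D (\<lambda>p. f (g \<otimes>\<^bsub>G\<^esub> p)) = (\<lambda>p. D f (g \<otimes>\<^bsub>G\<^esub> p)))}"

definition lie_ideal ::
  "'g monoid \<Rightarrow> ('g, 'n::finite) chart set \<Rightarrow> (('g \<Rightarrow> real) \<Rightarrow> ('g \<Rightarrow> real)) set \<Rightarrow> bool" where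
  "lie_ideal G A I \<longleftrightarrow>
     I \<subseteq> lie_algebra G A \<and> (\<lambda>f p. 0) \<in> I \<and>
     (\<forall>D\<in>I. \<forall>E\<in>I. \<forall>r s. (\<lambda>f p. r * D f p + s * E f p) \<in> I) \<and>
     (\<forall>D\<in>lie_algebra G A. \<forall>E\<in>I. lie_bracket D E \<in> I)"

text \<open>
  Semisimplicity in Bourbaki's form: the Lie algebra has no nonzero abelian ideal.
  The last nonzero term of the derived series of a solvable ideal is an abelian ideal,
  so this is the same as having no nonzero solvable ideal.
\<close>

definition semisimple_lie_group :: "'g::topological_space monoid \<Rightarrow> ('g, 'n::finite) chart set \<Rightarrow> bool" where
  "semisimple_lie_group G A \<longleftrightarrow>
     lie_group G A \<and>
     (\<forall>I. lie_ideal G A I \<and> (\<forall>D\<in>I. \<forall>E\<in>I. lie_bracket D E = (\<lambda>f p. 0)) \<longrightarrow>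
          I = {\<lambda>f p. 0})"


text \<open>
  Tangent vectors at \<open>p\<close> are derivations at \<open>p\<close>, again normalised to be zero
  on functions that are not smooth.
\<close>

definition tangent_space :: "('g, 'n::finite) chart set \<Rightarrow> 'g \<Rightarrow> (('g \<Rightarrow> real) \<Rightarrow> real) set" where
  "tangent_space A p =
     {X. (\<forall>f. \<not> smooth_fun A f \<longrightarrow> X f = 0) \<and>
         (\<forall>f h r s. smooth_fun A f \<and> smooth_fun A h \<longrightarrow>
            X (\<lambda>q. r * f q + s * h q) = r * X f + s * X h) \<and>
         (\<forall>f h. smooth_fun A f \<and> smooth_fun A h \<longrightarrow>
            X (\<lambda>q. f q * h q) = f p * X h + h p * X f)}"

definition coord_vector ::
  "('g, 'n::finite) chart set \<Rightarrow> ('g, 'n) chart \<Rightarrow> 'n \<Rightarrow> 'g \<Rightarrow> (('g \<Rightarrow> real) \<Rightarrow> real)" where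
  "coord_vector A c i p =
     (\<lambda>f. if smooth_fun A f then partial_deriv i (\<lambda>x. f (param c x)) (snd c p) else 0)"

text \<open>The metric coefficients in a chart, as functions of the coordinates.\<close>

definition metric_coeffs ::
  "('g, 'n::finite) chart set \<Rightarrow> ('g \<Rightarrow> (('g \<Rightarrow> real) \<Rightarrow> real) \<Rightarrow> (('g \<Rightarrow> real) \<Rightarrow> real) \<Rightarrow> real)
     \<Rightarrow> ('g, 'n) chart \<Rightarrow> real^'n \<Rightarrow> real^'n^'n" where
  "metric_coeffs A \<rho> c x =
     (\<chi> i j. \<rho> (param c x) (coord_vector A c i (param c x)) (coord_vector A c j (param c x)))"

definition riemannian_metric ::
  "('g, 'n::finite) chart set \<Rightarrow> ('g \<Rightarrow> (('g \<Rightarrow> real) \<Rightarrow> real) \<Rightarrow> (('g \<Rightarrow> real) \<Rightarrow> real) \<Rightarrow> real) \<Rightarrow> bool"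
  where
  "riemannian_metric A \<rho> \<longleftrightarrow>
     (\<forall>p. \<forall>X\<in>tangent_space A p. \<forall>Y\<in>tangent_space A p. \<forall>Z\<in>tangent_space A p. \<forall>r s.
        \<rho> p (\<lambda>f. r * X f + s * Y f) Z = r * \<rho> p X Z + s * \<rho> p Y Z) \<and>
     (\<forall>p. \<forall>X\<in>tangent_space A p. \<forall>Y\<in>tangent_space A p. \<rho> p X Y = \<rho> p Y X) \<and>
     (\<forall>p. \<forall>X\<in>tangent_space A p. X \<noteq> (\<lambda>f. 0) \<longrightarrow> \<rho> p X X > 0) \<and>
     (\<forall>c\<in>A. \<forall>i j. smooth_on (coord_range c) (\<lambda>x. metric_coeffs A \<rho> c x $ i $ j))"

text \<open>
  The differential of a diffeomorphism \<open>F\<close>, acting on tangent vectors. The normalisation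
  is preserved because \<open>f \<circ> F\<close> is smooth only if \<open>f\<close> is.
\<close>

definition push_forward :: "('g \<Rightarrow> 'g) \<Rightarrow> (('g \<Rightarrow> real) \<Rightarrow> real) \<Rightarrow> (('g \<Rightarrow> real) \<Rightarrow> real)" where
  "push_forward F X = (\<lambda>f. X (f \<circ> F))"

definition bi_invariant ::
  "'g monoid \<Rightarrow> ('g, 'n::finite) chart set
     \<Rightarrow> ('g \<Rightarrow> (('g \<Rightarrow> real) \<Rightarrow> real) \<Rightarrow> (('g \<Rightarrow> real) \<Rightarrow> real) \<Rightarrow> real) \<Rightarrow> bool" where
  "bi_invariant G A \<rho> \<longleftrightarrow>
     (\<forall>g p. \<forall>X\<in>tangent_space A p. \<forall>Y\<in>tangent_space A p.
        \<rho> (g \<otimes>\<^bsub>G\<^esub> p) (push_forward (\<lambda>q. g \<otimes>\<^bsub>G\<^esub> q) X) (push_forward (\<lambda>q. g \<otimes>\<^bsub>G\<^esub> q) Y)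
          = \<rho> p X Y \<and>
        \<rho> (p \<otimes>\<^bsub>G\<^esub> g) (push_forward (\<lambda>q. q \<otimes>\<^bsub>G\<^esub> g) X) (push_forward (\<lambda>q. q \<otimes>\<^bsub>G\<^esub> g) Y)
          = \<rho> p X Y)"

text \<open>
  The Laplace--Beltrami operator \<open>div grad\<close> in local coordinates,
  \<open>\<Delta> u = (1 / sqrt (det \<rho>)) \<Sum>\<^sub>i \<partial>\<^sub>i (sqrt (det \<rho>) \<Sum>\<^sub>j \<rho>\<^sup>i\<^sup>j \<partial>\<^sub>j u)\<close>.
  For smooth \<open>u\<close> the value at a point does not depend on the chart around the point.
\<close>

definition chart_laplacian ::
  "('g, 'n::finite) chart set \<Rightarrow> ('g \<Rightarrow> (('g \<Rightarrow> real) \<Rightarrow> real) \<Rightarrow> (('g \<Rightarrow> real) \<Rightarrow> real) \<Rightarrow> real)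
     \<Rightarrow> ('g, 'n) chart \<Rightarrow> ('g \<Rightarrow> real) \<Rightarrow> real^'n \<Rightarrow> real" where
  "chart_laplacian A \<rho> c u x =
     (\<Sum>i\<in>UNIV. partial_deriv i
        (\<lambda>y. sqrt (det (metric_coeffs A \<rho> c y)) *
             (\<Sum>j\<in>UNIV. matrix_inv (metric_coeffs A \<rho> c y) $ i $ j *
                         partial_deriv j (\<lambda>z. u (param c z)) y)) x)
     / sqrt (det (metric_coeffs A \<rho> c x))"

definition laplace_beltrami ::
  "('g, 'n::finite) chart set \<Rightarrow> ('g \<Rightarrow> (('g \<Rightarrow> real) \<Rightarrow> real) \<Rightarrow> (('g \<Rightarrow> real) \<Rightarrow> real) \<Rightarrow> real)
     \<Rightarrow> ('g \<Rightarrow> real) \<Rightarrow> ('g \<Rightarrow> real)" where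
  "laplace_beltrami A \<rho> u p =
     (let c = (SOME c. c \<in> A \<and> p \<in> fst c) in chart_laplacian A \<rho> c u (snd c p))"


definition group_representation ::
  "'g::topological_space monoid \<Rightarrow> ('g \<Rightarrow> 'v::euclidean_space \<Rightarrow> 'v) \<Rightarrow> bool" where
  "group_representation G \<sigma> \<longleftrightarrow>
     group_action G UNIV \<sigma> \<and> (\<forall>g. linear (\<sigma> g)) \<and> (\<forall>x. continuous_on UNIV (\<lambda>g. \<sigma> g x))"

text \<open>
  The invariant inner product is a parameter \<open>B\<close>: the one of the class
  \<open>euclidean_space\<close> need not be invariant and only serves to provide the
  topology of the finite-dimensional space.
\<close>

definition invariant_inner_product ::
  "('g \<Rightarrow> 'v::real_vector \<Rightarrow> 'v) \<Rightarrow> ('v \<Rightarrow> 'v \<Rightarrow> real) \<Rightarrow> bool" where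
  "invariant_inner_product \<sigma> B \<longleftrightarrow>
     bilinear B \<and> (\<forall>x y. B x y = B y x) \<and> (\<forall>x. x \<noteq> 0 \<longrightarrow> B x x > 0) \<and>
     (\<forall>g x y. B (\<sigma> g x) (\<sigma> g y) = B x y)"

definition matrix_element ::
  "('g \<Rightarrow> 'v \<Rightarrow> 'v) \<Rightarrow> ('v \<Rightarrow> 'v \<Rightarrow> real) \<Rightarrow> 'v \<Rightarrow> 'v \<Rightarrow> 'g \<Rightarrow> real" where
  "matrix_element \<sigma> B x y = (\<lambda>g. B (\<sigma> g x) y)"

definition matrix_elements :: "('g \<Rightarrow> 'v \<Rightarrow> 'v) \<Rightarrow> ('v \<Rightarrow> 'v \<Rightarrow> real) \<Rightarrow> ('g \<Rightarrow> real) set" where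
  "matrix_elements \<sigma> B =
     {\<lambda>g. \<Sum>k<m. r k * matrix_element \<sigma> B (x k) (y k) g |
        (m::nat) (r :: nat \<Rightarrow> real) (x :: nat \<Rightarrow> 'v) (y :: nat \<Rightarrow> 'v). True}"

text \<open>The spectrum of an operator on a finite-dimensional space of real functions: its eigenvalues.\<close>

definition spectrum_on :: "(('g \<Rightarrow> real) \<Rightarrow> ('g \<Rightarrow> real)) \<Rightarrow> ('g \<Rightarrow> real) set \<Rightarrow> real set" where
  "spectrum_on T M = {l. \<exists>u\<in>M. u \<noteq> (\<lambda>g. 0) \<and> T u = (\<lambda>g. l * u g)}"

end

theory Submission
  imports Defs
begin

text \<open>
  Let \<open>L\<close> be the common kernel of two functionals and let \<open>f = f\<^sub>1 + i f\<^sub>2\<close> be the matrix element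
  which they define on the orbit; suppose that \<open>f\<close> has no zero. Since \<open>G\<close> is semisimple it has only
  the trivial character, and averaging the shifts of the argument of \<open>f\<close> over \<open>G\<close> shows that \<open>f = r e\<^sup>i\<^sup>b\<close>
  with a continuous real function \<open>b\<close> on \<open>G\<close>. The Laplace operator is the Casimir operator \<open>C\<close>
  of the representation, which is symmetric; its only eigenvalue is \<open>\<lambda>\<close>, so that \<open>C = \<lambda>\<close> and
  \<open>f\<^sub>1\<close>, \<open>f\<^sub>2\<close> are eigenfunctions for \<open>\<lambda>\<close>. Hence \<open>div (r\<^sup>2 \<nabla>b) = 0\<close>, and integrating
  \<open>div (b r\<^sup>2 \<nabla>b) = r\<^sup>2 \<bar>\<nabla>b\<bar>\<^sup>2\<close> over \<open>G\<close> gives \<open>\<nabla>b = 0\<close>. Thus \<open>f\<close> is a constant multiple of a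
  positive eigenfunction, whose integral would have to vanish because \<open>\<lambda> \<noteq> 0\<close>.

  The only integral in use is the invariant mean of continuous functions on \<open>G\<close>.
\<close>

section \<open>Calculus of smooth maps\<close>

text \<open>The representation is only assumed continuous, while the Casimir operator, the
  differential of a character and the Laplacian of a matrix element all require derivatives. So
  differentiability of continuous homomorphisms is proved first, in coordinates at the unit, and
  then carried to other points by translation.

  Semisimplicity is available only as the absence of abelian ideals. An Ad-invariant vector spans a
  central ideal and hence vanishes; the bi-invariant metric turns invariant functionals into
  invariant vectors, and the differential of a character is an invariant functional.

  The obstacle to a global \<open>b\<close> is topological. It is bypassed because, for fixed
  \<open>g\<close>, the quotient of the phases at \<open>g h\<close> and \<open>h\<close> has a
  continuous argument in \<open>h\<close>: this holds for \<open>g\<close> near the unit and spreads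
  over the connected group.

  The Laplacian is defined in charts. It becomes the Casimir operator once it is written in the
  left-invariant frame, whose fields have no divergence.

  The mean is controlled by the supremum norm alone. Derivatives along left-invariant fields are
  therefore used as uniform first-order expansions, and integration by parts is right invariance of
  the mean.\<close>

lemma frechet_derivative_eqI:
  "(f has_derivative f') (at x) \<Longrightarrow> frechet_derivative f (at x) = f'"
  using frechet_derivative_at by metis

text \<open>Derivatives are taken in the whole space (\<open>at x\<close>), so agreement of two
  functions on \<open>S\<close> passes to their derivatives when \<open>S\<close> is open. This is
  why openness accompanies most of the rules that follow.\<close>

lemma Ck_on_cong:
  assumes "open S" "\<And>x. x \<in> S \<Longrightarrow> f x = g x" "Ck_on k S f"
  shows "Ck_on k S g"
  using assms
proof (induction k arbitrary: f g)
  case 0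
  then show ?case using continuous_on_cong[of S S f g] by auto
next
  case (Suc k)
  have d: "(g has_derivative frechet_derivative f (at x)) (at x)" if "x \<in> S" for x
  proof (rule has_derivative_transform_within_open[where f = f])
    show "(f has_derivative frechet_derivative f (at x)) (at x)"
      using Suc.prems that by (simp add: frechet_derivative_works)
  qed (use Suc.prems that in auto)
  then have eq: "frechet_derivative g (at x) = frechet_derivative f (at x)" if "x \<in> S" for x
    using frechet_derivative_eqI that by blast
  show ?case
    unfolding Ck_on.simps
  proof (intro conjI ballI allI)
    fix x assume "x \<in> S"
    then show "g differentiable at x" using d by (auto simp: differentiable_def)
  next
    fix v
    show "Ck_on k S (\<lambda>x. frechet_derivative g (at x) v)"
      by (rule Suc.IH[of "\<lambda>x. frechet_derivative f (at x) v"]) (use Suc.prems eq in auto)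
  qed
qed

lemma Ck_on_subset: "Ck_on k S f \<Longrightarrow> T \<subseteq> S \<Longrightarrow> Ck_on k T f"
  by (induction k arbitrary: f) (auto intro: continuous_on_subset)

lemma Ck_on_lower: "Ck_on (Suc k) S f \<Longrightarrow> Ck_on k S f"
proof (induction k arbitrary: f)
  case 0
  then show ?case
    by (auto intro: continuous_at_imp_continuous_on differentiable_imp_continuous_within)
next
  case (Suc k)
  then have "\<And>v. Ck_on (Suc k) S (\<lambda>x. frechet_derivative f (at x) v)" "\<forall>x\<in>S. f differentiable at x"
    by auto
  with Suc.IH show ?case unfolding Ck_on.simps(2)[of k S f] by blast
qed

lemma Ck_on_continuous: "Ck_on k S f \<Longrightarrow> continuous_on S f"
proof (induction k)
  case (Suc k)
  then show ?case using Ck_on_lower by blast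
qed simp

lemma Ck_on_local:
  assumes "\<And>x. x \<in> S \<Longrightarrow> \<exists>U. open U \<and> x \<in> U \<and> Ck_on k U f"
  shows "Ck_on k S f"
  using assms
proof (induction k arbitrary: f)
  case 0
  show ?case
    unfolding Ck_on.simps
  proof (rule continuous_at_imp_continuous_on, rule ballI)
    fix x assume "x \<in> S"
    then obtain U where "open U" "x \<in> U" "continuous_on U f" using 0 by auto
    then show "isCont f x" by (simp add: continuous_on_eq_continuous_at)
  qed
next
  case (Suc k)
  show ?case
    unfolding Ck_on.simps
  proof (intro conjI ballI allI)
    fix x assume "x \<in> S"
    then show "f differentiable at x" using Suc.prems by fastforce
  next
    fix v
    show "Ck_on k S (\<lambda>x. frechet_derivative f (at x) v)"
      by (rule Suc.IH) (use Suc.prems in fastforce)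
  qed
qed

lemma Ck_on_const: "Ck_on k S (\<lambda>x. c)"
  by (induction k arbitrary: c) auto

lemma Ck_on_bounded_linear:
  assumes "bounded_linear f"
  shows "Ck_on k S f"
proof (cases k)
  case 0
  then show ?thesis using assms by (simp add: linear_continuous_on)
next
  case (Suc m)
  have "(f has_derivative f) (at x)" for x using assms by (rule bounded_linear_imp_has_derivative)
  then have "frechet_derivative f (at x) = f" "f differentiable at x" for x
    using frechet_derivative_eqI by (blast, auto simp: differentiable_def)
  then show ?thesis by (simp add: Suc Ck_on_const)
qed

lemma Ck_on_add:
  assumes "open S" "Ck_on k S f" "Ck_on k S g"
  shows "Ck_on k S (\<lambda>x. f x + g x)"
  using assms
proof (induction k arbitrary: f g)
  case 0
  then show ?case by (auto intro: continuous_on_add)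
next
  case (Suc k)
  have d: "((\<lambda>x. f x + g x) has_derivative
      (\<lambda>v. frechet_derivative f (at x) v + frechet_derivative g (at x) v)) (at x)" if "x \<in> S" for x
    using Suc.prems that by (intro has_derivative_add) (auto simp: frechet_derivative_works)
  show ?case
    unfolding Ck_on.simps
  proof (intro conjI ballI allI)
    fix x assume "x \<in> S"
    then show "(\<lambda>x. f x + g x) differentiable at x" using d unfolding differentiable_def by blast
  next
    fix v
    show "Ck_on k S (\<lambda>x. frechet_derivative (\<lambda>x. f x + g x) (at x) v)"
      by (rule Ck_on_cong[OF Suc.prems(1) _ Suc.IH[of "\<lambda>x. frechet_derivative f (at x) v"
              "\<lambda>x. frechet_derivative g (at x) v"]])
        (use Suc.prems frechet_derivative_eqI[OF d] in auto)
  qed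
qed

text \<open>Covers products, scalar multiples and inner products at once. The product rule returns
  terms of the same shape with one factor undifferentiated, so the induction also needs that factor
  in the lower class.\<close>

lemma Ck_on_bilinear:
  assumes h: "bounded_bilinear h" and "open S" "Ck_on k S f" "Ck_on k S g"
  shows "Ck_on k S (\<lambda>x. h (f x) (g x))"
  using assms(2-)
proof (induction k arbitrary: f g)
  case 0
  then show ?case using bounded_bilinear.continuous_on[OF h] by auto
next
  case (Suc k)
  have d: "((\<lambda>x. h (f x) (g x)) has_derivative
      (\<lambda>v. h (f x) (frechet_derivative g (at x) v) + h (frechet_derivative f (at x) v) (g x))) (at x)"
    if "x \<in> S" for x
    using Suc.prems that by (intro bounded_bilinear.FDERIV[OF h]) (auto simp: frechet_derivative_works)
  show ?case
    unfolding Ck_on.simps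
  proof (intro conjI ballI allI)
    fix x assume "x \<in> S"
    then show "(\<lambda>x. h (f x) (g x)) differentiable at x" using d unfolding differentiable_def by blast
  next
    fix v
    have "Ck_on k S f" "Ck_on k S g" using Suc.prems Ck_on_lower by blast+
    then have "Ck_on k S (\<lambda>x. h (f x) (frechet_derivative g (at x) v) + h (frechet_derivative f (at x) v) (g x))"
      using Suc.prems by (intro Ck_on_add Suc.IH) auto
    then show "Ck_on k S (\<lambda>x. frechet_derivative (\<lambda>x. h (f x) (g x)) (at x) v)"
      by (rule Ck_on_cong[OF Suc.prems(1), rotated]) (use frechet_derivative_eqI[OF d] in auto)
  qed
qed

lemmas Ck_on_mult = Ck_on_bilinear[OF bounded_bilinear_mult]
lemmas Ck_on_scaleR = Ck_on_bilinear[OF bounded_bilinear_scaleR]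

lemma Ck_on_sum:
  assumes "open S" "\<And>i. i \<in> I \<Longrightarrow> Ck_on k S (f i)"
  shows "Ck_on k S (\<lambda>x. \<Sum>i\<in>I. f i x)"
  using assms(2)
proof (induction I rule: infinite_finite_induct)
  case (insert i I)
  then have "Ck_on k S (\<lambda>x. f i x + (\<Sum>i\<in>I. f i x))" by (intro Ck_on_add assms(1)) auto
  with insert show ?case by simp
qed (simp_all add: Ck_on_const)

lemma Ck_on_frechet: "Ck_on (Suc k) S f \<Longrightarrow> Ck_on k S (\<lambda>x. frechet_derivative f (at x) v)"
  by simp

text \<open>\<open>Ck_on\<close> speaks of derivatives in fixed directions. The expansion in the
  basis reduces to them a direction that varies with the point, as it does in the chain rule or for
  a vector field.\<close>

lemma frechet_derivative_euclidean:
  fixes f :: "'a::euclidean_space \<Rightarrow> 'b::real_normed_vector"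
  assumes "f differentiable at x"
  shows "frechet_derivative f (at x) v = (\<Sum>b\<in>Basis. (v \<bullet> b) *\<^sub>R frechet_derivative f (at x) b)"
proof -
  interpret bounded_linear "frechet_derivative f (at x)"
    using assms by (meson frechet_derivative_works has_derivative_bounded_linear)
  have "frechet_derivative f (at x) (\<Sum>b\<in>Basis. (v \<bullet> b) *\<^sub>R b)
      = (\<Sum>b\<in>Basis. (v \<bullet> b) *\<^sub>R frechet_derivative f (at x) b)"
    by (simp add: sum scaleR)
  then show ?thesis by (simp add: euclidean_representation)
qed

lemma Ck_on_inner: "open S \<Longrightarrow> Ck_on k S f \<Longrightarrow> Ck_on k S (\<lambda>x. f x \<bullet> b)"
  by (rule Ck_on_bilinear[OF bounded_bilinear_inner]) (auto intro: Ck_on_const)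

lemma Ck_on_compose:
  fixes f :: "'a::euclidean_space \<Rightarrow> 'b::euclidean_space" and g :: "'b \<Rightarrow> 'c::real_normed_vector"
  assumes "open S" "f ` S \<subseteq> T" "Ck_on k S f" "Ck_on k T g"
  shows "Ck_on k S (\<lambda>x. g (f x))"
  using assms(2-)
proof (induction k arbitrary: g)
  case 0
  then show ?case by (auto intro: continuous_on_compose2)
next
  case (Suc k)
  have d: "((\<lambda>x. g (f x)) has_derivative
      (\<lambda>v. frechet_derivative g (at (f x)) (frechet_derivative f (at x) v))) (at x)" if "x \<in> S" for x
    using Suc.prems that
    by (intro has_derivative_compose[of f _ x UNIV g]) (auto simp: frechet_derivative_works image_subset_iff)
  show ?case
    unfolding Ck_on.simps
  proof (intro conjI ballI allI)
    fix x assume "x \<in> S"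
    then show "(\<lambda>x. g (f x)) differentiable at x" using d unfolding differentiable_def by blast
  next
    fix v
    have 1: "Ck_on k S (\<lambda>x. \<Sum>b\<in>Basis. (frechet_derivative f (at x) v \<bullet> b) *\<^sub>R frechet_derivative g (at (f x)) b)"
    proof (intro Ck_on_sum Ck_on_scaleR Ck_on_inner assms(1))
      show "Ck_on k S (\<lambda>x. frechet_derivative f (at x) v)" using Suc.prems by simp
      show "Ck_on k S (\<lambda>x. frechet_derivative g (at (f x)) b)" if "b \<in> Basis" for b
        by (rule Suc.IH) (use Suc.prems Ck_on_lower[OF Suc.prems(2)] in auto)
    qed
    show "Ck_on k S (\<lambda>x. frechet_derivative (\<lambda>x. g (f x)) (at x) v)"
    proof (rule Ck_on_cong[OF assms(1) _ 1])
      fix x assume x: "x \<in> S"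
      have "frechet_derivative (\<lambda>x. g (f x)) (at x) v = frechet_derivative g (at (f x)) (frechet_derivative f (at x) v)"
        using frechet_derivative_eqI[OF d[OF x]] by simp
      also have "\<dots> = (\<Sum>b\<in>Basis. (frechet_derivative f (at x) v \<bullet> b) *\<^sub>R frechet_derivative g (at (f x)) b)"
        by (rule frechet_derivative_euclidean) (use Suc.prems x in auto)
      finally show "(\<Sum>b\<in>Basis. (frechet_derivative f (at x) v \<bullet> b) *\<^sub>R frechet_derivative g (at (f x)) b)
        = frechet_derivative (\<lambda>x. g (f x)) (at x) v" by simp
    qed
  qed
qed

lemma Ck_on_linear_compose:
  fixes f :: "'a::euclidean_space \<Rightarrow> 'b::euclidean_space"
  assumes "open S" "bounded_linear g" "Ck_on k S f"
  shows "Ck_on k S (\<lambda>x. g (f x))"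
  by (rule Ck_on_compose[where T = UNIV]) (use assms Ck_on_bounded_linear in auto)

lemma Ck_on_Pair:
  fixes f :: "'a::euclidean_space \<Rightarrow> 'b::euclidean_space" and g :: "'a \<Rightarrow> 'c::euclidean_space"
  assumes "open S" "Ck_on k S f" "Ck_on k S g"
  shows "Ck_on k S (\<lambda>x. (f x, g x))"
proof -
  have "Ck_on k S (\<lambda>x. (f x, 0::'c) + (0::'b, g x))"
    by (intro Ck_on_add Ck_on_linear_compose[where g = "\<lambda>a. (a, 0)"]
        Ck_on_linear_compose[where g = "\<lambda>a. (0, a)"] assms)
      (auto intro: bounded_linear_Pair bounded_linear_ident bounded_linear_zero)
  then show ?thesis by simp
qed

lemma smooth_onD: "smooth_on S f \<Longrightarrow> Ck_on k S f"
  by (simp add: smooth_on_def)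

lemma smooth_on_differentiable: "smooth_on S f \<Longrightarrow> x \<in> S \<Longrightarrow> f differentiable at x"
  using smooth_onD[of S f 1] by simp

lemma smooth_on_has_derivative:
  "smooth_on S f \<Longrightarrow> x \<in> S \<Longrightarrow> (f has_derivative frechet_derivative f (at x)) (at x)"
  using smooth_on_differentiable frechet_derivative_works by blast

lemma smooth_on_cong: "open S \<Longrightarrow> (\<And>x. x \<in> S \<Longrightarrow> f x = g x) \<Longrightarrow> smooth_on S f \<Longrightarrow> smooth_on S g"
  unfolding smooth_on_def using Ck_on_cong by blast

lemma smooth_on_subset: "smooth_on S f \<Longrightarrow> T \<subseteq> S \<Longrightarrow> smooth_on T f"
  unfolding smooth_on_def using Ck_on_subset by blast

lemma smooth_on_local:
  assumes "\<And>x. x \<in> S \<Longrightarrow> \<exists>U. open U \<and> x \<in> U \<and> smooth_on U f"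
  shows "smooth_on S f"
  unfolding smooth_on_def by (intro allI Ck_on_local) (use assms smooth_on_def in blast)

lemma smooth_on_const: "smooth_on S (\<lambda>x. c)"
  by (simp add: smooth_on_def Ck_on_const)

lemma smooth_on_bounded_linear: "bounded_linear f \<Longrightarrow> smooth_on S f"
  by (simp add: smooth_on_def Ck_on_bounded_linear)

lemma smooth_on_add: "open S \<Longrightarrow> smooth_on S f \<Longrightarrow> smooth_on S g \<Longrightarrow> smooth_on S (\<lambda>x. f x + g x)"
  by (simp add: smooth_on_def Ck_on_add)

lemma smooth_on_mult:
  fixes f g :: "'a::euclidean_space \<Rightarrow> 'b::real_normed_algebra"
  shows "open S \<Longrightarrow> smooth_on S f \<Longrightarrow> smooth_on S g \<Longrightarrow> smooth_on S (\<lambda>x. f x * g x)"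
  by (simp add: smooth_on_def Ck_on_mult)

lemma smooth_on_scaleR:
  "open S \<Longrightarrow> smooth_on S f \<Longrightarrow> smooth_on S g \<Longrightarrow> smooth_on S (\<lambda>x. f x *\<^sub>R g x)"
  by (simp add: smooth_on_def Ck_on_scaleR)

lemma smooth_on_sum:
  "open S \<Longrightarrow> (\<And>i. i \<in> I \<Longrightarrow> smooth_on S (f i)) \<Longrightarrow> smooth_on S (\<lambda>x. \<Sum>i\<in>I. f i x)"
  by (simp add: smooth_on_def Ck_on_sum)

lemma smooth_on_inner: "open S \<Longrightarrow> smooth_on S f \<Longrightarrow> smooth_on S (\<lambda>x. f x \<bullet> b)"
  by (simp add: smooth_on_def Ck_on_inner)

lemma smooth_on_compose:
  fixes f :: "'a::euclidean_space \<Rightarrow> 'b::euclidean_space" and g :: "'b \<Rightarrow> 'c::real_normed_vector"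
  shows "open S \<Longrightarrow> f ` S \<subseteq> T \<Longrightarrow> smooth_on S f \<Longrightarrow> smooth_on T g \<Longrightarrow> smooth_on S (\<lambda>x. g (f x))"
  unfolding smooth_on_def using Ck_on_compose by blast

lemma smooth_on_Pair:
  fixes f :: "'a::euclidean_space \<Rightarrow> 'b::euclidean_space" and g :: "'a \<Rightarrow> 'c::euclidean_space"
  shows "open S \<Longrightarrow> smooth_on S f \<Longrightarrow> smooth_on S g \<Longrightarrow> smooth_on S (\<lambda>x. (f x, g x))"
  by (simp add: smooth_on_def Ck_on_Pair)

lemma smooth_on_frechet: "smooth_on S f \<Longrightarrow> smooth_on S (\<lambda>x. frechet_derivative f (at x) v)"
  unfolding smooth_on_def using Ck_on_frechet by blast

lemma smooth_on_frechet_apply: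
  fixes f :: "'a::euclidean_space \<Rightarrow> 'b::real_normed_vector"
  assumes "open S" "smooth_on S f" "smooth_on S w"
  shows "smooth_on S (\<lambda>x. frechet_derivative f (at x) (w x))"
proof (rule smooth_on_cong[OF assms(1)])
  show "smooth_on S (\<lambda>x. \<Sum>b\<in>Basis. (w x \<bullet> b) *\<^sub>R frechet_derivative f (at x) b)"
    using assms by (intro smooth_on_sum smooth_on_scaleR smooth_on_inner smooth_on_frechet)
  show "(\<Sum>b\<in>Basis. (w x \<bullet> b) *\<^sub>R frechet_derivative f (at x) b) = frechet_derivative f (at x) (w x)"
    if "x \<in> S" for x
    using frechet_derivative_euclidean[OF smooth_on_differentiable[OF assms(2) that], of "w x"] by simp
qed

lemma smooth_on_vec_nth:
  fixes f :: "'a::euclidean_space \<Rightarrow> real^'n"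
  shows "open S \<Longrightarrow> smooth_on S f \<Longrightarrow> smooth_on S (\<lambda>x. f x $ i)"
  using smooth_on_inner[of S f "axis i 1"] by (simp add: inner_axis)

section \<open>Symmetry of second derivatives\<close>

lemma has_real_derivative_along_line:
  fixes f :: "'a::real_normed_vector \<Rightarrow> real"
  assumes "(f has_derivative f') (at (u + s *\<^sub>R v))"
  shows "((\<lambda>t. f (u + t *\<^sub>R v)) has_real_derivative f' v) (at s)"
proof -
  interpret bounded_linear f' using assms by (rule has_derivative_bounded_linear)
  have "((\<lambda>t. u + t *\<^sub>R v) has_derivative (\<lambda>h. h *\<^sub>R v)) (at s)"
    by (auto intro!: derivative_eq_intros)
  from has_derivative_compose[OF this assms]
  show ?thesis by (simp add: has_field_derivative_def scaleR mult_commute_abs)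
qed

text \<open>Two mean value theorems: along \<open>v\<close> for the difference of \<open>f\<close>
  across the side \<open>h *\<^sub>R w\<close> of a parallelogram, then along \<open>w\<close> for
  the derivative in direction \<open>v\<close>. The left side is symmetric in \<open>v\<close> and
  \<open>w\<close>, which is what makes the formula useful.\<close>

lemma second_difference_mvt:
  fixes f :: "'a::euclidean_space \<Rightarrow> real"
  assumes "Ck_on 2 S f" "ball x r \<subseteq> S" "0 < h" "h * (norm v + norm w) < r"
  shows "\<exists>y\<in>ball x r. f (x + h *\<^sub>R v + h *\<^sub>R w) - f (x + h *\<^sub>R v) - f (x + h *\<^sub>R w) + f x
      = h * (h * frechet_derivative (\<lambda>x. frechet_derivative f (at x) v) (at y) w)"
proof -
  have in_ball: "x + s *\<^sub>R v + t *\<^sub>R w \<in> ball x r" if "0 \<le> s" "s \<le> h" "0 \<le> t" "t \<le> h" for s t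
  proof -
    have "norm (s *\<^sub>R v + t *\<^sub>R w) \<le> s * norm v + t * norm w"
      using that norm_triangle_ineq[of "s *\<^sub>R v" "t *\<^sub>R w"] by simp
    also have "\<dots> \<le> h * norm v + h * norm w" using that by (intro add_mono mult_right_mono) auto
    also have "\<dots> < r" using assms(4) by (simp add: algebra_simps)
    finally have "norm (s *\<^sub>R v + t *\<^sub>R w) < r" .
    moreover have "dist x (x + s *\<^sub>R v + t *\<^sub>R w) = norm (s *\<^sub>R v + t *\<^sub>R w)"
      unfolding dist_norm by (metis add.assoc add_diff_cancel_left' norm_minus_commute)
    ultimately show ?thesis by simp
  qed
  have C1: "f differentiable at y" "(\<lambda>x. frechet_derivative f (at x) v) differentiable at y"
    if "y \<in> ball x r" for y
    using assms(1,2) that by (auto simp: numeral_2_eq_2)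
  let ?g = "\<lambda>s. f (x + s *\<^sub>R v + h *\<^sub>R w) - f (x + s *\<^sub>R v)"
  have line: "((\<lambda>t. f (u + t *\<^sub>R v)) has_real_derivative frechet_derivative f (at (u + s *\<^sub>R v)) v) (at s)"
    if "u + s *\<^sub>R v \<in> ball x r" for u s
    by (rule has_real_derivative_along_line) (use C1(1)[OF that] frechet_derivative_works in blast)
  have "\<exists>z>0. z < h \<and> ?g h - ?g 0 = (h - 0) * (frechet_derivative f (at (x + z *\<^sub>R v + h *\<^sub>R w)) v
      - frechet_derivative f (at (x + z *\<^sub>R v)) v)"
  proof (rule MVT2)
    fix s assume s: "0 \<le> s" "s \<le> h"
    have 1: "x + h *\<^sub>R w + s *\<^sub>R v = x + s *\<^sub>R v + h *\<^sub>R w" for s by simp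
    show "(?g has_real_derivative frechet_derivative f (at (x + s *\<^sub>R v + h *\<^sub>R w)) v
      - frechet_derivative f (at (x + s *\<^sub>R v)) v) (at s)"
      using line[of "x + h *\<^sub>R w" s] line[of x s] in_ball[of s h] in_ball[of s 0] s assms(3)
      by (intro DERIV_diff) (simp_all add: 1)
  qed (use assms in auto)
  then obtain z where z: "0 < z" "z < h" "?g h - ?g 0 = h * (frechet_derivative f (at (x + z *\<^sub>R v + h *\<^sub>R w)) v
      - frechet_derivative f (at (x + z *\<^sub>R v)) v)" by auto
  have "\<exists>y>0. y < h \<and> frechet_derivative f (at (x + z *\<^sub>R v + h *\<^sub>R w)) v
      - frechet_derivative f (at (x + z *\<^sub>R v + 0 *\<^sub>R w)) v
      = (h - 0) * frechet_derivative (\<lambda>x. frechet_derivative f (at x) v) (at (x + z *\<^sub>R v + y *\<^sub>R w)) w"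
  proof (rule MVT2)
    fix t assume t: "0 \<le> t" "t \<le> h"
    show "((\<lambda>t. frechet_derivative f (at (x + z *\<^sub>R v + t *\<^sub>R w)) v) has_real_derivative
        frechet_derivative (\<lambda>x. frechet_derivative f (at x) v) (at (x + z *\<^sub>R v + t *\<^sub>R w)) w) (at t)"
      by (rule has_real_derivative_along_line)
        (use C1(2)[OF in_ball[of z t]] z t frechet_derivative_works in \<open>simp; blast\<close>)
  qed (use assms in auto)
  then obtain y where y: "0 < y" "y < h" "frechet_derivative f (at (x + z *\<^sub>R v + h *\<^sub>R w)) v
      - frechet_derivative f (at (x + z *\<^sub>R v)) v
      = h * frechet_derivative (\<lambda>x. frechet_derivative f (at x) v) (at (x + z *\<^sub>R v + y *\<^sub>R w)) w"
    by auto
  show ?thesis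
    by (rule bexI[of _ "x + z *\<^sub>R v + y *\<^sub>R w"]) (use z y in_ball[of z y] in auto)
qed

text \<open>By the symmetry of the second difference, the two mixed derivatives take a common value
  at two points arbitrarily near \<open>x\<close>; continuity then identifies them at
  \<open>x\<close>.\<close>

lemma mixed_derivatives_commute:
  fixes f :: "'a::euclidean_space \<Rightarrow> real"
  assumes "Ck_on 2 S f" "open S" "x \<in> S"
  shows "frechet_derivative (\<lambda>x. frechet_derivative f (at x) v) (at x) w
       = frechet_derivative (\<lambda>x. frechet_derivative f (at x) w) (at x) v" (is "?A x = ?B x")
proof (rule ccontr)
  assume neq: "?A x \<noteq> ?B x"
  define e where "e = \<bar>?A x - ?B x\<bar> / 2"
  have e: "e > 0" using neq by (simp add: e_def)
  have "continuous_on S ?A" "continuous_on S ?B"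
    using assms(1) by (auto simp: numeral_2_eq_2)
  then have "isCont ?A x" "isCont ?B x" using assms by (auto simp: continuous_on_eq_continuous_at)
  then obtain d1 d2 where d: "d1 > 0" "d2 > 0"
    "\<And>y. dist y x < d1 \<Longrightarrow> dist (?A y) (?A x) < e" "\<And>y. dist y x < d2 \<Longrightarrow> dist (?B y) (?B x) < e"
    using e unfolding continuous_at_eps_delta by metis
  obtain r0 where r0: "r0 > 0" "ball x r0 \<subseteq> S" using assms openE by blast
  define r where "r = min r0 (min d1 d2)"
  have r: "r > 0" "ball x r \<subseteq> S" using r0 d by (auto simp: r_def)
  \<comment> \<open>The summand 1 avoids a zero denominator when \<open>v = w = 0\<close> and leaves
    the parallelogram strictly inside the ball.\<close>
  define h where "h = r / (norm v + norm w + 1)"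
  have pos: "0 < norm v + norm w + 1" by (simp add: add_nonneg_pos)
  then have h: "h > 0" using r by (simp add: h_def)
  have "h * (norm v + norm w) < h * (norm v + norm w + 1)" using h by simp
  also have "\<dots> = r" using pos by (simp add: h_def)
  finally have hr: "h * (norm v + norm w) < r" .
  obtain y where y: "y \<in> ball x r" "f (x + h *\<^sub>R v + h *\<^sub>R w) - f (x + h *\<^sub>R v) - f (x + h *\<^sub>R w) + f x = h * (h * ?A y)"
    using second_difference_mvt[OF assms(1) r(2) h hr] by blast
  obtain z where z: "z \<in> ball x r" "f (x + h *\<^sub>R w + h *\<^sub>R v) - f (x + h *\<^sub>R w) - f (x + h *\<^sub>R v) + f x = h * (h * ?B z)"
    using second_difference_mvt[OF assms(1) r(2) h, of w v] hr by (auto simp: add.commute)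
  have "f (x + h *\<^sub>R w + h *\<^sub>R v) = f (x + h *\<^sub>R v + h *\<^sub>R w)" by (simp add: add_ac)
  then have "h * (h * ?A y) = h * (h * ?B z)" using y(2) z(2) by linarith
  then have "?A y = ?B z" using h by simp
  moreover have "dist (?A y) (?A x) < e" "dist (?B z) (?B x) < e"
    using y(1) z(1) by (auto simp: r_def dist_commute[of x] intro!: d)
  ultimately show False unfolding e_def dist_real_def by (simp add: field_simps abs_if split: if_splits)
qed

section \<open>Bump functions\<close>

text \<open>The powers in the denominator close the family under differentiation up to linear
  combinations, so that smoothness of \<open>exp (- 1 / t)\<close> extended by zero is an induction
  for all \<open>k\<close> at once.\<close>

definition flat :: "nat \<Rightarrow> real \<Rightarrow> real" where
  "flat k t = (if t > 0 then exp (- 1 / t) / t ^ k else 0)"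

lemma flat_tendsto_0: "((\<lambda>t. exp (- 1 / t) / t ^ k) \<longlongrightarrow> 0) (at_right (0::real))"
proof -
  have "((\<lambda>x. x ^ k / exp x) \<longlongrightarrow> 0) (at_top :: real filter)" by (rule tendsto_power_div_exp_0)
  then have "((\<lambda>t. inverse t ^ k / exp (inverse t)) \<longlongrightarrow> 0) (at_right (0::real))"
    by (rule filterlim_compose) (rule filterlim_inverse_at_top_right)
  then show ?thesis by (simp add: exp_minus field_simps inverse_eq_divide)
qed

lemma flat_derivative:
  "(flat k has_real_derivative flat (k + 2) t - real k * flat (k + 1) t) (at t)"
proof -
  consider "t > 0" | "t < 0" | "t = 0" by linarith
  then show ?thesis
  proof cases
    case 1
    have "((\<lambda>t. exp (- 1 / t) / t ^ k) has_real_derivative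
      (exp (- 1 / t) * (1 / t ^ 2)) / t ^ k - exp (- 1 / t) * (real k * t ^ (k - 1)) / (t ^ k * t ^ k)) (at t)"
      using 1 by (auto intro!: derivative_eq_intros simp: power2_eq_square field_simps)
    also have "(exp (- 1 / t) * (1 / t ^ 2)) / t ^ k - exp (- 1 / t) * (real k * t ^ (k - 1)) / (t ^ k * t ^ k)
        = flat (k + 2) t - real k * flat (k + 1) t"
      using 1 by (cases k) (auto simp: flat_def field_simps power2_eq_square)
    finally show ?thesis
      by (rule has_field_derivative_transform_within_open[where S = "{0<..}"]) (use 1 in \<open>auto simp: flat_def\<close>)
  next
    case 2
    have "((\<lambda>t. 0) has_real_derivative 0) (at t)" by simp
    then have "(flat k has_real_derivative 0) (at t)"
      by (rule has_field_derivative_transform_within_open[where S = "{..<0}"]) (use 2 in \<open>auto simp: flat_def\<close>)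
    then show ?thesis using 2 by (simp add: flat_def)
  next
    case 3
    \<comment> \<open>To the right of 0 the difference quotient is
      \<open>exp (- 1 / y) / y ^ Suc k\<close>, to the left it is 0.\<close>
    have "((\<lambda>y. (flat k y - flat k 0) / (y - 0)) \<longlongrightarrow> 0) (at 0)"
      unfolding filterlim_split_at_real
    proof (intro filterlim_split_at)
      show "((\<lambda>y. (flat k y - flat k 0) / (y - 0)) \<longlongrightarrow> 0) (at_left 0)"
        by (rule tendsto_eventually) (auto simp: eventually_at_filter flat_def)
      show "((\<lambda>y. (flat k y - flat k 0) / (y - 0)) \<longlongrightarrow> 0) (at_right 0)"
        by (rule Lim_transform_eventually[OF flat_tendsto_0[of "Suc k"]])
          (auto simp: eventually_at_filter flat_def)
    qed
    then show ?thesis using 3 by (simp add: has_field_derivative_iff flat_def)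
  qed
qed

lemma Ck_on_flat: "Ck_on m UNIV (flat k)"
proof (induction m arbitrary: k)
  case 0
  show ?case using flat_derivative by (auto intro!: DERIV_continuous_on)
next
  case (Suc m)
  have d: "(flat k has_derivative (\<lambda>v. (flat (k + 2) t - real k * flat (k + 1) t) * v)) (at t)" for t
    using flat_derivative[of k t] by (simp add: has_field_derivative_def)
  have "Ck_on m UNIV (\<lambda>t. (flat (k + 2) t + (- real k) * flat (k + 1) t) * v)" for v
    by (intro Ck_on_mult Ck_on_add Ck_on_const Suc.IH open_UNIV)
  then show ?case using d by (auto simp: frechet_derivative_eqI[OF d] differentiable_def)
qed

lemma smooth_bump:
  fixes p :: "'a::euclidean_space"
  assumes "r > 0"
  obtains \<beta> :: "'a \<Rightarrow> real" where "smooth_on UNIV \<beta>" "\<beta> p = 1" "\<And>x. norm (x - p) \<ge> r \<Longrightarrow> \<beta> x = 0"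
proof
  let ?c = "flat 0 (r\<^sup>2)"
  let ?\<beta> = "\<lambda>x. flat 0 (r\<^sup>2 + (- 1) * ((x + - p) \<bullet> (x + - p))) * (1 / ?c)"
  show "smooth_on UNIV ?\<beta>"
    unfolding smooth_on_def
  proof
    fix k
    have 1: "Ck_on k UNIV (\<lambda>x::'a. x + - p)"
      by (intro Ck_on_add Ck_on_const Ck_on_bounded_linear bounded_linear_ident open_UNIV)
    have "Ck_on k UNIV (\<lambda>x. r\<^sup>2 + (- 1) * ((x + - p) \<bullet> (x + - p)))"
      by (intro Ck_on_add Ck_on_mult Ck_on_const Ck_on_bilinear[OF bounded_bilinear_inner] 1 open_UNIV)
    from Ck_on_compose[OF open_UNIV subset_UNIV this Ck_on_flat]
    have "Ck_on k UNIV (\<lambda>x. flat 0 (r\<^sup>2 + (- 1) * ((x + - p) \<bullet> (x + - p))))" .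
    then show "Ck_on k UNIV ?\<beta>" by (rule Ck_on_mult[OF open_UNIV _ Ck_on_const])
  qed
  show "?\<beta> p = 1" using assms by (simp add: flat_def)
  show "?\<beta> x = 0" if "norm (x - p) \<ge> r" for x
  proof -
    have "r\<^sup>2 \<le> (norm (x - p))\<^sup>2" using that assms by (intro power_mono) auto
    then show ?thesis by (simp add: flat_def power2_norm_eq_inner)
  qed
qed

section \<open>Hadamard's lemma\<close>

lemma radial_in_ball:
  fixes x :: "'a::euclidean_space"
  assumes "x \<in> ball x0 r" "t \<in> {0..1}"
  shows "x0 + t *\<^sub>R (x - x0) \<in> ball x0 r"
proof -
  have "t * norm (x - x0) \<le> norm (x - x0)" using assms by (intro mult_left_le_one_le) auto
  then show ?thesis using assms by (simp add: dist_norm norm_minus_commute)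
qed

text \<open>Each differentiation under the integral sign brings out a factor \<open>t\<close> from
  the inner function; the weight \<open>t ^ m\<close> with arbitrary \<open>m\<close> absorbs it and
  makes the induction on \<open>k\<close> close.\<close>

lemma Ck_on_radial_integral:
  fixes w :: "'a::euclidean_space \<Rightarrow> real"
  assumes "Ck_on k (ball x0 r) w"
  shows "Ck_on k (ball x0 r) (\<lambda>x. integral {0..1} (\<lambda>t. t ^ m * w (x0 + t *\<^sub>R (x - x0))))"
  using assms
proof (induction k arbitrary: m w)
  case 0
  have line: "continuous_on A (\<lambda>p. x0 + snd p *\<^sub>R (fst p - x0))" for A :: "('a \<times> real) set"
    by (intro continuous_intros)
  have "continuous_on (ball x0 r \<times> cbox 0 1) (\<lambda>p. w (x0 + snd p *\<^sub>R (fst p - x0)))"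
    by (rule continuous_on_compose2[OF _ line]) (use 0 radial_in_ball[of _ x0 r] in \<open>auto simp del: mem_ball\<close>)
  then have "continuous_on (ball x0 r \<times> cbox 0 1) (\<lambda>(x, t::real). t ^ m * w (x0 + t *\<^sub>R (x - x0)))"
    unfolding split_beta by (intro continuous_on_mult continuous_on_power continuous_on_snd continuous_on_id)
  from integral_continuous_on_param[OF this] show ?case by (simp add: cbox_interval)
next
  case (Suc k)
  let ?B = "ball x0 r"
  let ?D = "\<lambda>v x. integral {0..1} (\<lambda>t. t ^ Suc m * frechet_derivative w (at (x0 + t *\<^sub>R (x - x0))) v)"
  let ?f = "\<lambda>x t. t ^ m * w (x0 + t *\<^sub>R (x - x0))"
  define F where "F x t = Blinfun (\<lambda>v. t ^ Suc m * frechet_derivative w (at (x0 + t *\<^sub>R (x - x0))) v)" for x t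
  have wd: "(w has_derivative frechet_derivative w (at y)) (at y)" if "y \<in> ?B" for y
    using Suc.prems that by (simp add: frechet_derivative_works)
  have cw: "continuous_on ?B (\<lambda>x. frechet_derivative w (at x) v)" for v
    by (rule Ck_on_continuous[OF Ck_on_frechet[OF Suc.prems]])
  have F: "blinfun_apply (F x t) = (\<lambda>v. t ^ Suc m * frechet_derivative w (at (x0 + t *\<^sub>R (x - x0))) v)"
    if "x \<in> ?B" "t \<in> {0..1}" for x t
    unfolding F_def
    by (rule bounded_linear_Blinfun_apply)
      (rule bounded_linear_const_mult[OF has_derivative_bounded_linear[OF wd[OF radial_in_ball[OF that]]]])
  have fd: "((\<lambda>x. ?f x t) has_derivative blinfun_apply (F x t)) (at x within ?B)"
    if "x \<in> ?B" "t \<in> cbox 0 1" for x t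
  proof -
    have t: "t \<in> {0..1}" using that by simp
    interpret bounded_linear "frechet_derivative w (at (x0 + t *\<^sub>R (x - x0)))"
      using has_derivative_bounded_linear[OF wd[OF radial_in_ball[OF that(1) t]]] .
    have "((\<lambda>x. x0 + t *\<^sub>R (x - x0)) has_derivative (\<lambda>v. t *\<^sub>R v)) (at x within ?B)"
      by (auto intro!: derivative_eq_intros)
    from has_derivative_compose[OF this wd[OF radial_in_ball[OF that(1) t]]]
    have "((\<lambda>x. ?f x t) has_derivative (\<lambda>v. t ^ m * frechet_derivative w (at (x0 + t *\<^sub>R (x - x0))) (t *\<^sub>R v)))
      (at x within ?B)" by (rule has_derivative_mult_right)
    then show ?thesis unfolding F[OF that(1) t] by (simp add: scaleR mult_ac)
  qed
  have cf: "continuous_on ((\<lambda>t. x0 + t *\<^sub>R (x - x0)) ` {0..1}) w" if "x \<in> ?B" for x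
    by (rule continuous_on_subset[OF Ck_on_continuous[OF Suc.prems]]) (use radial_in_ball[OF that] in blast)
  have int: "?f x integrable_on cbox 0 1" if "x \<in> ?B" for x
    by (intro integrable_continuous continuous_intros continuous_on_compose2[OF cf[OF that]]) auto
  have cF: "continuous_on (?B \<times> cbox 0 1) (\<lambda>(x, t). F x t)"
  proof (rule continuous_on_blinfun_componentwise)
    fix v :: 'a assume "v \<in> Basis"
    have line: "continuous_on A (\<lambda>p. x0 + snd p *\<^sub>R (fst p - x0))" for A :: "('a \<times> real) set"
      by (intro continuous_intros)
    have "continuous_on (?B \<times> cbox 0 1) (\<lambda>p. frechet_derivative w (at (x0 + snd p *\<^sub>R (fst p - x0))) v)"
      by (rule continuous_on_compose2[OF cw[of v] line]) (use radial_in_ball[of _ x0 r] in \<open>auto simp del: mem_ball\<close>)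
    then have "continuous_on (?B \<times> cbox 0 1)
        (\<lambda>xt. snd xt ^ Suc m * frechet_derivative w (at (x0 + snd xt *\<^sub>R (fst xt - x0))) v)"
      by (intro continuous_on_mult continuous_on_power continuous_on_snd continuous_on_id)
    then show "continuous_on (?B \<times> cbox 0 1) (\<lambda>xt. blinfun_apply (case xt of (x, t) \<Rightarrow> F x t) v)"
      by (rule continuous_on_eq) (auto simp: F)
  qed
  have ap: "blinfun_apply (integral (cbox 0 1) (F x)) v = ?D v x" if "x \<in> ?B" for x v
  proof -
    have "continuous_on (cbox 0 1) (\<lambda>t. (x, t :: real))" by (intro continuous_intros)
    from continuous_on_compose2[OF cF this] have "continuous_on (cbox 0 1) (F x)" using that by (simp add: image_subset_iff)
    then have "F x integrable_on cbox 0 1" by (rule integrable_continuous)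
    from blinfun_apply_integral[OF this] have "blinfun_apply (integral (cbox 0 1) (F x)) v
        = integral {0..1} (\<lambda>t. blinfun_apply (F x t) v)" by (simp only: box_real)
    also have "\<dots> = ?D v x" by (rule integral_cong) (simp only: F[OF that])
    finally show ?thesis .
  qed
  have d: "((\<lambda>x. integral {0..1} (?f x)) has_derivative (\<lambda>v. ?D v x)) (at x)" if "x \<in> ?B" for x
  proof -
    have "((\<lambda>x. integral (cbox 0 1) (?f x)) has_derivative integral (cbox 0 1) (F x)) (at x within ?B)"
      by (rule leibniz_rule[where U = ?B and f = ?f and fx = F, OF fd int cF that convex_ball])
    moreover have "blinfun_apply (integral (cbox 0 1) (F x)) = (\<lambda>v. ?D v x)"
      by (rule ext) (rule ap[OF that])
    ultimately show ?thesis using at_within_open[OF that open_ball] by (simp only: box_real)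
  qed
  show ?case
    unfolding Ck_on.simps
  proof (intro conjI ballI allI)
    show "(\<lambda>x. integral {0..1} (?f x)) differentiable at x" if "x \<in> ?B" for x
      using d[OF that] unfolding differentiable_def by blast
    fix v
    show "Ck_on k ?B (\<lambda>x. frechet_derivative (\<lambda>x. integral {0..1} (?f x)) (at x) v)"
      by (rule Ck_on_cong[OF open_ball _ Suc.IH[of "\<lambda>x. frechet_derivative w (at x) v" "Suc m"]])
        (use Suc.prems frechet_derivative_eqI[OF d] in auto)
  qed
qed

text \<open>The coefficient \<open>g b\<close> averages the derivative in direction \<open>b\<close>
  over the segment from \<open>x0\<close>; the formula is the fundamental theorem of calculus on
  that segment.\<close>

lemma hadamard:
  fixes f :: "'a::euclidean_space \<Rightarrow> real"
  assumes f: "smooth_on (ball x0 r) f" and r: "r > 0"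
  obtains g where "\<And>b. smooth_on (ball x0 r) (g b)" "\<And>b. g b x0 = frechet_derivative f (at x0) b"
    "\<And>x. x \<in> ball x0 r \<Longrightarrow> f x = f x0 + (\<Sum>b\<in>Basis. ((x - x0) \<bullet> b) * g b x)"
proof
  \<comment> \<open>The factor \<open>t ^ 0\<close> presents the coefficient as the case
    \<open>m = 0\<close> of the radial integral.\<close>
  let ?g = "\<lambda>b x. integral {0..1} (\<lambda>t. t ^ 0 * frechet_derivative f (at (x0 + t *\<^sub>R (x - x0))) b)"
  have C: "Ck_on k (ball x0 r) (\<lambda>x. frechet_derivative f (at x) b)" for k b
    using smooth_on_frechet[OF f] smooth_onD by blast
  show "smooth_on (ball x0 r) (?g b)" for b
    unfolding smooth_on_def using Ck_on_radial_integral[OF C, where m = 0] by blast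
  show "?g b x0 = frechet_derivative f (at x0) b" for b by simp
  fix x assume x: "x \<in> ball x0 r"
  let ?D = "\<lambda>t. frechet_derivative f (at (x0 + t *\<^sub>R (x - x0)))"
  have line: "continuous_on {0..1::real} (\<lambda>t. x0 + t *\<^sub>R (x - x0))" by (intro continuous_intros)
  have int: "(\<lambda>t. ?D t b) integrable_on {0..1}" for b
    by (rule integrable_continuous_real, rule continuous_on_compose2[OF Ck_on_continuous[OF C] line])
      (use radial_in_ball[OF x] in blast)
  have "((\<lambda>t. ?D t (x - x0)) has_integral f (x0 + 1 *\<^sub>R (x - x0)) - f (x0 + 0 *\<^sub>R (x - x0))) {0..1}"
  proof (rule fundamental_theorem_of_calculus)
    fix t :: real assume t: "t \<in> {0..1}"
    have "((\<lambda>t. f (x0 + t *\<^sub>R (x - x0))) has_real_derivative ?D t (x - x0)) (at t)"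
      by (rule has_real_derivative_along_line, rule smooth_on_has_derivative[OF f radial_in_ball[OF x t]])
    then show "((\<lambda>t. f (x0 + t *\<^sub>R (x - x0))) has_vector_derivative ?D t (x - x0)) (at t within {0..1})"
      by (simp add: has_real_derivative_iff_has_vector_derivative has_vector_derivative_at_within)
  qed simp
  then have "f x - f x0 = integral {0..1} (\<lambda>t. ?D t (x - x0))" by (simp add: integral_unique)
  also have "\<dots> = integral {0..1} (\<lambda>t. \<Sum>b\<in>Basis. ((x - x0) \<bullet> b) * ?D t b)"
  proof (rule integral_cong)
    fix t :: real assume "t \<in> {0..1}"
    from frechet_derivative_euclidean[OF smooth_on_differentiable[OF f radial_in_ball[OF x this]], of "x - x0"]
    show "?D t (x - x0) = (\<Sum>b\<in>Basis. ((x - x0) \<bullet> b) * ?D t b)" by (simp only: real_scaleR_def)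
  qed
  also have "\<dots> = (\<Sum>b\<in>Basis. integral {0..1} (\<lambda>t. ((x - x0) \<bullet> b) * ?D t b))"
    by (rule integral_sum) (use int in \<open>auto intro: integrable_on_mult_right\<close>)
  also have "\<dots> = (\<Sum>b\<in>Basis. ((x - x0) \<bullet> b) * ?g b x)"
    by (simp only: integral_mult_right power_0 mult_1)
  finally have "f x - f x0 = (\<Sum>b\<in>Basis. ((x - x0) \<bullet> b) * ?g b x)" .
  then show "f x = f x0 + (\<Sum>b\<in>Basis. ((x - x0) \<bullet> b) * ?g b x)" by linarith
qed

section \<open>The invariant mean of a compact group\<close>

locale top_group = group G for G :: "'g::topological_space monoid" (structure) +
  assumes carrier_UNIV [simp]: "carrier G = UNIV"
    and cont_mult: "continuous_on UNIV (\<lambda>(g, h). g \<otimes> h)"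
    and cont_inv: "continuous_on UNIV (\<lambda>g. inv g)"
begin

lemma continuous_on_group_mult:
  assumes "continuous_on S f" "continuous_on S g"
  shows "continuous_on S (\<lambda>x. f x \<otimes> g x)"
  using continuous_on_compose2[OF cont_mult continuous_on_Pair[OF assms]] by simp

lemma continuous_on_group_inv:
  assumes "continuous_on S f"
  shows "continuous_on S (\<lambda>x. inv (f x))"
  using continuous_on_compose2[OF cont_inv assms] by simp

lemma continuous_on_translate_left: "continuous_on UNIV f \<Longrightarrow> continuous_on UNIV (\<lambda>h. f (g \<otimes> h))"
  by (rule continuous_on_compose2[of UNIV f])
    (auto intro: continuous_on_group_mult continuous_on_const continuous_on_id)

lemma continuous_on_translate_right: "continuous_on UNIV f \<Longrightarrow> continuous_on UNIV (\<lambda>h. f (h \<otimes> g))"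
  by (rule continuous_on_compose2[of UNIV f])
    (auto intro: continuous_on_group_mult continuous_on_const continuous_on_id)

lemma inv_mult_cancel [simp]: "inv a \<otimes> (a \<otimes> b) = b" "a \<otimes> (inv a \<otimes> b) = b"
  by (simp_all add: m_assoc[symmetric])

section \<open>Averages over finitely many translates\<close>

text \<open>Lists instead of finite sets keep multiplicities, so that an average of an average is
  the average over the list of all products.\<close>

definition right_avg :: "'g list \<Rightarrow> ('g \<Rightarrow> real) \<Rightarrow> 'g \<Rightarrow> real" where
  "right_avg T f h = (\<Sum>a\<leftarrow>T. f (h \<otimes> a)) / real (length T)"

definition left_avg :: "'g list \<Rightarrow> ('g \<Rightarrow> real) \<Rightarrow> 'g \<Rightarrow> real" where
  "left_avg T f h = (\<Sum>a\<leftarrow>T. f (a \<otimes> h)) / real (length T)"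

lemma sum_list_uminus: "(\<Sum>a\<leftarrow>xs. - F a) = - (\<Sum>a\<leftarrow>xs. F a :: real)"
  by (induction xs) simp_all

lemma right_avg_le: "T \<noteq> [] \<Longrightarrow> (\<And>h. f h \<le> c) \<Longrightarrow> right_avg T f h \<le> c"
  using sum_list_mono[of T "\<lambda>a. f (h \<otimes> a)" "\<lambda>_. c"]
  by (simp add: right_avg_def sum_list_triv field_simps)

lemma right_avg_minus: "right_avg T (\<lambda>h. - f h) h = - right_avg T f h"
  by (simp add: right_avg_def sum_list_uminus)

lemma right_avg_ge: "T \<noteq> [] \<Longrightarrow> (\<And>h. c \<le> f h) \<Longrightarrow> c \<le> right_avg T f h"
  using right_avg_le[of T "\<lambda>h. - f h" "- c" h] by (simp add: right_avg_minus)

lemma left_avg_le: "T \<noteq> [] \<Longrightarrow> (\<And>h. f h \<le> c) \<Longrightarrow> left_avg T f h \<le> c"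
  using sum_list_mono[of T "\<lambda>a. f (a \<otimes> h)" "\<lambda>_. c"]
  by (simp add: left_avg_def sum_list_triv field_simps)

lemma left_avg_minus: "left_avg T (\<lambda>h. - f h) h = - left_avg T f h"
  by (simp add: left_avg_def sum_list_uminus)

lemma left_avg_ge: "T \<noteq> [] \<Longrightarrow> (\<And>h. c \<le> f h) \<Longrightarrow> c \<le> left_avg T f h"
  using left_avg_le[of T "\<lambda>h. - f h" "- c" h] by (simp add: left_avg_minus)

lemma right_avg_close:
  assumes "T \<noteq> []" "\<And>h. \<bar>f h - s\<bar> \<le> e" shows "\<bar>right_avg T f h - s\<bar> \<le> e"
proof -
  have "f h \<le> s + e" "s - e \<le> f h" for h using assms(2)[of h] by linarith+
  then show ?thesis using right_avg_le[OF assms(1)] right_avg_ge[OF assms(1)] by (simp add: abs_le_iff) (smt (verit))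
qed

lemma left_avg_close:
  assumes "T \<noteq> []" "\<And>h. \<bar>f h - s\<bar> \<le> e" shows "\<bar>left_avg T f h - s\<bar> \<le> e"
proof -
  have "f h \<le> s + e" "s - e \<le> f h" for h using assms(2)[of h] by linarith+
  then show ?thesis using left_avg_le[OF assms(1)] left_avg_ge[OF assms(1)] by (simp add: abs_le_iff) (smt (verit))
qed

lemma right_avg_right_avg:
  "right_avg T (right_avg S f) = right_avg (concat (map (\<lambda>a. map (\<lambda>b. a \<otimes> b) S) T)) f"
proof
  fix h
  have "length (concat (map (\<lambda>a. map (\<lambda>b. a \<otimes> b) S) T)) = length T * length S"
    by (induction T) auto
  moreover have "(\<Sum>a\<leftarrow>T. (\<Sum>b\<leftarrow>S. f (h \<otimes> a \<otimes> b)) / real (length S))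
    = (\<Sum>a\<leftarrow>concat (map (\<lambda>a. map (\<lambda>b. a \<otimes> b) S) T). f (h \<otimes> a)) / real (length S)"
    by (induction T) (auto simp: add_divide_distrib m_assoc o_def)
  ultimately show "right_avg T (right_avg S f) h = right_avg (concat (map (\<lambda>a. map (\<lambda>b. a \<otimes> b) S) T)) f h"
    by (simp add: right_avg_def)
qed

lemma sum_list_swap:
  fixes F :: "'a \<Rightarrow> 'b \<Rightarrow> real"
  shows "(\<Sum>a\<leftarrow>xs. \<Sum>b\<leftarrow>ys. F a b) = (\<Sum>b\<leftarrow>ys. \<Sum>a\<leftarrow>xs. F a b)"
  by (induction xs) (simp_all add: sum_list_addf)

lemma sum_list_divide: "(\<Sum>a\<leftarrow>xs. F a / c) = (\<Sum>a\<leftarrow>xs. F a) / (c :: real)"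
  by (induction xs) (simp_all add: add_divide_distrib)

text \<open>Left and right translations commute by associativity. All properties of the mean,
  including its uniqueness, rest on this.\<close>

lemma right_left_avg_commute: "right_avg T (left_avg S f) = left_avg S (right_avg T f)"
proof
  fix h
  show "right_avg T (left_avg S f) h = left_avg S (right_avg T f) h"
    unfolding right_avg_def left_avg_def sum_list_divide
    by (subst sum_list_swap) (simp add: m_assoc mult.commute)
qed

lemma continuous_right_avg:
  assumes "continuous_on UNIV f"
  shows "continuous_on UNIV (right_avg T f)"
proof -
  have "continuous_on UNIV (\<lambda>h. \<Sum>a\<leftarrow>T. f (h \<otimes> a))"
    by (induction T) (auto intro!: continuous_on_add continuous_on_translate_right assms)
  then show ?thesis unfolding right_avg_def divide_inverse by (intro continuous_on_mult_right)
qed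

lemma right_avg_add: "right_avg T (\<lambda>h. f h + g h) h = right_avg T f h + right_avg T g h"
  by (simp add: right_avg_def sum_list_addf add_divide_distrib)

lemma right_avg_cmult: "right_avg T (\<lambda>h. c * f h) h = c * right_avg T f h"
  by (simp add: right_avg_def sum_list_const_mult)

text \<open>Von Neumann's description of the Haar integral of a continuous function on a compact
  group: the constant that is a uniform limit of averages of its translates.\<close>

definition right_mean :: "('g \<Rightarrow> real) \<Rightarrow> real \<Rightarrow> bool" where
  "right_mean f s \<longleftrightarrow> (\<forall>e>0. \<exists>T. T \<noteq> [] \<and> (\<forall>h. \<bar>right_avg T f h - s\<bar> \<le> e))"

definition left_mean :: "('g \<Rightarrow> real) \<Rightarrow> real \<Rightarrow> bool" where
  "left_mean f s \<longleftrightarrow> (\<forall>e>0. \<exists>T. T \<noteq> [] \<and> (\<forall>h. \<bar>left_avg T f h - s\<bar> \<le> e))"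

text \<open>Average on both sides: the resulting function is uniformly close to \<open>s\<close>
  and, because the averages commute, also to \<open>s'\<close>. Existence of one kind of mean thus
  gives uniqueness of the other.\<close>

lemma left_right_mean_eq:
  assumes "right_mean f s" "left_mean f s'"
  shows "s = s'"
proof (rule ccontr)
  assume "s \<noteq> s'"
  define e where "e = \<bar>s - s'\<bar> / 3"
  have e: "e > 0" using \<open>s \<noteq> s'\<close> by (simp add: e_def)
  obtain T where T: "T \<noteq> []" "\<And>h. \<bar>right_avg T f h - s\<bar> \<le> e" using assms(1) e unfolding right_mean_def by blast
  obtain S where S: "S \<noteq> []" "\<And>h. \<bar>left_avg S f h - s'\<bar> \<le> e" using assms(2) e unfolding left_mean_def by blast
  have "\<bar>right_avg T (left_avg S f) \<one> - s'\<bar> \<le> e" using right_avg_close[OF T(1) S(2)] .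
  moreover have "\<bar>left_avg S (right_avg T f) \<one> - s\<bar> \<le> e" using left_avg_close[OF S(1) T(2)] .
  ultimately have "\<bar>s - s'\<bar> \<le> 2 * e" unfolding right_left_avg_commute by linarith
  then show False using e by (simp add: e_def)
qed

end

locale compact_group = top_group +
  assumes compact_UNIV: "compact (UNIV :: 'a set)"
begin

text \<open>The tube lemma for \<open>{\<one>} \<times> UNIV\<close>, which lies in the open set
  where \<open>f (u \<otimes> h)\<close> and \<open>f h\<close> differ by less than
  \<open>e\<close>.\<close>

lemma uniform_left_continuity:
  fixes f :: "'a \<Rightarrow> 'b::metric_space"
  assumes "continuous_on UNIV f" "e > 0"
  shows "\<exists>U. open U \<and> \<one> \<in> U \<and> (\<forall>u\<in>U. \<forall>h. dist (f (u \<otimes> h)) (f h) < e)"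
proof -
  let ?W = "{p. dist (f (fst p \<otimes> snd p)) (f (snd p)) < e}"
  have c: "continuous_on UNIV (\<lambda>p::'a \<times> 'a. dist (f (fst p \<otimes> snd p)) (f (snd p)))"
    by (intro continuous_on_dist continuous_on_compose2[OF assms(1)] continuous_on_group_mult
        continuous_on_fst continuous_on_snd continuous_on_id) auto
  have W: "open ?W" by (rule open_Collect_less[OF c continuous_on_const])
  have sub: "{\<one>} \<times> UNIV \<subseteq> ?W" using assms(2) by auto
  from Elementary_Topology.tube_lemma[OF compact_UNIV W sub] obtain U where "\<one> \<in> U" "open U" "U \<times> UNIV \<subseteq> ?W" by blast
  then show ?thesis by (intro exI[of _ U]) fastforce
qed

lemma finite_translates_cover:
  assumes "open U" "\<one> \<in> U"
  obtains bs where "bs \<noteq> []" "\<And>h. \<exists>b\<in>set bs. \<exists>u\<in>U. h = u \<otimes> b"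
proof -
  have op: "open {h. h \<otimes> inv b \<in> U}" for b
    using continuous_on_group_mult[OF continuous_on_id continuous_on_const, of UNIV "inv b"] assms(1)
      open_vimage[of U "\<lambda>h. h \<otimes> inv b"] by (simp add: vimage_def)
  have "UNIV \<subseteq> (\<Union>b\<in>UNIV. {h. h \<otimes> inv b \<in> U})" using assms(2) by auto
  from compactE_image[OF compact_UNIV op this] obtain C where C: "finite C" "UNIV \<subseteq> (\<Union>b\<in>C. {h. h \<otimes> inv b \<in> U})"
    by auto
  obtain bs where bs: "set bs = C" using C(1) finite_list by blast
  have "\<exists>b\<in>set bs. \<exists>u\<in>U. h = u \<otimes> b" for h
  proof -
    obtain b where b: "b \<in> C" "h \<otimes> inv b \<in> U" using C(2) by auto
    then show ?thesis by (intro bexI[of _ b] bexI[of _ "h \<otimes> inv b"]) (auto simp: bs m_assoc)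
  qed
  moreover from this have "bs \<noteq> []" by fastforce
  ultimately show thesis using that by blast
qed

lemma sum_list_le_one_small:
  assumes "\<And>a. a \<in> set T \<Longrightarrow> F a \<le> (A::real)" "a0 \<in> set T" "F a0 \<le> B" 
  shows "(\<Sum>a\<leftarrow>T. F a) \<le> (real (length T) - 1) * A + B"
  using assms
proof (induction T)
  case (Cons a T)
  show ?case
  proof (cases "a0 \<in> set T")
    case True
    then show ?thesis using Cons by (simp add: algebra_simps) (smt (verit))
  next
    case False
    have "(\<Sum>a\<leftarrow>T. F a) \<le> (\<Sum>a\<leftarrow>T. A)" using Cons.prems by (intro sum_list_mono) auto
    then show ?thesis using Cons.prems False by (simp add: sum_list_triv algebra_simps)
  qed
qed simp

text \<open>\<open>s\<close> is the infimum of all uniform upper bounds of averages of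
  \<open>f\<close>. An average whose bound is close to \<open>s\<close> cannot fall far below
  \<open>s\<close> anywhere: translates of \<open>f\<close> share their modulus of continuity, so
  the average would be low on a whole set \<open>U g0\<close>, and a second average in which every
  point meets this set would have an upper bound below \<open>s\<close>.\<close>

lemma right_mean_exists:
  assumes f: "continuous_on UNIV f"
  shows "\<exists>s. right_mean f s"
proof -
  have "compact (f ` UNIV)" by (rule compact_continuous_image[OF f compact_UNIV])
  then have "bounded (range f)" by (rule compact_imp_bounded)
  then obtain K where K: "\<And>h. \<bar>f h\<bar> \<le> K" by (auto simp: bounded_iff)
  define Z where "Z = {t. \<exists>T. T \<noteq> [] \<and> (\<forall>h. right_avg T f h \<le> t)}"
  have "f h \<le> K" "- K \<le> f h" for h using K[of h] by linarith+
  then have "right_avg [\<one>] f h \<le> K" for h by (intro right_avg_le) auto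
  then have Zne: "K \<in> Z" unfolding Z_def by (intro CollectI exI[of _ "[\<one>]"]) auto
  have "- K \<le> t" if "t \<in> Z" for t
    using that right_avg_ge[of _ "- K" f \<one>] \<open>\<And>h. - K \<le> f h\<close> unfolding Z_def by (smt (verit) mem_Collect_eq)
  then have bdd: "bdd_below Z" by (intro bdd_belowI[of _ "- K"])
  define s where "s = Inf Z"
  have "\<exists>T. T \<noteq> [] \<and> (\<forall>h. \<bar>right_avg T f h - s\<bar> \<le> c)" if c: "c > 0" for c
  proof -
    from uniform_left_continuity[OF f, of "c / 2"] c obtain U where
      U: "open U" "\<one> \<in> U" "\<And>u h. u \<in> U \<Longrightarrow> dist (f (u \<otimes> h)) (f h) < c / 2" by auto
    obtain bs where bs: "bs \<noteq> []" "\<And>h. \<exists>b\<in>set bs. \<exists>u\<in>U. h = u \<otimes> b"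
      using finite_translates_cover[OF U(1,2)] by blast
    define N where "N = real (length bs)"
    have N: "N \<ge> 1" using bs(1) by (simp add: N_def Suc_leI)
    \<comment> \<open>In the second average over \<open>N\<close> shifts, one term is at most
      \<open>s - c / 2\<close> and the others are at most \<open>s + d\<close>. With
      \<open>N * d = c / 4\<close> the average is at most \<open>s - d\<close>.\<close>
    define d where "d = c / (4 * N)"
    have d: "d > 0" "d \<le> c" "N * d = c / 4" using c N by (auto simp: d_def field_simps)
    have "Inf Z < s + d" using d by (simp add: s_def)
    then obtain t where t: "t \<in> Z" "t < s + d" using cInf_lessD[of Z] Zne by blast
    then obtain T where T: "T \<noteq> []" "\<And>h. right_avg T f h \<le> t" unfolding Z_def by blast
    have lower: "s - c \<le> right_avg T f g0" for g0
    proof (rule ccontr)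
      assume "\<not> s - c \<le> right_avg T f g0"
      then have less: "right_avg T f g0 < s - c" by simp
      have near: "right_avg T f (u \<otimes> g0) \<le> s - c / 2" if u: "u \<in> U" for u
      proof -
        have "(\<Sum>a\<leftarrow>T. f (u \<otimes> g0 \<otimes> a)) \<le> (\<Sum>a\<leftarrow>T. f (g0 \<otimes> a) + c / 2)"
        proof (rule sum_list_mono)
          fix a show "f (u \<otimes> g0 \<otimes> a) \<le> f (g0 \<otimes> a) + c / 2"
            using U(3)[OF u, of "g0 \<otimes> a"] unfolding dist_real_def m_assoc[of u g0 a, simplified] by linarith
        qed
        also have "\<dots> = (\<Sum>a\<leftarrow>T. f (g0 \<otimes> a)) + real (length T) * (c / 2)"
          by (simp only: sum_list_addf sum_list_triv)
        finally have "right_avg T f (u \<otimes> g0) \<le> right_avg T f g0 + c / 2"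
          using T(1) by (simp add: right_avg_def field_simps)
        then show ?thesis using less by simp
      qed
      \<comment> \<open>If \<open>h = u \<otimes> b\<close> with \<open>u \<in> U\<close>, then the
        shift of \<open>h\<close> by \<open>inv b \<otimes> g0\<close> is
        \<open>u \<otimes> g0\<close>, where the first average is low.\<close>
      define T' where "T' = map (\<lambda>b. inv b \<otimes> g0) bs"
      have T': "T' \<noteq> []" "real (length T') = N" using bs by (auto simp: T'_def N_def)
      have "right_avg T' (right_avg T f) h \<le> s - d" for h
      proof -
        obtain b u where b: "b \<in> set bs" "u \<in> U" "h = u \<otimes> b" using bs(2) by blast
        have "(\<Sum>a\<leftarrow>T'. right_avg T f (h \<otimes> a)) \<le> (real (length T') - 1) * (s + d) + (s - c / 2)"
        proof (rule sum_list_le_one_small)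
          show "right_avg T f (h \<otimes> a) \<le> s + d" for a using T(2)[of "h \<otimes> a"] t(2) by linarith
          show "inv b \<otimes> g0 \<in> set T'" using b by (auto simp: T'_def)
          show "right_avg T f (h \<otimes> (inv b \<otimes> g0)) \<le> s - c / 2"
            using near[OF b(2)] b(3) by (simp add: m_assoc)
        qed
        also have "\<dots> = N * s + N * d - d - c / 2" by (simp add: T' algebra_simps)
        also have "\<dots> \<le> N * (s - d)" using d c by (simp add: algebra_simps)
        finally show ?thesis unfolding right_avg_def[of T'] using T' N by (simp add: divide_simps mult.commute)
      qed
      then have "s - d \<in> Z"
        unfolding Z_def right_avg_right_avg
        by (intro CollectI exI[of _ "concat (map (\<lambda>a. map (\<lambda>b. a \<otimes> b) T) T')"])
          (use T(1) T'(1) in \<open>auto simp: neq_Nil_conv\<close>)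
      then have "s \<le> s - d" unfolding s_def by (intro cInf_lower bdd)
      then show False using d by simp
    qed
    show ?thesis
    proof (intro exI[of _ T] conjI allI T(1))
      fix h show "\<bar>right_avg T f h - s\<bar> \<le> c" using lower[of h] T(2)[of h] t(2) d(2) by linarith
    qed
  qed
  then show ?thesis unfolding right_mean_def by blast
qed

lemma left_mean_exists:
  assumes f: "continuous_on UNIV f"
  shows "\<exists>s. left_mean f s"
proof -
  have "continuous_on UNIV (\<lambda>h. f (inv h))"
    by (rule continuous_on_compose2[OF f]) (auto intro: cont_inv)
  then obtain s where s: "right_mean (\<lambda>h. f (inv h)) s" using right_mean_exists by blast
  have "right_avg T (\<lambda>h. f (inv h)) (inv h) = left_avg (map (\<lambda>a. inv a) T) f h" for T h
    by (simp add: right_avg_def left_avg_def inv_mult_group o_def)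
  then have "left_mean f s"
    using s unfolding right_mean_def left_mean_def by (metis map_is_Nil_conv)
  then show ?thesis by blast
qed

section \<open>The invariant mean and its properties\<close>

definition mean :: "('a \<Rightarrow> real) \<Rightarrow> real" where
  "mean f = (SOME s. right_mean f s)"

lemma right_mean_mean: "continuous_on UNIV f \<Longrightarrow> right_mean f (mean f)"
  unfolding mean_def using right_mean_exists by (rule someI_ex)

lemma left_mean_mean: "continuous_on UNIV f \<Longrightarrow> left_mean f (mean f)"
  using left_mean_exists right_mean_mean left_right_mean_eq by metis

lemma mean_eqI: "continuous_on UNIV f \<Longrightarrow> right_mean f s \<Longrightarrow> mean f = s"
  using left_mean_mean left_right_mean_eq by metis

lemma mean_eqI': "continuous_on UNIV f \<Longrightarrow> left_mean f s \<Longrightarrow> mean f = s"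
  using right_mean_mean left_right_mean_eq by metis

text \<open>A right translation commutes with left averages, so it is the description of the mean by
  left averages that is visibly unchanged; for left translations it is the one by right
  averages.\<close>

lemma mean_translate_right:
  assumes "continuous_on UNIV f"
  shows "mean (\<lambda>h. f (h \<otimes> g)) = mean f"
proof (rule mean_eqI')
  have "left_avg T (\<lambda>h. f (h \<otimes> g)) h = left_avg T f (h \<otimes> g)" for T h
    by (simp add: left_avg_def m_assoc)
  then show "left_mean (\<lambda>h. f (h \<otimes> g)) (mean f)"
    using left_mean_mean[OF assms] unfolding left_mean_def by simp metis
qed (rule continuous_on_translate_right[OF assms])

lemma mean_translate_left:
  assumes "continuous_on UNIV f"
  shows "mean (\<lambda>h. f (g \<otimes> h)) = mean f"
proof (rule mean_eqI)
  have "right_avg T (\<lambda>h. f (g \<otimes> h)) h = right_avg T f (g \<otimes> h)" for T h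
    by (simp add: right_avg_def m_assoc)
  then show "right_mean (\<lambda>h. f (g \<otimes> h)) (mean f)"
    using right_mean_mean[OF assms] unfolding right_mean_def by simp metis
qed (rule continuous_on_translate_left[OF assms])

lemma mean_right_avg:
  assumes "continuous_on UNIV f" "T \<noteq> []"
  shows "mean (right_avg T f) = mean f"
proof (rule mean_eqI'[OF continuous_right_avg[OF assms(1)]])
  show "left_mean (right_avg T f) (mean f)"
    using left_mean_mean[OF assms(1)] right_avg_close[OF assms(2)]
    unfolding left_mean_def right_left_avg_commute[symmetric] by metis
qed

text \<open>The lists adapted to \<open>f\<close> and to \<open>g\<close> differ. Here
  \<open>T\<close> is chosen for \<open>f\<close> and then \<open>S\<close> for the average of
  \<open>g\<close> over \<open>T\<close>; averaging over \<open>S\<close> as well does not spoil the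
  approximation for \<open>f\<close>.\<close>

lemma mean_add:
  assumes f: "continuous_on UNIV f" and g: "continuous_on UNIV g"
  shows "mean (\<lambda>h. f h + g h) = mean f + mean g"
proof (rule mean_eqI)
  show "right_mean (\<lambda>h. f h + g h) (mean f + mean g)"
    unfolding right_mean_def
  proof (intro allI impI)
    fix e :: real assume "e > 0"
    then have e2: "e / 2 > 0" by simp
    obtain T where T: "T \<noteq> []" "\<And>h. \<bar>right_avg T f h - mean f\<bar> \<le> e / 2"
      using right_mean_mean[OF f] e2 unfolding right_mean_def by blast
    have "right_mean (right_avg T g) (mean g)"
      using right_mean_mean[OF continuous_right_avg[OF g, of T]] mean_right_avg[OF g T(1)] by simp
    then obtain S where S: "S \<noteq> []" "\<And>h. \<bar>right_avg S (right_avg T g) h - mean g\<bar> \<le> e / 2"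
      using e2 unfolding right_mean_def by blast
    let ?C = "concat (map (\<lambda>a. map (\<lambda>b. a \<otimes> b) T) S)"
    have "\<bar>right_avg ?C (\<lambda>h. f h + g h) h - (mean f + mean g)\<bar> \<le> e" for h
    proof -
      have "\<bar>right_avg S (right_avg T f) h - mean f\<bar> \<le> e / 2" by (rule right_avg_close[OF S(1) T(2)])
      then show ?thesis using S(2)[of h] unfolding right_avg_right_avg right_avg_add by linarith
    qed
    moreover have "?C \<noteq> []" using T(1) S(1) by (auto simp: neq_Nil_conv)
    ultimately show "\<exists>C. C \<noteq> [] \<and> (\<forall>h. \<bar>right_avg C (\<lambda>h. f h + g h) h - (mean f + mean g)\<bar> \<le> e)" by blast
  qed
qed (intro continuous_on_add f g)

lemma mean_const [simp]: "mean (\<lambda>h. c) = c"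
  by (rule mean_eqI) (auto simp: right_mean_def right_avg_def sum_list_triv intro!: exI[of _ "[\<one>]"])

lemma mean_cmult:
  assumes f: "continuous_on UNIV f"
  shows "mean (\<lambda>h. c * f h) = c * mean f"
proof (rule mean_eqI)
  show "right_mean (\<lambda>h. c * f h) (c * mean f)"
    unfolding right_mean_def
  proof (intro allI impI)
    fix e :: real assume e: "e > 0"
    define d where "d = e / (\<bar>c\<bar> + 1)"
    have d: "d > 0" "\<bar>c\<bar> * d \<le> e" using e by (auto simp: d_def field_simps)
    obtain T where T: "T \<noteq> []" "\<And>h. \<bar>right_avg T f h - mean f\<bar> \<le> d"
      using right_mean_mean[OF f] d(1) unfolding right_mean_def by blast
    have "\<bar>right_avg T (\<lambda>h. c * f h) h - c * mean f\<bar> \<le> e" for h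
    proof -
      have "\<bar>c * (right_avg T f h - mean f)\<bar> \<le> \<bar>c\<bar> * d"
        unfolding abs_mult using T(2) by (intro mult_left_mono) auto
      then show ?thesis using d(2) by (simp add: right_avg_cmult algebra_simps)
    qed
    then show "\<exists>T. T \<noteq> [] \<and> (\<forall>h. \<bar>right_avg T (\<lambda>h. c * f h) h - c * mean f\<bar> \<le> e)" using T(1) by blast
  qed
qed (intro continuous_on_mult_left f)

lemma mean_diff:
  assumes "continuous_on UNIV f" "continuous_on UNIV g"
  shows "mean (\<lambda>h. f h - g h) = mean f - mean g"
  using mean_add[OF assms(1) continuous_on_mult_left[OF assms(2), of "- 1"]] mean_cmult[OF assms(2), of "- 1"]
  by simp

lemma mean_sum:
  assumes "\<And>i. i \<in> I \<Longrightarrow> continuous_on UNIV (f i)"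
  shows "mean (\<lambda>h. \<Sum>i\<in>I. f i h) = (\<Sum>i\<in>I. mean (f i))"
  using assms
proof (induction I rule: infinite_finite_induct)
  case (insert i I)
  then show ?case by (simp add: mean_add continuous_on_sum)
qed auto

lemma mean_le:
  assumes "continuous_on UNIV f" "\<And>h. f h \<le> c"
  shows "mean f \<le> c"
proof (rule field_le_epsilon)
  fix e :: real assume "e > 0"
  then obtain T where "T \<noteq> []" "\<And>h. \<bar>right_avg T f h - mean f\<bar> \<le> e"
    using right_mean_mean[OF assms(1)] unfolding right_mean_def by blast
  with right_avg_le[where f = f and T = T and h = \<one> and c = c, OF _ assms(2)] show "mean f \<le> c + e" by (smt (verit))
qed

lemma mean_ge:
  assumes "continuous_on UNIV f" "\<And>h. c \<le> f h"
  shows "c \<le> mean f"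
proof -
  have "mean (\<lambda>h. - 1 * f h) \<le> - c" by (intro mean_le continuous_on_mult_left assms) (use assms in auto)
  then show ?thesis unfolding mean_cmult[OF assms(1)] by simp
qed

lemma abs_mean_le:
  assumes "continuous_on UNIV f" "\<And>h. \<bar>f h\<bar> \<le> c"
  shows "\<bar>mean f\<bar> \<le> c"
  using mean_le[OF assms(1), of c] mean_ge[OF assms(1), of "- c"] assms(2) by (smt (verit) abs_le_iff)

text \<open>Finitely many translates of the set where \<open>f\<close> exceeds
  \<open>f g0 / 2\<close> cover the group. In the corresponding average every point has at least one
  large term, so the average is bounded below by a positive constant.\<close>

lemma mean_pos:
  assumes f: "continuous_on UNIV f" and nonneg: "\<And>h. 0 \<le> f h" and pos: "0 < f g0"
  shows "0 < mean f"
proof -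
  define U where "U = {u. f g0 / 2 < f (u \<otimes> g0)}"
  have "open U" unfolding U_def
    by (rule open_Collect_less[OF continuous_on_const continuous_on_translate_right[OF f]])
  moreover have "\<one> \<in> U" using pos by (simp add: U_def)
  ultimately obtain bs where bs: "bs \<noteq> []" "\<And>h. \<exists>b\<in>set bs. \<exists>u\<in>U. h = u \<otimes> b"
    using finite_translates_cover by metis
  define T where "T = map (\<lambda>b. inv b \<otimes> g0) bs"
  define c where "c = f g0 / 2 / real (length T)"
  have T: "T \<noteq> []" using bs by (simp add: T_def)
  have "c \<le> right_avg T f h" for h
  proof -
    obtain b u where b: "b \<in> set bs" "u \<in> U" "h = u \<otimes> b" using bs(2) by blast
    have "f g0 / 2 \<le> f (h \<otimes> (inv b \<otimes> g0))" using b(2,3) by (simp add: U_def m_assoc)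
    also have "\<dots> \<le> (\<Sum>a\<leftarrow>T. f (h \<otimes> a))"
      by (rule member_le_sum_list) (use b(1) nonneg in \<open>auto simp: T_def\<close>)
    finally show ?thesis unfolding c_def right_avg_def by (intro divide_right_mono) auto
  qed
  then have "c \<le> mean (right_avg T f)" by (intro mean_ge continuous_right_avg f)
  moreover have "c > 0" using pos T by (simp add: c_def)
  ultimately show ?thesis by (simp add: mean_right_avg[OF f T])
qed

end

section \<open>Manifolds and Lie groups\<close>

lemma sum_Basis_vec: "(\<Sum>b\<in>(Basis :: (real^'n) set). F b) = (\<Sum>i\<in>UNIV. F (axis i 1))"
proof -
  have "(Basis :: (real^'n) set) = range (\<lambda>i. axis i 1)" by (auto simp: Basis_vec_def)
  moreover have inj: "inj (\<lambda>i::'n. axis i (1::real))" by (auto simp: inj_on_def axis_eq_axis)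
  ultimately show ?thesis using sum.reindex[OF inj, of F] by (simp only: o_def)
qed

locale manifold =
  fixes A :: "('g::t2_space, 'n::finite) chart set"
  assumes atlas: "smooth_atlas A"
begin

lemma chart_exists: obtains c where "c \<in> A" "p \<in> fst c"
  using atlas unfolding smooth_atlas_def by blast

lemma
  assumes "c \<in> A"
  shows open_chart_domain: "open (fst c)"
    and open_coord_range: "open (coord_range c)"
    and continuous_on_chart: "continuous_on (fst c) (snd c)"
    and continuous_on_param: "continuous_on (coord_range c) (param c)"
    and param_coord: "p \<in> fst c \<Longrightarrow> param c (snd c p) = p"
    and coord_param: "x \<in> coord_range c \<Longrightarrow> snd c (param c x) = x"
    and param_in: "x \<in> coord_range c \<Longrightarrow> param c x \<in> fst c"
  using atlas assms unfolding smooth_atlas_def homeomorphism_def by blast+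

lemma coord_in: "p \<in> fst c \<Longrightarrow> snd c p \<in> coord_range c"
  by blast

lemma transition_smooth:
  assumes "c \<in> A" "d \<in> A"
  shows "smooth_on {x \<in> coord_range c. param c x \<in> fst d} (\<lambda>x. snd d (param c x))"
proof -
  have "{x \<in> coord_range c. param c x \<in> fst d} \<subseteq> snd c ` (fst c \<inter> fst d)"
  proof
    fix x assume x: "x \<in> {x \<in> coord_range c. param c x \<in> fst d}"
    then have "x = snd c (param c x)" "param c x \<in> fst c \<inter> fst d"
      using coord_param[OF assms(1)] param_in[OF assms(1)] by auto
    then show "x \<in> snd c ` (fst c \<inter> fst d)" by (rule image_eqI)
  qed
  then show ?thesis using atlas assms unfolding smooth_atlas_def by (meson smooth_on_subset)
qed

lemma open_param_vimage:
  assumes "c \<in> A" "open U" "continuous_on UNIV \<Phi>"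
  shows "open {x \<in> coord_range c. \<Phi> (param c x) \<in> U}"
proof -
  have "continuous_on (coord_range c) (\<lambda>x. \<Phi> (param c x))"
    by (rule continuous_on_compose2[OF assms(3) continuous_on_param[OF assms(1)]]) auto
  from continuous_open_preimage[OF this open_coord_range[OF assms(1)] assms(2)]
  show ?thesis by (simp add: vimage_def Int_def conj_commute)
qed

lemma smooth_fun_smooth_on: "smooth_fun A f \<Longrightarrow> c \<in> A \<Longrightarrow> smooth_on (coord_range c) (\<lambda>x. f (param c x))"
  by (simp add: smooth_fun_def)

lemma smooth_fun_const: "smooth_fun A (\<lambda>p. r)"
  by (simp add: smooth_fun_def smooth_on_const)

lemma smooth_fun_lin:
  assumes "smooth_fun A f" "smooth_fun A h"
  shows "smooth_fun A (\<lambda>p. r * f p + s * h p)"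
  unfolding smooth_fun_def
proof
  fix c assume c: "c \<in> A"
  show "smooth_on (coord_range c) (\<lambda>x. r * f (param c x) + s * h (param c x))"
    using assms c unfolding smooth_fun_def by (intro smooth_on_add smooth_on_mult smooth_on_const open_coord_range) auto
qed

lemma smooth_fun_mult:
  assumes "smooth_fun A f" "smooth_fun A h"
  shows "smooth_fun A (\<lambda>p. f p * h p)"
  unfolding smooth_fun_def
proof
  fix c assume c: "c \<in> A"
  show "smooth_on (coord_range c) (\<lambda>x. f (param c x) * h (param c x))"
    using assms c unfolding smooth_fun_def by (intro smooth_on_mult open_coord_range) auto
qed

lemma smooth_fun_sum:
  assumes "\<And>i. i \<in> I \<Longrightarrow> smooth_fun A (f i)"
  shows "smooth_fun A (\<lambda>p. \<Sum>i\<in>I. f i p)"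
  unfolding smooth_fun_def
proof
  fix c assume c: "c \<in> A"
  show "smooth_on (coord_range c) (\<lambda>x. \<Sum>i\<in>I. f i (param c x))"
    using assms c unfolding smooth_fun_def by (intro smooth_on_sum open_coord_range) auto
qed

text \<open>The support lies in the image of a closed ball. This image is compact, hence closed in
  the Hausdorff space, so that points outside the chart have a neighbourhood on which the extension
  is zero.\<close>

lemma smooth_fun_extension:
  fixes h :: "real^'n \<Rightarrow> real"
  assumes c: "c \<in> A" and h: "smooth_on (coord_range c) h" and r: "cball z r \<subseteq> coord_range c"
    and supp: "\<And>x. x \<in> coord_range c \<Longrightarrow> x \<notin> cball z r \<Longrightarrow> h x = 0"
  shows "smooth_fun A (\<lambda>q. if q \<in> fst c then h (snd c q) else 0)"
  unfolding smooth_fun_def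
proof (rule ballI, rule smooth_on_local)
  let ?f = "\<lambda>q. if q \<in> fst c then h (snd c q) else 0"
  fix d x assume d: "d \<in> A" and x: "x \<in> coord_range d"
  show "\<exists>U. open U \<and> x \<in> U \<and> smooth_on U (\<lambda>x. ?f (param d x))"
  proof (cases "param d x \<in> fst c")
    case True
    let ?U = "{x \<in> coord_range d. param d x \<in> fst c}"
    have U: "open ?U" using open_param_vimage[OF d open_chart_domain[OF c] continuous_on_id] by simp
    have "smooth_on ?U (\<lambda>x. h (snd c (param d x)))"
      by (rule smooth_on_compose[OF U _ transition_smooth[OF d c] h]) (auto simp: coord_in)
    then have "smooth_on ?U (\<lambda>x. ?f (param d x))" by (rule smooth_on_cong[OF U, rotated]) auto
    then show ?thesis using U x True by (intro exI[of _ ?U]) simp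
  next
    case False
    let ?K = "param c ` cball z r"
    let ?U = "{x \<in> coord_range d. param d x \<in> - ?K}"
    have "compact ?K"
      using continuous_on_subset[OF continuous_on_param[OF c] r] by (intro compact_continuous_image) auto
    then have "open (- ?K)" by (simp add: compact_imp_closed open_Compl)
    from open_param_vimage[OF d this continuous_on_id] have U: "open ?U" by simp
    have "smooth_on ?U (\<lambda>x. ?f (param d x))"
    proof (rule smooth_on_cong[OF U _ smooth_on_const[of _ 0]])
      fix y assume y: "y \<in> ?U"
      show "0 = ?f (param d y)"
      proof (cases "param d y \<in> fst c")
        case True
        have "snd c (param d y) \<notin> cball z r"
        proof
          assume "snd c (param d y) \<in> cball z r"
          then have "param c (snd c (param d y)) \<in> ?K" by (rule imageI)
          then show False using y param_coord[OF c True] by simp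
        qed
        then show ?thesis using True supp[OF coord_in[OF True]] by simp
      qed simp
    qed
    moreover have "x \<in> ?U" using False param_in[OF c] subsetD[OF r] x by auto
    ultimately show ?thesis using U by (intro exI[of _ ?U] conjI)
  qed
qed

section \<open>Tangent vectors in a chart\<close>

text \<open>The tangent vector with components \<open>v\<close> in the chart \<open>c\<close>; the
  value 0 off the smooth functions matches the normalisation in
  \<open>tangent_space\<close>.\<close>

definition dir_vec :: "('g, 'n) chart \<Rightarrow> real^'n \<Rightarrow> 'g \<Rightarrow> ('g \<Rightarrow> real) \<Rightarrow> real" where
  "dir_vec c v p = (\<lambda>f. if smooth_fun A f then frechet_derivative (\<lambda>x. f (param c x)) (at (snd c p)) v else 0)"

lemma coord_vector_eq: "coord_vector A c i p = dir_vec c (axis i 1) p"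
  by (simp add: coord_vector_def dir_vec_def partial_deriv_def fun_eq_iff)

lemma smooth_fun_has_derivative:
  assumes "smooth_fun A f" "c \<in> A" "p \<in> fst c"
  shows "((\<lambda>x. f (param c x)) has_derivative (\<lambda>v. dir_vec c v p f)) (at (snd c p))"
  using smooth_on_has_derivative[OF smooth_fun_smooth_on[OF assms(1,2)] coord_in[OF assms(3)]] assms(1)
  by (simp add: dir_vec_def)

lemma dir_vec_eqI:
  assumes "((\<lambda>x. f (param c x)) has_derivative D) (at (snd c p))" "smooth_fun A f"
  shows "dir_vec c v p f = D v"
  using frechet_derivative_eqI[OF assms(1)] assms(2) by (simp add: dir_vec_def)

lemma dir_vec_tangent:
  assumes c: "c \<in> A" "p \<in> fst c"
  shows "dir_vec c v p \<in> tangent_space A p"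
  unfolding tangent_space_def
proof (intro CollectI conjI allI impI)
  show "\<not> smooth_fun A f \<Longrightarrow> dir_vec c v p f = 0" for f by (simp add: dir_vec_def)
  fix f h r s assume fh: "smooth_fun A f \<and> smooth_fun A h"
  note d = smooth_fun_has_derivative[OF _ c]
  show "dir_vec c v p (\<lambda>q. r * f q + s * h q) = r * dir_vec c v p f + s * dir_vec c v p h"
    by (rule dir_vec_eqI) (use fh d in \<open>auto intro!: derivative_eq_intros smooth_fun_lin\<close>)
next
  fix f h assume fh: "smooth_fun A f \<and> smooth_fun A h"
  note d = smooth_fun_has_derivative[OF _ c]
  show "dir_vec c v p (\<lambda>q. f q * h q) = f p * dir_vec c v p h + h p * dir_vec c v p f"
    by (rule dir_vec_eqI)
      (use fh d in \<open>auto intro!: derivative_eq_intros smooth_fun_mult simp: param_coord[OF c] mult.commute\<close>)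
qed

lemma dir_vec_linear:
  assumes "c \<in> A" "p \<in> fst c"
  shows "dir_vec c (r *\<^sub>R v + s *\<^sub>R w) p = (\<lambda>f. r * dir_vec c v p f + s * dir_vec c w p f)"
proof
  fix f
  show "dir_vec c (r *\<^sub>R v + s *\<^sub>R w) p f = r * dir_vec c v p f + s * dir_vec c w p f"
  proof (cases "smooth_fun A f")
    case True
    interpret bounded_linear "\<lambda>v. dir_vec c v p f"
      using smooth_fun_has_derivative[OF True assms] by (rule has_derivative_bounded_linear)
    show ?thesis by (simp add: add scaleR)
  qed (simp add: dir_vec_def)
qed

lemma dir_vec_sum:
  assumes "c \<in> A" "p \<in> fst c"
  shows "dir_vec c v p f = (\<Sum>i\<in>UNIV. v $ i * dir_vec c (axis i 1) p f)"
proof (cases "smooth_fun A f")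
  case True
  interpret bounded_linear "\<lambda>v. dir_vec c v p f"
    using smooth_fun_has_derivative[OF True assms] by (rule has_derivative_bounded_linear)
  have "v = (\<Sum>i\<in>UNIV. v $ i *\<^sub>R axis i 1)" by (simp add: basis_expansion scalar_mult_eq_scaleR[symmetric])
  then have "dir_vec c v p f = dir_vec c (\<Sum>i\<in>UNIV. v $ i *\<^sub>R axis i 1) p f" by metis
  then show ?thesis by (simp add: sum scaleR)
qed (simp add: dir_vec_def)

lemma chart_ball:
  assumes "c \<in> A" "p \<in> fst c"
  obtains r where "r > 0" "cball (snd c p) r \<subseteq> coord_range c"
  using open_contains_cball open_coord_range[OF assms(1)] coord_in[OF assms(2)] by metis

text \<open>A derivation at \<open>p\<close> is a coordinate derivation: multiply the Hadamard decomposition of \<open>f\<close> by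
  the square of a bump function to make all terms globally defined. The factor \<open>f - f p\<close> of the
  remainder vanishes at \<open>p\<close>, and so does \<open>1 - \<beta>\<^sup>2\<close>.\<close>

lemma tangent_space_dir_vec:
  assumes c: "c \<in> A" "p \<in> fst c" and X: "X \<in> tangent_space A p"
  obtains w where "X = dir_vec c w p"
proof -
  let ?x0 = "snd c p"
  obtain r where r: "r > 0" "cball ?x0 r \<subseteq> coord_range c" by (rule chart_ball[OF c])
  obtain \<beta> :: "real^'n \<Rightarrow> real" where \<beta>: "smooth_on UNIV \<beta>" "\<beta> ?x0 = 1" "\<And>x. norm (x - ?x0) \<ge> r / 2 \<Longrightarrow> \<beta> x = 0"
    using smooth_bump[of "r / 2" ?x0] r(1) by (metis half_gt_zero)
  \<comment> \<open>Each function gets one bump factor, so a product of two extended functions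
    carries its square. The bump is supported in radius \<open>r / 2\<close>, inside the ball of
    radius \<open>r\<close> on which the Hadamard coefficients are smooth.\<close>
  define ext :: "(real^'n \<Rightarrow> real) \<Rightarrow> 'g \<Rightarrow> real" where
    "ext h = (\<lambda>q. if q \<in> fst c then \<beta> (snd c q) * h (snd c q) else 0)" for h
  have ext_smooth: "smooth_fun A (ext h)" if h: "smooth_on (ball ?x0 r) h" for h
    unfolding ext_def
  proof (rule smooth_fun_extension[OF c(1), where z = ?x0 and r = "r / 2"])
    show "smooth_on (coord_range c) (\<lambda>x. \<beta> x * h x)"
    proof (rule smooth_on_local)
      fix x assume x: "x \<in> coord_range c"
      show "\<exists>U. open U \<and> x \<in> U \<and> smooth_on U (\<lambda>x. \<beta> x * h x)"
      proof (cases "x \<in> ball ?x0 r")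
        case True
        then show ?thesis
          by (intro exI[of _ "ball ?x0 r"] conjI smooth_on_mult smooth_on_subset[OF \<beta>(1)] h) auto
      next
        case False
        let ?U = "- cball ?x0 (r / 2)"
        have "smooth_on ?U (\<lambda>x. \<beta> x * h x)"
          by (rule smooth_on_cong[OF _ _ smooth_on_const[of _ 0]])
            (use \<beta>(3) in \<open>auto simp: dist_norm norm_minus_commute\<close>)
        moreover have "x \<in> ?U" using False r(1) by auto
        ultimately show ?thesis by (intro exI[of _ ?U]) (simp add: open_Compl)
      qed
    qed
    show "cball ?x0 (r / 2) \<subseteq> coord_range c" using r by (auto simp: subset_eq)
    show "\<beta> x * h x = 0" if "x \<notin> cball ?x0 (r / 2)" for x
      using \<beta>(3)[of x] that by (auto simp: dist_norm norm_minus_commute)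
  qed
  have ext_p: "ext h p = h ?x0" for h using c \<beta>(2) by (simp add: ext_def)
  define w :: "real^'n" where "w = (\<chi> i. X (ext (\<lambda>x. (x - ?x0) $ i)))"
  have coord_smooth: "smooth_on S (\<lambda>x. (x - ?x0) $ i)" if "open S" for S i
  proof -
    have "smooth_on S (\<lambda>x. (x + - ?x0) \<bullet> axis i 1)"
      using that by (intro smooth_on_inner smooth_on_add smooth_on_const smooth_on_bounded_linear bounded_linear_ident)
    then show ?thesis by (simp add: inner_axis)
  qed
  have Xlin: "X (\<lambda>q. r * f q + s * h q) = r * X f + s * X h" if "smooth_fun A f" "smooth_fun A h" for f h r s
    using X that unfolding tangent_space_def by blast
  have Xprod: "X (\<lambda>q. f q * h q) = f p * X h + h p * X f" if "smooth_fun A f" "smooth_fun A h" for f h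
    using X that unfolding tangent_space_def by blast
  have X1: "X (\<lambda>q. 1) = 0" using Xprod[OF smooth_fun_const smooth_fun_const, of 1 1] by simp
  have Xconst: "X (\<lambda>q. a) = 0" for a using Xlin[OF smooth_fun_const smooth_fun_const, of a 1 0 0] X1 by simp
  have Xsum: "X (\<lambda>q. \<Sum>i\<in>I. f i q) = (\<Sum>i\<in>I. X (f i))" if "\<And>i. smooth_fun A (f i)" for I and f :: "'n \<Rightarrow> 'g \<Rightarrow> real"
  proof (induction I rule: infinite_finite_induct)
    case (insert i I)
    have "X (\<lambda>q. 1 * f i q + 1 * (\<Sum>i\<in>I. f i q)) = 1 * X (f i) + 1 * X (\<lambda>q. \<Sum>i\<in>I. f i q)"
      using that by (intro Xlin smooth_fun_sum)
    then show ?case using insert by simp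
  qed (auto simp: Xconst)
  have "X = dir_vec c w p"
  proof
    fix f show "X f = dir_vec c w p f"
    proof (cases "smooth_fun A f")
      case f: True
      have fb: "smooth_on (ball ?x0 r) (\<lambda>x. f (param c x))"
        using smooth_on_subset[OF smooth_fun_smooth_on[OF f c(1)]] r(2) ball_subset_cball by blast
      obtain g where g: "\<And>b. smooth_on (ball ?x0 r) (g b)"
        "\<And>b. g b ?x0 = frechet_derivative (\<lambda>x. f (param c x)) (at ?x0) b"
        "\<And>x. x \<in> ball ?x0 r \<Longrightarrow> f (param c x) = f (param c ?x0) + (\<Sum>b\<in>Basis. ((x - ?x0) \<bullet> b) * g b x)"
        using hadamard[OF fb r(1)] by blast
      let ?k = "\<lambda>i. ext (\<lambda>x. (x - ?x0) $ i)" and ?g = "\<lambda>i. ext (g (axis i 1))"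
      have sk: "smooth_fun A (?k i)" and sg: "smooth_fun A (?g i)" for i
        by (intro ext_smooth coord_smooth g(1) open_ball)+
      define e where "e = ext (\<lambda>x. 1)"
      have se: "smooth_fun A e" unfolding e_def by (intro ext_smooth smooth_on_const)
      have s1: "smooth_fun A (\<lambda>q. 1 * 1 + (- 1) * (e q * e q))"
        by (rule smooth_fun_lin[OF smooth_fun_const smooth_fun_mult[OF se se]])
      have s2: "smooth_fun A (\<lambda>q. 1 * f q + (- 1) * f p)"
        by (rule smooth_fun_lin[OF f smooth_fun_const])
      have s3: "smooth_fun A (\<lambda>q. \<Sum>i\<in>UNIV. ?k i q * ?g i q)"
        by (intro smooth_fun_sum smooth_fun_mult sk sg)
      \<comment> \<open>Where the bump does not vanish, the Hadamard formula makes the sum equal to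
        \<open>e q * e q * (f q - f p)\<close>; elsewhere all extended functions are 0. The factors
        1 bring the terms into the form of the linearity rule for \<open>X\<close>.\<close>
      have decomp: "f q = 1 * (1 * f p + 1 * (\<Sum>i\<in>UNIV. ?k i q * ?g i q))
          + 1 * ((1 * 1 + (- 1) * (e q * e q)) * (1 * f q + (- 1) * f p))" for q
      proof (cases "q \<in> fst c \<and> snd c q \<in> ball ?x0 r")
        case True
        let ?y = "snd c q"
        have "(\<Sum>i\<in>UNIV. ?k i q * ?g i q) = \<beta> ?y * \<beta> ?y * (\<Sum>i\<in>UNIV. (?y - ?x0) $ i * g (axis i 1) ?y)"
          using True by (simp add: ext_def sum_distrib_left algebra_simps)
        also have "(\<Sum>i\<in>UNIV. (?y - ?x0) $ i * g (axis i 1) ?y) = (\<Sum>b\<in>Basis. ((?y - ?x0) \<bullet> b) * g b ?y)"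
          by (simp add: sum_Basis_vec inner_axis)
        also have "\<dots> = f q - f p"
          using g(3)[of ?y] True param_coord[OF c(1)] c(2) by simp
        finally have "(\<Sum>i\<in>UNIV. ?k i q * ?g i q) = \<beta> ?y * \<beta> ?y * (f q - f p)" .
        then show ?thesis using True by (simp add: e_def ext_def algebra_simps)
      next
        case False
        then have "ext h q = 0" for h
          using \<beta>(3)[of "snd c q"] r(1) by (auto simp: ext_def dist_norm norm_minus_commute)
        then show ?thesis by (simp add: e_def)
      qed
      have "X f = X (\<lambda>q. 1 * (1 * f p + 1 * (\<Sum>i\<in>UNIV. ?k i q * ?g i q))
          + 1 * ((1 * 1 + (- 1) * (e q * e q)) * (1 * f q + (- 1) * f p)))"
        using decomp by (metis (no_types, lifting) ext)
      also have "\<dots> = X (\<lambda>q. \<Sum>i\<in>UNIV. ?k i q * ?g i q)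
          + X (\<lambda>q. (1 * 1 + (- 1) * (e q * e q)) * (1 * f q + (- 1) * f p))"
        using Xlin[OF smooth_fun_lin[OF smooth_fun_const[of "f p"] s3, of 1 1] smooth_fun_mult[OF s1 s2], of 1 1]
          Xlin[OF smooth_fun_const[of "f p"] s3, of 1 1] Xconst by simp
      also have "X (\<lambda>q. (1 * 1 + (- 1) * (e q * e q)) * (1 * f q + (- 1) * f p)) = 0"
        using Xprod[OF s1 s2] ext_p[of "\<lambda>x. 1"] by (simp add: e_def)
      also have "X (\<lambda>q. \<Sum>i\<in>UNIV. ?k i q * ?g i q) = (\<Sum>i\<in>UNIV. X (\<lambda>q. ?k i q * ?g i q))"
        by (intro Xsum smooth_fun_mult sk sg)
      also have "\<dots> = (\<Sum>i\<in>UNIV. w $ i * g (axis i 1) ?x0)"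
      proof (rule sum.cong[OF refl])
        fix i
        have "X (\<lambda>q. ?k i q * ?g i q) = ?k i p * X (?g i) + ?g i p * X (?k i)" by (rule Xprod[OF sk sg])
        then show "X (\<lambda>q. ?k i q * ?g i q) = w $ i * g (axis i 1) ?x0"
          by (simp add: ext_p w_def)
      qed
      also have "\<dots> = dir_vec c w p f"
        unfolding dir_vec_sum[OF c, of w] using f by (simp add: g(2) dir_vec_def)
      finally show ?thesis by simp
    next
      case False
      then show ?thesis using X by (simp add: tangent_space_def dir_vec_def)
    qed
  qed
  then show thesis by (rule that)
qed

text \<open>Test on the linear function \<open>x \<mapsto> (x - ?x0) \<bullet> w\<close>, cut off by
  a bump: its derivative in direction \<open>w\<close> at the point is
  \<open>w \<bullet> w\<close>.\<close>

lemma dir_vec_eq_0D: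
  assumes c: "c \<in> A" "p \<in> fst c" and w: "dir_vec c w p = (\<lambda>f. 0)"
  shows "w = 0"
proof -
  let ?x0 = "snd c p"
  obtain r where r: "r > 0" "cball ?x0 r \<subseteq> coord_range c" by (rule chart_ball[OF c])
  obtain \<beta> :: "real^'n \<Rightarrow> real" where \<beta>: "smooth_on UNIV \<beta>" "\<beta> ?x0 = 1" "\<And>x. norm (x - ?x0) \<ge> r \<Longrightarrow> \<beta> x = 0"
    using smooth_bump[of r ?x0] r(1) by metis
  let ?h = "\<lambda>x. \<beta> x * ((x + - ?x0) \<bullet> w)"
  let ?f = "\<lambda>q. if q \<in> fst c then ?h (snd c q) else 0"
  have f: "smooth_fun A ?f"
  proof (rule smooth_fun_extension[OF c(1) _ r(2)])
    show "smooth_on (coord_range c) ?h"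
      using open_coord_range[OF c(1)]
      by (intro smooth_on_mult smooth_on_inner smooth_on_add smooth_on_const smooth_on_bounded_linear
          bounded_linear_ident smooth_on_subset[OF \<beta>(1)]) auto
    show "?h x = 0" if "x \<notin> cball ?x0 r" for x
      using \<beta>(3)[of x] that by (auto simp: dist_norm norm_minus_commute)
  qed
  have "(?h has_derivative (\<lambda>v. v \<bullet> w)) (at ?x0)"
    using smooth_on_has_derivative[OF \<beta>(1), of ?x0] \<beta>(2) by (auto intro!: derivative_eq_intros)
  then have "((\<lambda>x. ?f (param c x)) has_derivative (\<lambda>v. v \<bullet> w)) (at ?x0)"
    by (rule has_derivative_transform_within_open[OF _ open_coord_range[OF c(1)] coord_in[OF c(2)]])
      (simp add: param_in[OF c(1)] coord_param[OF c(1)])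
  from dir_vec_eqI[OF this f, of w] have "w \<bullet> w = 0" using w by simp
  then show ?thesis by simp
qed

section \<open>Smooth maps and their differentials\<close>

definition smooth_map :: "('g \<Rightarrow> 'g) \<Rightarrow> bool" where
  "smooth_map \<Phi> \<longleftrightarrow> continuous_on UNIV \<Phi> \<and>
     (\<forall>c\<in>A. \<forall>d\<in>A. smooth_on {x \<in> coord_range c. \<Phi> (param c x) \<in> fst d} (\<lambda>x. snd d (\<Phi> (param c x))))"

lemma smooth_map_continuous: "smooth_map \<Phi> \<Longrightarrow> continuous_on UNIV \<Phi>"
  by (simp add: smooth_map_def)

lemma smooth_map_chart:
  "smooth_map \<Phi> \<Longrightarrow> c \<in> A \<Longrightarrow> d \<in> A \<Longrightarrow>
    smooth_on {x \<in> coord_range c. \<Phi> (param c x) \<in> fst d} (\<lambda>x. snd d (\<Phi> (param c x)))"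
  by (simp add: smooth_map_def)

lemma smooth_map_open_vimage:
  "smooth_map \<Phi> \<Longrightarrow> c \<in> A \<Longrightarrow> d \<in> A \<Longrightarrow> open {x \<in> coord_range c. \<Phi> (param c x) \<in> fst d}"
  by (intro open_param_vimage open_chart_domain smooth_map_continuous)

lemma smooth_fun_compose:
  assumes f: "smooth_fun A f" and \<Phi>: "smooth_map \<Phi>"
  shows "smooth_fun A (f \<circ> \<Phi>)"
  unfolding smooth_fun_def
proof (rule ballI, rule smooth_on_local)
  fix c x assume c: "c \<in> A" and x: "x \<in> coord_range c"
  obtain d where d: "d \<in> A" "\<Phi> (param c x) \<in> fst d" by (rule chart_exists)
  let ?U = "{x \<in> coord_range c. \<Phi> (param c x) \<in> fst d}"
  have U: "open ?U" by (rule smooth_map_open_vimage[OF \<Phi> c d(1)])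
  have "smooth_on ?U (\<lambda>x. f (param d (snd d (\<Phi> (param c x)))))"
    by (rule smooth_on_compose[OF U _ smooth_map_chart[OF \<Phi> c d(1)] smooth_fun_smooth_on[OF f d(1)]])
      (auto simp: coord_in)
  then have "smooth_on ?U (\<lambda>x. (f \<circ> \<Phi>) (param c x))"
    by (rule smooth_on_cong[OF U, rotated]) (simp add: param_coord[OF d(1)])
  then show "\<exists>U. open U \<and> x \<in> U \<and> smooth_on U (\<lambda>x. (f \<circ> \<Phi>) (param c x))"
    using U x d(2) by (intro exI[of _ ?U]) simp
qed

text \<open>A smooth right inverse is what recovers smoothness of \<open>f\<close> from that of
  \<open>f \<circ> \<Phi>\<close>; with it \<open>push_forward\<close> respects the value 0 on
  functions that are not smooth.\<close>

definition diffeo :: "('g \<Rightarrow> 'g) \<Rightarrow> bool" where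
  "diffeo \<Phi> \<longleftrightarrow> smooth_map \<Phi> \<and> (\<exists>\<Psi>. smooth_map \<Psi> \<and> \<Phi> \<circ> \<Psi> = id)"

lemma diffeo_smooth_fun_iff: "diffeo \<Phi> \<Longrightarrow> smooth_fun A (f \<circ> \<Phi>) \<longleftrightarrow> smooth_fun A f"
  unfolding diffeo_def using smooth_fun_compose by (metis comp_assoc comp_id)

definition chart_deriv :: "('g \<Rightarrow> 'g) \<Rightarrow> ('g, 'n) chart \<Rightarrow> ('g, 'n) chart \<Rightarrow> 'g \<Rightarrow> real^'n \<Rightarrow> real^'n" where
  "chart_deriv \<Phi> c d p = frechet_derivative (\<lambda>x. snd d (\<Phi> (param c x))) (at (snd c p))"

lemma chart_deriv_has_derivative:
  assumes "smooth_map \<Phi>" "c \<in> A" "p \<in> fst c" "d \<in> A" "\<Phi> p \<in> fst d"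
  shows "((\<lambda>x. snd d (\<Phi> (param c x))) has_derivative chart_deriv \<Phi> c d p) (at (snd c p))"
  unfolding chart_deriv_def
  by (rule smooth_on_has_derivative[OF smooth_map_chart[OF assms(1,2,4)]])
    (use assms in \<open>auto simp: param_coord coord_in\<close>)

lemma push_forward_dir_vec:
  assumes \<Phi>: "diffeo \<Phi>" and c: "c \<in> A" "p \<in> fst c" and d: "d \<in> A" "\<Phi> p \<in> fst d"
  shows "push_forward \<Phi> (dir_vec c v p) = dir_vec d (chart_deriv \<Phi> c d p v) (\<Phi> p)"
proof
  fix f
  show "push_forward \<Phi> (dir_vec c v p) f = dir_vec d (chart_deriv \<Phi> c d p v) (\<Phi> p) f"
  proof (cases "smooth_fun A f")
    case f: True
    have \<Phi>s: "smooth_map \<Phi>" using \<Phi> by (simp add: diffeo_def)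
    have "((\<lambda>x. f (param d x)) has_derivative (\<lambda>v. dir_vec d v (\<Phi> p) f)) (at (snd d (\<Phi> (param c (snd c p)))))"
      using smooth_fun_has_derivative[OF f d] by (simp add: param_coord[OF c])
    from has_derivative_compose[OF chart_deriv_has_derivative[OF \<Phi>s c d] this]
    have "((\<lambda>x. f (param d (snd d (\<Phi> (param c x))))) has_derivative
        (\<lambda>v. dir_vec d (chart_deriv \<Phi> c d p v) (\<Phi> p) f)) (at (snd c p))" .
    then have "((\<lambda>x. (f \<circ> \<Phi>) (param c x)) has_derivative
        (\<lambda>v. dir_vec d (chart_deriv \<Phi> c d p v) (\<Phi> p) f)) (at (snd c p))"
      by (rule has_derivative_transform_within_open[OF _ smooth_map_open_vimage[OF \<Phi>s c(1) d(1)]])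
        (use c d in \<open>auto simp: param_coord coord_in\<close>)
    from dir_vec_eqI[OF this smooth_fun_compose[OF f \<Phi>s]] show ?thesis
      by (simp add: push_forward_def)
  next
    case False
    then show ?thesis using diffeo_smooth_fun_iff[OF \<Phi>] by (simp add: push_forward_def dir_vec_def)
  qed
qed

lemma push_forward_tangent:
  assumes \<Phi>: "diffeo \<Phi>" and X: "X \<in> tangent_space A p"
  shows "push_forward \<Phi> X \<in> tangent_space A (\<Phi> p)"
proof -
  obtain c where c: "c \<in> A" "p \<in> fst c" by (rule chart_exists)
  obtain d where d: "d \<in> A" "\<Phi> p \<in> fst d" by (rule chart_exists)
  obtain w where w: "X = dir_vec c w p" by (rule tangent_space_dir_vec[OF c X])
  show ?thesis unfolding w push_forward_dir_vec[OF \<Phi> c d] by (rule dir_vec_tangent[OF d])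
qed

lemma smooth_map_compose:
  assumes \<Phi>: "smooth_map \<Phi>" and \<Psi>: "smooth_map \<Psi>"
  shows "smooth_map (\<Phi> \<circ> \<Psi>)"
  unfolding smooth_map_def
proof (intro conjI ballI)
  show "continuous_on UNIV (\<Phi> \<circ> \<Psi>)"
    using \<Phi> \<Psi> by (meson continuous_on_compose continuous_on_subset smooth_map_continuous subset_UNIV)
  fix c d assume c: "c \<in> A" and d: "d \<in> A"
  show "smooth_on {x \<in> coord_range c. (\<Phi> \<circ> \<Psi>) (param c x) \<in> fst d} (\<lambda>x. snd d ((\<Phi> \<circ> \<Psi>) (param c x)))"
  proof (rule smooth_on_local)
    fix x assume x: "x \<in> {x \<in> coord_range c. (\<Phi> \<circ> \<Psi>) (param c x) \<in> fst d}"
    obtain b where b: "b \<in> A" "\<Psi> (param c x) \<in> fst b" by (rule chart_exists)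
    let ?V = "{x \<in> coord_range c. \<Psi> (param c x) \<in> fst b}"
    let ?W = "{x \<in> coord_range c. \<Phi> (\<Psi> (param c x)) \<in> fst d}"
    let ?U = "?V \<inter> ?W"
    have cont: "continuous_on UNIV (\<lambda>x. \<Phi> (\<Psi> x))"
      by (rule continuous_on_compose2[OF smooth_map_continuous[OF \<Phi>] smooth_map_continuous[OF \<Psi>]]) simp
    have W: "open ?W" using open_param_vimage[OF c open_chart_domain[OF d] cont] .
    have U: "open ?U" by (intro open_Int smooth_map_open_vimage[OF \<Psi> c b(1)] W)
    have "smooth_on ?U (\<lambda>x. snd d (\<Phi> (param b (snd b (\<Psi> (param c x))))))"
      by (rule smooth_on_compose[OF U _ smooth_on_subset[OF smooth_map_chart[OF \<Psi> c b(1)]]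
            smooth_map_chart[OF \<Phi> b(1) d]])
        (auto simp: param_coord[OF b(1)] coord_in)
    then have "smooth_on ?U (\<lambda>x. snd d ((\<Phi> \<circ> \<Psi>) (param c x)))"
      by (rule smooth_on_cong[OF U, rotated]) (simp add: param_coord[OF b(1)])
    then show "\<exists>U. open U \<and> x \<in> U \<and> smooth_on U (\<lambda>x. snd d ((\<Phi> \<circ> \<Psi>) (param c x)))"
      using U x b(2) by (intro exI[of _ ?U]) simp
  qed
qed

lemma diffeo_compose:
  assumes "diffeo \<Phi>" "diffeo \<Psi>"
  shows "diffeo (\<Phi> \<circ> \<Psi>)"
proof -
  obtain \<Phi>' \<Psi>' where inv: "smooth_map \<Phi>'" "\<Phi> \<circ> \<Phi>' = id" "smooth_map \<Psi>'" "\<Psi> \<circ> \<Psi>' = id"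
    using assms unfolding diffeo_def by blast
  have "(\<Phi> \<circ> \<Psi>) \<circ> (\<Psi>' \<circ> \<Phi>') = \<Phi> \<circ> (\<Psi> \<circ> \<Psi>') \<circ> \<Phi>'" by (simp add: comp_assoc)
  also have "\<dots> = id" using inv by simp
  finally have "(\<Phi> \<circ> \<Psi>) \<circ> (\<Psi>' \<circ> \<Phi>') = id" .
  moreover have "smooth_map (\<Psi>' \<circ> \<Phi>')" using inv by (intro smooth_map_compose)
  ultimately show ?thesis using assms smooth_map_compose unfolding diffeo_def by blast
qed

end

section \<open>Riemannian metrics in charts, isometries\<close>

locale riemannian_manifold = manifold A for A :: "('g::t2_space, 'n::finite) chart set" +
  fixes \<rho> :: "'g \<Rightarrow> (('g \<Rightarrow> real) \<Rightarrow> real) \<Rightarrow> (('g \<Rightarrow> real) \<Rightarrow> real) \<Rightarrow> real"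
  assumes metric: "riemannian_metric A \<rho>"
begin

abbreviation metric_at :: "('g, 'n) chart \<Rightarrow> 'g \<Rightarrow> real^'n^'n" where
  "metric_at c p \<equiv> metric_coeffs A \<rho> c (snd c p)"

lemma metric_linear:
  assumes "X \<in> tangent_space A p" "Y \<in> tangent_space A p" "Z \<in> tangent_space A p"
  shows "\<rho> p (\<lambda>f. r * X f + s * Y f) Z = r * \<rho> p X Z + s * \<rho> p Y Z"
  using metric assms unfolding riemannian_metric_def by blast

lemma metric_sym:
  assumes "X \<in> tangent_space A p" "Y \<in> tangent_space A p"
  shows "\<rho> p X Y = \<rho> p Y X"
  using metric assms unfolding riemannian_metric_def by blast

lemma metric_dir_vec:
  assumes c: "c \<in> A" "p \<in> fst c"
  shows "\<rho> p (dir_vec c v p) (dir_vec c w p) = v \<bullet> (metric_at c p *v w)"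
proof -
  note t = dir_vec_tangent[OF c]
  have l: "linear (\<lambda>v. \<rho> p (dir_vec c v p) (dir_vec c w p))" for w
  proof (rule linearI)
    show "\<rho> p (dir_vec c (a + b) p) (dir_vec c w p) = \<rho> p (dir_vec c a p) (dir_vec c w p) + \<rho> p (dir_vec c b p) (dir_vec c w p)" for a b
      using metric_linear[OF t t t, of 1 a 1 b w] dir_vec_linear[OF c, of 1 a 1 b] by simp
    show "\<rho> p (dir_vec c (r *\<^sub>R a) p) (dir_vec c w p) = r *\<^sub>R \<rho> p (dir_vec c a p) (dir_vec c w p)" for r a
      using metric_linear[OF t t t, of r a 0 a w] dir_vec_linear[OF c, of r a 0 a] by simp
  qed
  have exp: "\<rho> p (dir_vec c v p) (dir_vec c w p) = (\<Sum>i\<in>UNIV. v $ i * \<rho> p (dir_vec c (axis i 1) p) (dir_vec c w p))" for v w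
  proof -
    have "v = (\<Sum>i\<in>UNIV. v $ i *\<^sub>R axis i 1)" by (simp add: basis_expansion scalar_mult_eq_scaleR[symmetric])
    then have "\<rho> p (dir_vec c v p) (dir_vec c w p) = \<rho> p (dir_vec c (\<Sum>i\<in>UNIV. v $ i *\<^sub>R axis i 1) p) (dir_vec c w p)" by metis
    then show ?thesis using linear_sum[OF l[of w], of "\<lambda>i. v $ i *\<^sub>R axis i 1" UNIV] linear_cmul[OF l[of w]] by simp
  qed
  have "\<rho> p (dir_vec c (axis i 1) p) (dir_vec c w p) = (\<Sum>j\<in>UNIV. metric_at c p $ i $ j * w $ j)" for i
    unfolding metric_sym[OF t t, of "axis i 1" w] exp[of w]
    by (rule sum.cong) (simp_all add: metric_coeffs_def param_coord[OF c] coord_vector_eq metric_sym[OF t t, of _ "axis i 1"])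
  then show ?thesis unfolding exp[of v] by (simp add: inner_vec_def matrix_vector_mult_def)
qed

lemma metric_at_pos:
  assumes c: "c \<in> A" "p \<in> fst c" and "v \<noteq> 0"
  shows "v \<bullet> (metric_at c p *v v) > 0"
  using metric dir_vec_tangent[OF c] dir_vec_eq_0D[OF c] assms(3)
  unfolding riemannian_metric_def metric_dir_vec[OF c, symmetric] by blast

lemma metric_at_sym:
  assumes c: "c \<in> A" "p \<in> fst c"
  shows "v \<bullet> (metric_at c p *v w) = w \<bullet> (metric_at c p *v v)"
  using metric_sym[OF dir_vec_tangent[OF c] dir_vec_tangent[OF c]] unfolding metric_dir_vec[OF c, symmetric] .

definition isometric :: "('g \<Rightarrow> 'g) \<Rightarrow> bool" where
  "isometric \<Phi> \<longleftrightarrow> diffeo \<Phi> \<and> (\<forall>p. \<forall>X\<in>tangent_space A p. \<forall>Y\<in>tangent_space A p.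
     \<rho> (\<Phi> p) (push_forward \<Phi> X) (push_forward \<Phi> Y) = \<rho> p X Y)"

lemma isometric_compose:
  assumes "isometric \<Phi>" "isometric \<Psi>"
  shows "isometric (\<Phi> \<circ> \<Psi>)"
proof -
  have "push_forward (\<Phi> \<circ> \<Psi>) X = push_forward \<Phi> (push_forward \<Psi> X)" for X
    by (simp add: push_forward_def comp_assoc)
  then show ?thesis
    using assms push_forward_tangent diffeo_compose unfolding isometric_def by simp
qed

lemma isometric_metric:
  assumes \<Phi>: "isometric \<Phi>" and c: "c \<in> A" "p \<in> fst c" and d: "d \<in> A" "\<Phi> p \<in> fst d"
  shows "chart_deriv \<Phi> c d p v \<bullet> (metric_at d (\<Phi> p) *v chart_deriv \<Phi> c d p w) = v \<bullet> (metric_at c p *v w)"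
  using \<Phi> dir_vec_tangent[OF c] push_forward_dir_vec[where \<Phi> = \<Phi>, OF _ c d] unfolding isometric_def
  by (metis metric_dir_vec[OF c] metric_dir_vec[OF d])

end

section \<open>Lie groups and left-invariant vector fields\<close>

locale lie_grp =
  fixes G :: "'g::t2_space monoid" (structure) and A :: "('g, 'n::finite) chart set"
  assumes lie: "lie_group G A"

sublocale lie_grp \<subseteq> manifold A
  using lie unfolding lie_group_def manifold_def by blast

sublocale lie_grp \<subseteq> top_group G
  using lie unfolding lie_group_def top_group_def top_group_axioms_def by blast

context lie_grp
begin

lemma open_mult_domain:
  assumes "a \<in> A" "b \<in> A" "open U"
  shows "open {(x, y). x \<in> coord_range a \<and> y \<in> coord_range b \<and> param a x \<otimes> param b y \<in> U}"
proof -
  have "continuous_on (coord_range a \<times> coord_range b) (\<lambda>p. param a (fst p) \<otimes> param b (snd p))"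
    by (intro continuous_on_group_mult continuous_on_compose2[OF continuous_on_param[OF assms(1)]]
        continuous_on_compose2[OF continuous_on_param[OF assms(2)]] continuous_on_fst continuous_on_snd continuous_on_id) auto
  from continuous_open_preimage[OF this open_Times[OF open_coord_range[OF assms(1)] open_coord_range[OF assms(2)]] assms(3)]
  show ?thesis by (rule back_subst[where P = "open"]) auto
qed

lemma mult_smooth:
  assumes "a \<in> A" "b \<in> A" "c \<in> A"
  shows "smooth_on {(x, y). x \<in> coord_range a \<and> y \<in> coord_range b \<and> param a x \<otimes> param b y \<in> fst c}
           (\<lambda>(x, y). snd c (param a x \<otimes> param b y))"
  using lie assms unfolding lie_group_def by blast

lemma smooth_on_mult_pair:
  assumes f: "smooth_fun A f" and a: "a \<in> A" and b: "b \<in> A"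
  shows "smooth_on (coord_range a \<times> coord_range b) (\<lambda>p. f (param a (fst p) \<otimes> param b (snd p)))"
proof (rule smooth_on_local)
  fix p assume p: "p \<in> coord_range a \<times> coord_range b"
  obtain c where c: "c \<in> A" "param a (fst p) \<otimes> param b (snd p) \<in> fst c" by (rule chart_exists)
  let ?U = "{(x, y). x \<in> coord_range a \<and> y \<in> coord_range b \<and> param a x \<otimes> param b y \<in> fst c}"
  have U: "open ?U" by (rule open_mult_domain[OF a b open_chart_domain[OF c(1)]])
  have "smooth_on ?U (\<lambda>p. f (param c (case p of (x, y) \<Rightarrow> snd c (param a x \<otimes> param b y))))"
    by (rule smooth_on_compose[OF U _ mult_smooth[OF a b c(1)] smooth_fun_smooth_on[OF f c(1)]])
      (auto simp: coord_in)
  then have "smooth_on ?U (\<lambda>p. f (param a (fst p) \<otimes> param b (snd p)))"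
    by (rule smooth_on_cong[OF U, rotated]) (auto simp: param_coord[OF c(1)])
  then show "\<exists>U. open U \<and> p \<in> U \<and> smooth_on U (\<lambda>p. f (param a (fst p) \<otimes> param b (snd p)))"
    using U p c(2) by (intro exI[of _ ?U]) auto
qed

lemma smooth_map_left: "smooth_map (\<lambda>q. g \<otimes> q)"
  unfolding smooth_map_def
proof (intro conjI ballI)
  show "continuous_on UNIV (\<lambda>q. g \<otimes> q)"
    by (intro continuous_on_group_mult continuous_on_const continuous_on_id)
  then have cont: "continuous_on UNIV (\<lambda>q. g \<otimes> q)" .
  fix c d assume c: "c \<in> A" and d: "d \<in> A"
  obtain a where a: "a \<in> A" "g \<in> fst a" by (rule chart_exists)
  let ?U = "{x \<in> coord_range c. g \<otimes> param c x \<in> fst d}"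
  have U: "open ?U" by (rule open_param_vimage[OF c open_chart_domain[OF d] cont])
  have "smooth_on ?U (\<lambda>x. case (snd a g, x) of (x, y) \<Rightarrow> snd d (param a x \<otimes> param c y))"
    by (rule smooth_on_compose[OF U _ smooth_on_Pair[OF U smooth_on_const smooth_on_bounded_linear[OF bounded_linear_ident]]
          mult_smooth[OF a(1) c d]])
      (use a coord_in in \<open>auto simp: param_coord\<close>)
  then show "smooth_on ?U (\<lambda>x. snd d (g \<otimes> param c x))"
    by (rule smooth_on_cong[OF U, rotated]) (simp add: param_coord[OF a])
qed

lemma smooth_map_right: "smooth_map (\<lambda>q. q \<otimes> g)"
  unfolding smooth_map_def
proof (intro conjI ballI)
  show "continuous_on UNIV (\<lambda>q. q \<otimes> g)"
    by (intro continuous_on_group_mult continuous_on_const continuous_on_id)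
  then have cont: "continuous_on UNIV (\<lambda>q. q \<otimes> g)" .
  fix c d assume c: "c \<in> A" and d: "d \<in> A"
  obtain a where a: "a \<in> A" "g \<in> fst a" by (rule chart_exists)
  let ?U = "{x \<in> coord_range c. param c x \<otimes> g \<in> fst d}"
  have U: "open ?U" by (rule open_param_vimage[OF c open_chart_domain[OF d] cont])
  have "smooth_on ?U (\<lambda>x. case (x, snd a g) of (x, y) \<Rightarrow> snd d (param c x \<otimes> param a y))"
    by (rule smooth_on_compose[OF U _ smooth_on_Pair[OF U smooth_on_bounded_linear[OF bounded_linear_ident] smooth_on_const]
          mult_smooth[OF c a(1) d]])
      (use a coord_in in \<open>auto simp: param_coord\<close>)
  then show "smooth_on ?U (\<lambda>x. snd d (param c x \<otimes> g))"
    by (rule smooth_on_cong[OF U, rotated]) (simp add: param_coord[OF a])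
qed

lemma diffeo_left: "diffeo (\<lambda>q. g \<otimes> q)"
  unfolding diffeo_def using smooth_map_left
  by (auto intro!: exI[of _ "\<lambda>q. inv g \<otimes> q"] simp: fun_eq_iff)

lemma diffeo_right: "diffeo (\<lambda>q. q \<otimes> g)"
  unfolding diffeo_def using smooth_map_right
  by (auto intro!: exI[of _ "\<lambda>q. q \<otimes> inv g"] simp: fun_eq_iff m_assoc)

definition unit_chart :: "('g, 'n) chart" where
  "unit_chart = (SOME c. c \<in> A \<and> \<one> \<in> fst c)"

definition unit_coord :: "real^'n" where
  "unit_coord = snd unit_chart \<one>"

definition near_unit :: "real^'n \<Rightarrow> 'g" where
  "near_unit z = param unit_chart z"

lemma unit_chart: "unit_chart \<in> A" "\<one> \<in> fst unit_chart"
proof -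
  have "\<exists>c. c \<in> A \<and> \<one> \<in> fst c" using chart_exists by metis
  then have "unit_chart \<in> A \<and> \<one> \<in> fst unit_chart" unfolding unit_chart_def by (rule someI_ex)
  then show "unit_chart \<in> A" "\<one> \<in> fst unit_chart" by auto
qed

lemma unit_coord_in: "unit_coord \<in> coord_range unit_chart"
  using unit_chart(2) by (simp add: unit_coord_def)

lemma near_unit_unit_coord [simp]: "near_unit unit_coord = \<one>"
  using param_coord[OF unit_chart] by (simp add: near_unit_def unit_coord_def)

lemma continuous_near_unit: "continuous_on (coord_range unit_chart) near_unit"
  using continuous_on_param[OF unit_chart(1)] unfolding near_unit_def .

text \<open>The value at \<open>p\<close>, in the coordinates of \<open>c\<close>, of the left-invariant field extending \<open>v\<close>.\<close>

definition frame :: "('g, 'n) chart \<Rightarrow> 'g \<Rightarrow> real^'n \<Rightarrow> real^'n" where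
  "frame c p = chart_deriv (\<lambda>q. p \<otimes> q) unit_chart c \<one>"

lemma frame_has_derivative:
  assumes "c \<in> A" "p \<in> fst c"
  shows "((\<lambda>z. snd c (p \<otimes> near_unit z)) has_derivative frame c p) (at unit_coord)"
  using chart_deriv_has_derivative[OF smooth_map_left unit_chart assms(1), of p] assms(2)
  by (simp add: frame_def near_unit_def unit_coord_def)

lemma linear_frame: "c \<in> A \<Longrightarrow> p \<in> fst c \<Longrightarrow> bounded_linear (frame c p)"
  using frame_has_derivative has_derivative_bounded_linear by blast

text \<open>Recognises the frame as a partial derivative of the multiplication read in charts, a
  smooth map of two variables; its smooth dependence on the base point follows.\<close>

lemma frame_eq_partial:
  assumes c: "c \<in> A" and y: "y \<in> coord_range c"
  shows "frame c (param c y) v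
    = frechet_derivative (\<lambda>(y, z). snd c (param c y \<otimes> param unit_chart z)) (at (y, unit_coord)) (0, v)"
proof -
  let ?F = "\<lambda>(y, z). snd c (param c y \<otimes> param unit_chart z)"
  have "(y, unit_coord) \<in> {(x, z). x \<in> coord_range c \<and> z \<in> coord_range unit_chart \<and> param c x \<otimes> param unit_chart z \<in> fst c}"
    using y unit_coord_in param_in[OF c y] near_unit_unit_coord by (auto simp: near_unit_def)
  then have F: "(?F has_derivative frechet_derivative ?F (at (y, unit_coord))) (at (y, unit_coord))"
    by (rule smooth_on_has_derivative[OF mult_smooth[OF c unit_chart(1) c]])
  have "((\<lambda>z. (y, z)) has_derivative (\<lambda>v. (0, v))) (at unit_coord)"
    by (auto intro!: derivative_eq_intros)
  from has_derivative_compose[OF this F]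
  have "((\<lambda>z. snd c (param c y \<otimes> near_unit z)) has_derivative
      (\<lambda>v. frechet_derivative ?F (at (y, unit_coord)) (0, v))) (at unit_coord)"
    by (simp add: near_unit_def)
  from has_derivative_unique[OF this frame_has_derivative[OF c param_in[OF c y]]]
  show ?thesis by metis
qed

lemma smooth_on_frame:
  assumes c: "c \<in> A"
  shows "smooth_on (coord_range c) (\<lambda>y. frame c (param c y) v)"
proof -
  let ?F = "\<lambda>(y, z). snd c (param c y \<otimes> param unit_chart z)"
  let ?O = "{(x, z). x \<in> coord_range c \<and> z \<in> coord_range unit_chart \<and> param c x \<otimes> param unit_chart z \<in> fst c}"
  have "smooth_on (coord_range c) (\<lambda>y. frechet_derivative ?F (at (y, unit_coord)) (0, v))"
  proof (rule smooth_on_compose[where T = ?O and f = "\<lambda>y. (y, unit_coord)"])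
    show "smooth_on (coord_range c) (\<lambda>y. (y, unit_coord))"
      by (intro smooth_on_Pair open_coord_range c smooth_on_const smooth_on_bounded_linear bounded_linear_ident)
    show "smooth_on ?O (\<lambda>x. frechet_derivative ?F (at x) (0, v))"
      by (rule smooth_on_frechet[OF mult_smooth[OF c unit_chart(1) c]])
    show "(\<lambda>y. (y, unit_coord)) ` coord_range c \<subseteq> ?O"
      using unit_coord_in param_in[OF c] near_unit_unit_coord by (auto simp: near_unit_def)
  qed (rule open_coord_range[OF c])
  then show ?thesis
    by (rule smooth_on_cong[OF open_coord_range[OF c], rotated]) (simp add: frame_eq_partial[OF c])
qed

text \<open>The left-invariant field with value \<open>v\<close> at the unit. Using translated
  functions instead of components makes invariance immediate and needs no chart at
  \<open>p\<close>.\<close>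

definition left_field :: "real^'n \<Rightarrow> ('g \<Rightarrow> real) \<Rightarrow> 'g \<Rightarrow> real" where
  "left_field v f p = dir_vec unit_chart v \<one> (\<lambda>q. f (p \<otimes> q))"

lemma left_field_eq:
  assumes "c \<in> A" "p \<in> fst c"
  shows "left_field v f p = dir_vec c (frame c p v) p f"
  using push_forward_dir_vec[OF diffeo_left unit_chart assms(1), of p v] assms(2)
  by (simp add: left_field_def frame_def push_forward_def fun_eq_iff o_def)

lemma left_field_has_derivative:
  assumes "smooth_fun A f"
  shows "((\<lambda>z. f (p \<otimes> near_unit z)) has_derivative (\<lambda>v. left_field v f p)) (at unit_coord)"
  using smooth_fun_has_derivative[OF smooth_fun_compose[OF assms smooth_map_left] unit_chart, of p]
  by (simp add: left_field_def near_unit_def unit_coord_def o_def)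

lemma left_field_not_smooth: "\<not> smooth_fun A f \<Longrightarrow> left_field v f p = 0"
  using diffeo_smooth_fun_iff[OF diffeo_left, of f p] by (simp add: left_field_def dir_vec_def o_def)

lemma smooth_fun_left_field:
  assumes f: "smooth_fun A f"
  shows "smooth_fun A (left_field v f)"
  unfolding smooth_fun_def
proof
  fix c assume c: "c \<in> A"
  have "smooth_on (coord_range c) (\<lambda>y. frechet_derivative (\<lambda>x. f (param c x)) (at y) (frame c (param c y) v))"
    by (intro smooth_on_frechet_apply open_coord_range c smooth_on_frame smooth_fun_smooth_on[OF f])
  then show "smooth_on (coord_range c) (\<lambda>x. left_field v f (param c x))"
    by (rule smooth_on_cong[OF open_coord_range[OF c], rotated])
      (simp add: left_field_eq[OF c param_in[OF c]] dir_vec_def f coord_param[OF c])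
qed

lemma left_field_linear:
  "left_field (r *\<^sub>R v + s *\<^sub>R w) f p = r * left_field v f p + s * left_field w f p"
  by (simp add: left_field_def dir_vec_linear[OF unit_chart])

lemma left_field_lie_algebra: "left_field v \<in> lie_algebra G A"
  unfolding lie_algebra_def vector_field_def
proof (intro CollectI conjI allI impI)
  show "smooth_fun A f \<Longrightarrow> smooth_fun A (left_field v f)" for f by (rule smooth_fun_left_field)
  show "\<not> smooth_fun A f \<Longrightarrow> left_field v f = (\<lambda>p. 0)" for f
    using left_field_not_smooth by blast
  have t: "\<exists>X\<in>tangent_space A p. \<forall>f. left_field v f p = X f" for p
    using chart_exists[of p] dir_vec_tangent left_field_eq by metis
  show "left_field v (\<lambda>p. r * f p + s * h p) = (\<lambda>p. r * left_field v f p + s * left_field v h p)"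
    if "smooth_fun A f \<and> smooth_fun A h" for f h r s
  proof
    fix p
    obtain X where "X \<in> tangent_space A p" "\<And>f. left_field v f p = X f" using t[of p] by blast
    then show "left_field v (\<lambda>p. r * f p + s * h p) p = r * left_field v f p + s * left_field v h p"
      using that unfolding tangent_space_def by simp
  qed
  show "left_field v (\<lambda>p. f p * h p) = (\<lambda>p. f p * left_field v h p + h p * left_field v f p)"
    if "smooth_fun A f \<and> smooth_fun A h" for f h
  proof
    fix p
    obtain X where "X \<in> tangent_space A p" "\<And>f. left_field v f p = X f" using t[of p] by blast
    then show "left_field v (\<lambda>p. f p * h p) p = f p * left_field v h p + h p * left_field v f p"
      using that unfolding tangent_space_def by simp
  qed
  show "left_field v (\<lambda>p. f (g \<otimes> p)) = (\<lambda>p. left_field v f (g \<otimes> p))" for g f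
    by (rule ext) (simp add: left_field_def m_assoc)
qed

text \<open>By invariance, \<open>E f p\<close> is the value at the unit of \<open>E\<close> on the
  translate of \<open>f\<close> by \<open>p\<close>; and the value of \<open>E\<close> at the unit,
  being a derivation there, is a coordinate derivation.\<close>

lemma lie_algebra_left_field:
  assumes E: "E \<in> lie_algebra G A"
  obtains w where "E = left_field w"
proof -
  have "vector_field A E" using E by (simp add: lie_algebra_def)
  note V = this[unfolded vector_field_def, THEN conjunct2]
  have Es: "E f = (\<lambda>p. 0)" if "\<not> smooth_fun A f" for f
    by (rule V[THEN conjunct1, rule_format, OF that])
  have Elin: "E (\<lambda>p. r * f p + s * h p) = (\<lambda>p. r * E f p + s * E h p)"
    if "smooth_fun A f" "smooth_fun A h" for f h r s
    by (rule V[THEN conjunct2, THEN conjunct1, rule_format, OF conjI[OF that]])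
  have Eprod: "E (\<lambda>p. f p * h p) = (\<lambda>p. f p * E h p + h p * E f p)"
    if "smooth_fun A f" "smooth_fun A h" for f h
    by (rule V[THEN conjunct2, THEN conjunct2, rule_format, OF conjI[OF that]])
  have Einv: "E (\<lambda>p. f (g \<otimes> p)) = (\<lambda>p. E f (g \<otimes> p))" if "smooth_fun A f" for f g
    using E that by (simp add: lie_algebra_def)
  have "(\<lambda>f. E f \<one>) \<in> tangent_space A \<one>"
    unfolding tangent_space_def by (auto simp: Es Elin Eprod)
  then obtain w where w: "(\<lambda>f. E f \<one>) = dir_vec unit_chart w \<one>"
    by (rule tangent_space_dir_vec[OF unit_chart])
  have "E f p = left_field w f p" for f p
  proof (cases "smooth_fun A f")
    case True
    then have "E f p = E (\<lambda>q. f (p \<otimes> q)) \<one>" by (simp add: Einv)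
    then show ?thesis using fun_cong[OF w, of "\<lambda>q. f (p \<otimes> q)"] by (simp add: left_field_def)
  qed (simp add: Es left_field_not_smooth)
  then have "E = left_field w" by blast
  then show thesis by (rule that)
qed

section \<open>The adjoint action and invariant vectors\<close>

definition conjugation :: "'g \<Rightarrow> 'g \<Rightarrow> 'g" where
  "conjugation g = (\<lambda>q. q \<otimes> inv g) \<circ> (\<lambda>q. g \<otimes> q)"

lemma conjugation_one [simp]: "conjugation g \<one> = \<one>"
  by (simp add: conjugation_def)

lemma diffeo_conjugation: "diffeo (conjugation g)"
  unfolding conjugation_def by (intro diffeo_compose diffeo_left diffeo_right)

definition Ad :: "'g \<Rightarrow> real^'n \<Rightarrow> real^'n" where
  "Ad g = chart_deriv (conjugation g) unit_chart unit_chart \<one>"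

lemma Ad_has_derivative:
  "((\<lambda>z. snd unit_chart (conjugation g (near_unit z))) has_derivative Ad g) (at unit_coord)"
proof -
  have "smooth_map (conjugation g)" using diffeo_conjugation by (simp add: diffeo_def)
  from chart_deriv_has_derivative[OF this unit_chart unit_chart(1)] show ?thesis
    using unit_chart(2) by (simp add: Ad_def near_unit_def unit_coord_def)
qed

text \<open>Since \<open>p \<otimes> q = conjugation p q \<otimes> p\<close>, the left-invariant and
  the right-invariant field through \<open>v\<close> agree at every point whose adjoint action fixes
  \<open>v\<close>.\<close>

lemma invariant_left_field_eq:
  assumes "Ad p v = v"
  shows "left_field v f p = dir_vec unit_chart v \<one> (\<lambda>q. f (q \<otimes> p))"
proof -
  have "(\<lambda>q. f (p \<otimes> q)) = (\<lambda>q. f (q \<otimes> p)) \<circ> conjugation p"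
    by (auto simp: conjugation_def fun_eq_iff m_assoc)
  then show ?thesis
    using fun_cong[OF push_forward_dir_vec[OF diffeo_conjugation unit_chart unit_chart(1), of p v], of "\<lambda>q. f (q \<otimes> p)"]
      assms unit_chart(2) by (simp add: left_field_def push_forward_def Ad_def)
qed

text \<open>For \<open>H (x, z) = f (x p z)\<close> the field of \<open>w\<close> differentiates in
  \<open>z\<close>, and the field of the invariant vector \<open>v\<close>, being right-invariant
  too, differentiates in \<open>x\<close>. So the claim is the symmetry of mixed
  derivatives.\<close>

lemma invariant_left_field_commute:
  assumes inv: "\<And>g. Ad g v = v" and f: "smooth_fun A f"
  shows "left_field v (left_field w f) p = left_field w (left_field v f) p"
proof -
  obtain d where d: "d \<in> A" "p \<in> fst d" by (rule chart_exists)
  let ?R = "coord_range unit_chart"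
  \<comment> \<open>Smoothness of the multiplication is given between charts; \<open>?Z\<close>
    keeps \<open>p \<otimes> near_unit z\<close> in the domain of the single chart \<open>d\<close>,
    through which \<open>H\<close> is then factored.\<close>
  let ?Z = "{z \<in> ?R. p \<otimes> param unit_chart z \<in> fst d}"
  let ?S = "?R \<times> ?Z"
  define H where "H = (\<lambda>q. f (near_unit (fst q) \<otimes> (p \<otimes> near_unit (snd q))))"
  have Z: "open ?Z" by (rule smooth_map_open_vimage[OF smooth_map_left unit_chart(1) d(1)])
  have S: "open ?S" by (intro open_Times Z open_coord_range unit_chart(1))
  have "smooth_on ?S (\<lambda>q. (fst q, snd d (p \<otimes> param unit_chart (snd q))))"
    by (intro smooth_on_Pair[OF S] smooth_on_bounded_linear[OF bounded_linear_fst]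
        smooth_on_compose[OF S _ smooth_on_bounded_linear[OF bounded_linear_snd] smooth_map_chart[OF smooth_map_left unit_chart(1) d(1)]])
      auto
  from smooth_on_compose[OF S _ this smooth_on_mult_pair[OF f unit_chart(1) d(1)]]
  have "smooth_on ?S (\<lambda>q. f (param unit_chart (fst q) \<otimes> param d (snd d (p \<otimes> param unit_chart (snd q)))))"
    by (auto simp: image_subset_iff coord_in)
  then have H: "smooth_on ?S H"
    by (rule smooth_on_cong[OF S, rotated]) (auto simp: H_def near_unit_def param_coord[OF d(1)])
  have Hd: "(H has_derivative frechet_derivative H (at q)) (at q)" if "q \<in> ?S" for q
    by (rule smooth_on_has_derivative[OF H that])
  have u: "unit_coord \<in> ?R" "unit_coord \<in> ?Z"
    using unit_coord_in d(2) near_unit_unit_coord by (simp_all add: near_unit_def[symmetric])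
  have Hx: "((\<lambda>x. H (x, z)) has_derivative (\<lambda>v. frechet_derivative H (at (x, z)) (v, 0))) (at x)"
    if "x \<in> ?R" "z \<in> ?Z" for x z
  proof -
    have "(x, z) \<in> ?S" using that by simp
    moreover have "((\<lambda>x. (x, z)) has_derivative (\<lambda>v. (v, 0))) (at x)"
      by (auto intro!: derivative_eq_intros)
    ultimately show ?thesis using has_derivative_compose Hd by blast
  qed
  have Hz: "((\<lambda>z. H (x, z)) has_derivative (\<lambda>v. frechet_derivative H (at (x, z)) (0, v))) (at z)"
    if "x \<in> ?R" "z \<in> ?Z" for x z
  proof -
    have "(x, z) \<in> ?S" using that by simp
    moreover have "((\<lambda>z. (x, z)) has_derivative (\<lambda>v. (0, v))) (at z)"
      by (auto intro!: derivative_eq_intros)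
    ultimately show ?thesis using has_derivative_compose Hd by blast
  qed
  have w1: "left_field w f (near_unit x \<otimes> p) = frechet_derivative H (at (x, unit_coord)) (0, w)" if "x \<in> ?R" for x
    using has_derivative_unique[OF left_field_has_derivative[OF f, of "near_unit x \<otimes> p"], of "\<lambda>v. frechet_derivative H (at (x, unit_coord)) (0, v)"]
      Hz[OF that u(2)] by (auto simp: H_def m_assoc dest: fun_cong[of _ _ w])
  have v1: "left_field v f (p \<otimes> near_unit z) = frechet_derivative H (at (unit_coord, z)) (v, 0)" if "z \<in> ?Z" for z
  proof -
    have "left_field v f (p \<otimes> near_unit z) = dir_vec unit_chart v \<one> (\<lambda>q. f (q \<otimes> (p \<otimes> near_unit z)))"
      by (rule invariant_left_field_eq[OF inv])
    also have "\<dots> = frechet_derivative H (at (unit_coord, z)) (v, 0)"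
    proof (rule dir_vec_eqI)
      show "((\<lambda>x. f (param unit_chart x \<otimes> (p \<otimes> near_unit z))) has_derivative
          (\<lambda>v. frechet_derivative H (at (unit_coord, z)) (v, 0))) (at (snd unit_chart \<one>))"
        using Hx[OF u(1) that] by (simp add: H_def near_unit_def unit_coord_def)
      show "smooth_fun A (\<lambda>q. f (q \<otimes> (p \<otimes> near_unit z)))"
        using smooth_fun_compose[OF f smooth_map_right] by (simp add: o_def)
    qed
    finally show ?thesis .
  qed
  have DH: "(\<lambda>q. frechet_derivative H (at q) e) differentiable at (unit_coord, unit_coord)" for e
    by (rule smooth_on_differentiable[OF smooth_on_frechet[OF H]]) (use u in auto)
  have "left_field v (left_field w f) p = dir_vec unit_chart v \<one> (\<lambda>q. left_field w f (q \<otimes> p))"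
    by (rule invariant_left_field_eq[OF inv])
  also have "\<dots> = frechet_derivative (\<lambda>q. frechet_derivative H (at q) (0, w)) (at (unit_coord, unit_coord)) (v, 0)"
  proof (rule dir_vec_eqI)
    show "smooth_fun A (\<lambda>q. left_field w f (q \<otimes> p))"
      using smooth_fun_compose[OF smooth_fun_left_field[OF f] smooth_map_right] by (simp add: o_def)
    have "((\<lambda>x. (x, unit_coord)) has_derivative (\<lambda>v. (v, 0))) (at unit_coord)"
      by (auto intro!: derivative_eq_intros)
    from has_derivative_compose[OF this DH[of "(0, w)", unfolded frechet_derivative_works]]
    have "((\<lambda>x. left_field w f (near_unit x \<otimes> p)) has_derivative
      (\<lambda>v. frechet_derivative (\<lambda>q. frechet_derivative H (at q) (0, w)) (at (unit_coord, unit_coord)) (v, 0))) (at unit_coord)"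
      by (rule has_derivative_transform_within_open[OF _ open_coord_range[OF unit_chart(1)] unit_coord_in]) (simp add: w1)
    then show "((\<lambda>x. left_field w f (param unit_chart x \<otimes> p)) has_derivative
      (\<lambda>v. frechet_derivative (\<lambda>q. frechet_derivative H (at q) (0, w)) (at (unit_coord, unit_coord)) (v, 0))) (at (snd unit_chart \<one>))"
      by (simp add: near_unit_def unit_coord_def)
  qed
  also have "\<dots> = frechet_derivative (\<lambda>q. frechet_derivative H (at q) (v, 0)) (at (unit_coord, unit_coord)) (0, w)"
    by (rule mixed_derivatives_commute[OF smooth_onD[OF H] S]) (use u in auto)
  also have "\<dots> = left_field w (left_field v f) p"
  proof -
    have "((\<lambda>z. (unit_coord, z)) has_derivative (\<lambda>v. (0, v))) (at unit_coord)"
      by (auto intro!: derivative_eq_intros)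
    from has_derivative_compose[OF this DH[of "(v, 0)", unfolded frechet_derivative_works]]
    have "((\<lambda>z. left_field v f (p \<otimes> near_unit z)) has_derivative
      (\<lambda>w. frechet_derivative (\<lambda>q. frechet_derivative H (at q) (v, 0)) (at (unit_coord, unit_coord)) (0, w))) (at unit_coord)"
      by (rule has_derivative_transform_within_open[OF _ Z u(2)]) (simp add: v1)
    from has_derivative_unique[OF this left_field_has_derivative[OF smooth_fun_left_field[OF f]]]
    show ?thesis by metis
  qed
  finally show ?thesis .
qed

text \<open>The fields of multiples of an invariant vector commute with all left-invariant fields,
  so they form an abelian ideal, which semisimplicity forces to be zero.\<close>

lemma semisimple_no_invariant_vector:
  assumes ss: "semisimple_lie_group G A" and inv: "\<And>g. Ad g v = v"
  shows "v = 0"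
proof -
  let ?I = "range (\<lambda>r. left_field (r *\<^sub>R v))"
  have lin: "left_field (r *\<^sub>R v) = (\<lambda>f p. r * left_field v f p)" for r
    using left_field_linear[of r v 0 v] by (auto simp: fun_eq_iff)
  have comm: "lie_bracket D E = (\<lambda>f p. 0)" if DL: "D \<in> lie_algebra G A" and EI: "E \<in> ?I" for D E
  proof -
    obtain w where D: "D = left_field w" by (rule lie_algebra_left_field[OF DL])
    obtain r where E: "E = left_field (r *\<^sub>R v)" using EI by blast
    have lc: "left_field w (\<lambda>p. r * h p) p = r * left_field w h p" if "smooth_fun A h" for h p
    proof -
      have "vector_field A (left_field w)" using left_field_lie_algebra[of w] by (simp add: lie_algebra_def)
      from this[unfolded vector_field_def, THEN conjunct2, THEN conjunct2, THEN conjunct1, rule_format, OF conjI[OF that that], of r 0]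
      show ?thesis by (simp add: fun_eq_iff)
    qed
    have "D (E f) p = E (D f) p" for f p
    proof (cases "smooth_fun A f")
      case True
      then show ?thesis
        by (simp add: D E lin lc smooth_fun_left_field invariant_left_field_commute[OF inv])
    next
      case False
      \<comment> \<open>On a function that is not smooth, both fields return the zero function by
        normalisation; the field applied afterwards annihilates it, so the bracket vanishes there as
        well.\<close>
      have z: "left_field u (\<lambda>p. 0) p = 0" for u p
        using left_field_has_derivative[OF smooth_fun_const[of 0], of p]
          has_derivative_unique[OF has_derivative_const] by metis
      have "left_field u f = (\<lambda>p. 0)" for u using False left_field_not_smooth by blast
      then show ?thesis by (simp add: D E z)
    qed
    then show ?thesis by (simp add: lie_bracket_def)
  qed
  have zero: "(\<lambda>f p. 0) \<in> ?I" using lin[of 0] by (intro image_eqI[of _ _ 0]) auto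
  have sub: "?I \<subseteq> lie_algebra G A" using left_field_lie_algebra by blast
  have "lie_ideal G A ?I"
    unfolding lie_ideal_def
  proof (intro conjI ballI allI sub zero)
    fix D E r s assume "D \<in> ?I" "E \<in> ?I"
    then obtain a b where "D = left_field (a *\<^sub>R v)" "E = left_field (b *\<^sub>R v)" by blast
    then show "(\<lambda>f p. r * D f p + s * E f p) \<in> ?I"
      by (intro image_eqI[of _ _ "r * a + s * b"]) (auto simp: lin fun_eq_iff distrib_right mult.assoc)
  next
    fix D E assume "D \<in> lie_algebra G A" "E \<in> ?I"
    then show "lie_bracket D E \<in> ?I" using comm zero by simp
  qed
  moreover have "\<forall>D\<in>?I. \<forall>E\<in>?I. lie_bracket D E = (\<lambda>f p. 0)"
  proof (intro ballI)
    fix D E assume "D \<in> ?I" "E \<in> ?I"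
    then show "lie_bracket D E = (\<lambda>f p. 0)" by (intro comm subsetD[OF sub])
  qed
  ultimately have "?I = {\<lambda>f p. 0}"
    by (intro ss[unfolded semisimple_lie_group_def, THEN conjunct2, rule_format] conjI)
  moreover have "left_field (1 *\<^sub>R v) \<in> ?I" by (rule rangeI)
  ultimately have "left_field v = (\<lambda>f p. 0)" by simp
  then have "left_field v f \<one> = 0" for f by simp
  then have "dir_vec unit_chart v \<one> = (\<lambda>f. 0)" by (simp add: left_field_def fun_eq_iff)
  then show ?thesis by (rule dir_vec_eq_0D[OF unit_chart])
qed

end

section \<open>Consequences of a bi-invariant metric\<close>

locale bi_invariant_lie_group = lie_grp G A + riemannian_manifold A \<rho>
  for G :: "'g::t2_space monoid" (structure) and A :: "('g, 'n::finite) chart set" and \<rho> +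
  assumes bi_inv: "bi_invariant G A \<rho>"
begin

lemma isometric_left: "isometric (\<lambda>q. g \<otimes> q)"
  using bi_inv diffeo_left unfolding isometric_def bi_invariant_def by simp

lemma isometric_right: "isometric (\<lambda>q. q \<otimes> g)"
  using bi_inv diffeo_right unfolding isometric_def bi_invariant_def by simp

abbreviation unit_metric :: "real^'n^'n" where
  "unit_metric \<equiv> metric_at unit_chart \<one>"

lemma frame_metric:
  assumes "c \<in> A" "p \<in> fst c"
  shows "frame c p v \<bullet> (metric_at c p *v frame c p w) = v \<bullet> (unit_metric *v w)"
  using isometric_metric[OF isometric_left unit_chart assms(1), of p] assms(2) by (simp add: frame_def)

lemma frame_eq_0D: "c \<in> A \<Longrightarrow> p \<in> fst c \<Longrightarrow> frame c p v = 0 \<Longrightarrow> v = 0"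
  using frame_metric[of c p v v] metric_at_pos[OF unit_chart, of v] by (cases "v = 0") auto

lemma Ad_metric: "Ad g v \<bullet> (unit_metric *v Ad g w) = v \<bullet> (unit_metric *v w)"
  using isometric_metric[OF isometric_compose[OF isometric_right isometric_left] unit_chart unit_chart(1), of "inv g" g]
    unit_chart(2) by (simp add: Ad_def conjugation_def)

lemma linear_surj_if_trivial_kernel:
  fixes f :: "real^'n \<Rightarrow> real^'n"
  assumes "linear f" "\<And>v. f v = 0 \<Longrightarrow> v = 0"
  shows "surj f"
  using assms linear_injective_imp_surjective linear_injective_0 by blast

lemma frame_surj: "c \<in> A \<Longrightarrow> p \<in> fst c \<Longrightarrow> surj (frame c p)"
  using linear_surj_if_trivial_kernel linear_frame frame_eq_0D bounded_linear.linear by blast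

lemma Ad_surj: "surj (Ad g)"
proof (rule linear_surj_if_trivial_kernel)
  show "linear (Ad g)" using Ad_has_derivative has_derivative_linear by blast
  show "v = 0" if "Ad g v = 0" for v
    using that Ad_metric[of g v v] metric_at_pos[OF unit_chart, of v] by (cases "v = 0") auto
qed

text \<open>The metric at the unit is Ad-invariant, so it represents an invariant functional by an
  invariant vector.\<close>

lemma semisimple_no_invariant_functional:
  assumes ss: "semisimple_lie_group G A" and l: "linear l" and inv: "\<And>g v. l (Ad g v) = (l v :: real)"
  shows "l v = 0"
proof -
  define a where "a = adjoint l 1"
  have a: "l w = w \<bullet> a" for w using adjoint_works[OF l, of w 1] by (simp add: a_def)
  have "surj ((*v) unit_metric)"
  proof (rule linear_surj_if_trivial_kernel)
    show "u = 0" if "unit_metric *v u = 0" for u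
      using that metric_at_pos[OF unit_chart, of u] by (cases "u = 0") auto
  qed simp
  then obtain u where u: "unit_metric *v u = a" by (metis surjD)
  have lu: "l w = u \<bullet> (unit_metric *v w)" for w
    unfolding metric_at_sym[OF unit_chart, of u w] by (simp add: a u)
  have "Ad g u = u" for g
  proof -
    \<comment> \<open>\<open>Ad g u\<close> and \<open>u\<close> have the same product with every
      \<open>Ad g w\<close>, and these vectors exhaust the space.\<close>
    have "(Ad g u - u) \<bullet> (unit_metric *v Ad g w) = 0" for w
      using Ad_metric[of g u w] lu[of w] lu[of "Ad g w"] inv[of g w] by (simp add: inner_diff_left)
    then have "(Ad g u - u) \<bullet> (unit_metric *v w) = 0" for w
      using Ad_surj[of g] by (metis surjD)
    from this[of "Ad g u - u"] show ?thesis using metric_at_pos[OF unit_chart, of "Ad g u - u"] by (cases "Ad g u - u = 0") auto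
  qed
  then have "u = 0" by (rule semisimple_no_invariant_vector[OF ss])
  then show ?thesis by (simp add: lu)
qed

end

section \<open>Differentiability of continuous representations\<close>

text \<open>Additivity gives homogeneity for integers. For real \<open>r\<close> the defect at
  \<open>n * r\<close> is \<open>n\<close> times the defect at \<open>r\<close>, yet it depends only
  on the fractional part of \<open>n * r\<close> and so stays bounded.\<close>

lemma additive_bounded_imp_bounded_linear:
  fixes E :: "'a::real_normed_vector \<Rightarrow> 'b::real_normed_vector"
  assumes add: "\<And>x y. E (x + y) = E x + E y" and bound: "\<And>x. norm (E x) \<le> K * norm x"
  shows "bounded_linear E"
proof (rule bounded_linear_intro)
  interpret additive E by standard (rule add)
  have nat: "E (real n *\<^sub>R x) = real n *\<^sub>R E x" for n x
    by (induction n) (auto simp: zero add scaleR_add_left)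
  have int: "E (of_int i *\<^sub>R x) = of_int i *\<^sub>R E x" for i x
  proof (cases "i \<ge> 0")
    case True
    then show ?thesis using nat[of "nat i" x] by simp
  next
    case False
    then show ?thesis using nat[of "nat (- i)" "- x"] by (simp add: minus)
  qed
  have K: "0 \<le> K * norm x" for x :: 'a using bound[of x] norm_ge_zero order_trans by blast
  show "E (r *\<^sub>R x) = r *\<^sub>R E x" for r x
  proof (rule ccontr)
    define \<delta> where "\<delta> = norm (E (r *\<^sub>R x) - r *\<^sub>R E x)"
    assume "E (r *\<^sub>R x) \<noteq> r *\<^sub>R E x"
    then have "\<delta> > 0" by (simp add: \<delta>_def)
    have le: "real n * \<delta> \<le> 2 * (K * norm x)" for n
    proof -
      define m where "m = \<lfloor>real n * r\<rfloor>"
      define \<theta> where "\<theta> = real n * r - of_int m"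
      have \<theta>: "0 \<le> \<theta>" "\<theta> \<le> 1" unfolding \<theta>_def m_def by linarith+
      have nr: "real n * r = of_int m + \<theta>" by (simp add: \<theta>_def)
      have "real n *\<^sub>R E (r *\<^sub>R x) = E ((of_int m + \<theta>) *\<^sub>R x)"
        using nat[of n "r *\<^sub>R x"] by (simp add: nr[symmetric])
      also have "\<dots> = of_int m *\<^sub>R E x + E (\<theta> *\<^sub>R x)" by (simp add: scaleR_add_left add int)
      finally have "real n *\<^sub>R (E (r *\<^sub>R x) - r *\<^sub>R E x) = E (\<theta> *\<^sub>R x) - \<theta> *\<^sub>R E x"
        by (simp add: scaleR_diff_right nr scaleR_add_left)
      then have "real n * \<delta> = norm (E (\<theta> *\<^sub>R x) - \<theta> *\<^sub>R E x)"
        unfolding \<delta>_def by (metis abs_of_nat norm_scaleR)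
      also have "\<dots> \<le> norm (E (\<theta> *\<^sub>R x)) + \<theta> * norm (E x)"
        using norm_triangle_ineq4[of "E (\<theta> *\<^sub>R x)" "\<theta> *\<^sub>R E x"] \<theta> by simp
      also have "\<dots> \<le> \<theta> * (K * norm x) + \<theta> * (K * norm x)"
        using bound[of "\<theta> *\<^sub>R x"] bound[of x] \<theta> by (intro add_mono mult_left_mono) (auto simp: mult_ac)
      also have "\<dots> \<le> 1 * (K * norm x) + 1 * (K * norm x)"
        using \<theta> K by (intro add_mono mult_right_mono) auto
      finally show ?thesis by simp
    qed
    obtain n where "2 * (K * norm x) < real n * \<delta>" using \<open>\<delta> > 0\<close> reals_Archimedean3 by blast
    with le[of n] show False by simp
  qed
  show "norm (E x) \<le> norm x * K" for x using bound[of x] by (simp add: mult.commute)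
qed (rule add)

text \<open>The Hyers--Ulam argument: the derivative is the limit of \<open>2\<^sup>n s (x / 2\<^sup>n)\<close>.\<close>

lemma almost_additive_differentiable:
  fixes s :: "'a::real_normed_vector \<Rightarrow> 'b::banach"
  assumes d: "d > 0" and C: "C \<ge> 0"
    and add: "\<And>x y. norm x < d \<Longrightarrow> norm y < d \<Longrightarrow> norm (s (x + y) - s x - s y) \<le> C * norm x * norm y"
    and bound: "\<And>x. norm x < d \<Longrightarrow> norm (s x) \<le> K * norm x"
  shows "\<exists>E. (s has_derivative E) (at 0)"
proof -
  define q where "q n x = (2 ^ n) *\<^sub>R s ((1 / 2 ^ n) *\<^sub>R x)" for n x
  have small: "\<exists>N. \<forall>n\<ge>N. norm ((1 / 2 ^ n) *\<^sub>R x) < d" for x :: 'a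
  proof -
    have "(\<lambda>n. (1 / 2) ^ n * norm x) \<longlonglongrightarrow> 0 * norm x" by (intro tendsto_mult LIMSEQ_power_zero tendsto_const) auto
    then have "eventually (\<lambda>n. (1 / 2) ^ n * norm x < d) sequentially" using d by (intro order_tendstoD) auto
    then show ?thesis by (simp add: eventually_sequentially power_one_over)
  qed
  \<comment> \<open>With \<open>y = x / 2 ^ Suc n\<close> the difference is \<open>2 ^ n\<close>
    times the additivity defect of \<open>s\<close> at the pair \<open>(y, y)\<close>, which is
    quadratic in \<open>y\<close>: the increments decay geometrically.\<close>
  have step: "norm (q (Suc n) x - q n x) \<le> C * (norm x)\<^sup>2 * (1 / 2) ^ Suc n"
    if "norm ((1 / 2 ^ Suc n) *\<^sub>R x) < d" for n x
  proof -
    define y where "y = (1 / 2 ^ Suc n) *\<^sub>R x"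
    have "q (Suc n) x - q n x = - ((2 ^ n) *\<^sub>R (s (y + y) - s y - s y))"
      unfolding q_def y_def by (simp add: scaleR_add_left[symmetric] scaleR_diff_right)
    then have "norm (q (Suc n) x - q n x) = 2 ^ n * norm (s (y + y) - s y - s y)" by simp
    also have "\<dots> \<le> 2 ^ n * (C * norm y * norm y)" using add[of y y] that by (intro mult_left_mono) (auto simp: y_def)
    also have "\<dots> = C * (norm x)\<^sup>2 * (2 ^ n / (2 ^ Suc n * 2 ^ Suc n))"
      by (simp add: y_def power2_eq_square)
    also have "\<dots> \<le> C * (norm x)\<^sup>2 * (1 / 2) ^ Suc n"
      using C by (intro mult_left_mono) (auto simp: power_one_over field_simps)
    finally show ?thesis .
  qed
  have conv: "convergent (\<lambda>n. q n x)" for x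
  proof -
    obtain N where N: "\<And>n. n \<ge> N \<Longrightarrow> norm ((1 / 2 ^ n) *\<^sub>R x) < d" using small by blast
    have "summable (\<lambda>n. q (Suc n) x - q n x)"
    proof (rule summable_comparison_test')
      show "summable (\<lambda>n. C * (norm x)\<^sup>2 * (1 / 2) ^ Suc n)"
        by (intro summable_mult) (simp add: summable_Suc_iff)
      show "norm (q (Suc n) x - q n x) \<le> C * (norm x)\<^sup>2 * (1 / 2) ^ Suc n" if "n \<ge> N" for n
        by (rule step, rule N) (use that in simp)
    qed
    moreover have "(\<Sum>i<n. q (Suc i) x - q i x) = q n x - q 0 x" for n
      using sum_lessThan_telescope[of "\<lambda>n. q n x" n] .
    ultimately have "(\<lambda>n. q n x - q 0 x) \<longlonglongrightarrow> (\<Sum>n. q (Suc n) x - q n x)"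
      using summable_LIMSEQ[of "\<lambda>n. q (Suc n) x - q n x"] by (simp only:)
    from tendsto_add[OF this tendsto_const[of "q 0 x"]] show ?thesis by (auto intro: convergentI)
  qed
  define E where "E x = lim (\<lambda>n. q n x)" for x
  have lim: "(\<lambda>n. q n x) \<longlonglongrightarrow> E x" for x using conv by (simp add: E_def convergent_LIMSEQ_iff)
  have Eadd: "E (x + y) = E x + E y" for x y
  proof -
    obtain N1 where N1: "\<And>n. n \<ge> N1 \<Longrightarrow> norm ((1 / 2 ^ n) *\<^sub>R x) < d" using small by blast
    obtain N2 where N2: "\<And>n. n \<ge> N2 \<Longrightarrow> norm ((1 / 2 ^ n) *\<^sub>R y) < d" using small by blast
    have "(\<lambda>n. q n (x + y) - q n x - q n y) \<longlonglongrightarrow> 0"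
    proof (rule Lim_null_comparison)
      show "eventually (\<lambda>n. norm (q n (x + y) - q n x - q n y) \<le> C * norm x * norm y * (1 / 2) ^ n) sequentially"
        unfolding eventually_sequentially
      proof (intro exI[of _ "max N1 N2"] allI impI)
        fix n assume n: "max N1 N2 \<le> n"
        have "q n (x + y) - q n x - q n y = (2 ^ n) *\<^sub>R (s ((1 / 2 ^ n) *\<^sub>R x + (1 / 2 ^ n) *\<^sub>R y)
            - s ((1 / 2 ^ n) *\<^sub>R x) - s ((1 / 2 ^ n) *\<^sub>R y))"
          by (simp add: q_def scaleR_diff_right scaleR_add_right)
        then have "norm (q n (x + y) - q n x - q n y) = 2 ^ n * norm (s ((1 / 2 ^ n) *\<^sub>R x + (1 / 2 ^ n) *\<^sub>R y)
            - s ((1 / 2 ^ n) *\<^sub>R x) - s ((1 / 2 ^ n) *\<^sub>R y))" by simp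
        also have "\<dots> \<le> 2 ^ n * (C * norm ((1 / 2 ^ n) *\<^sub>R x) * norm ((1 / 2 ^ n) *\<^sub>R y))"
          using add[OF N1[of n] N2[of n]] n by (intro mult_left_mono) auto
        also have "\<dots> = C * norm x * norm y * (1 / 2) ^ n" by (simp add: power_one_over)
        finally show "norm (q n (x + y) - q n x - q n y) \<le> C * norm x * norm y * (1 / 2) ^ n" .
      qed
      have "(\<lambda>n. C * norm x * norm y * (1 / 2) ^ n) \<longlonglongrightarrow> C * norm x * norm y * 0"
        by (intro tendsto_mult LIMSEQ_power_zero tendsto_const) auto
      then show "(\<lambda>n. C * norm x * norm y * (1 / 2) ^ n) \<longlonglongrightarrow> 0" by simp
    qed
    moreover have "(\<lambda>n. q n (x + y) - q n x - q n y) \<longlonglongrightarrow> E (x + y) - E x - E y"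
      by (intro tendsto_diff lim)
    ultimately have "E (x + y) - E x - E y = 0" using LIMSEQ_unique by blast
    then show ?thesis by (simp add: algebra_simps)
  qed
  have Ebound: "norm (E x) \<le> K * norm x" for x
  proof (rule Lim_norm_ubound[OF _ lim])
    obtain N where N: "\<And>n. n \<ge> N \<Longrightarrow> norm ((1 / 2 ^ n) *\<^sub>R x) < d" using small by blast
    show "eventually (\<lambda>n. norm (q n x) \<le> K * norm x) sequentially"
      unfolding eventually_sequentially
    proof (intro exI[of _ N] allI impI)
      fix n assume "N \<le> n"
      then have "2 ^ n * norm (s ((1 / 2 ^ n) *\<^sub>R x)) \<le> 2 ^ n * (K * norm ((1 / 2 ^ n) *\<^sub>R x))"
        using bound[OF N] by (intro mult_left_mono) auto
      then show "norm (q n x) \<le> K * norm x" by (simp add: q_def)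
    qed
  qed simp
  have E: "bounded_linear E" by (rule additive_bounded_imp_bounded_linear[OF Eadd Ebound])
  have close: "norm (s x - E x) \<le> C * (norm x)\<^sup>2" if x: "norm x < d" for x
  proof -
    \<comment> \<open>The geometric bounds are summed from \<open>q 0 x = s x\<close>; in the limit
      this is the quadratic error of a derivative at 0.\<close>
    have "norm (q n x - s x) \<le> C * (norm x)\<^sup>2 * (1 - (1 / 2) ^ n)" for n
    proof (induction n)
      case 0
      show ?case by (simp add: q_def)
    next
      case (Suc n)
      have "(1 / 2) ^ Suc n * norm x \<le> 1 * norm x"
        by (intro mult_right_mono power_le_one) auto
      then have "norm ((1 / 2 ^ Suc n) *\<^sub>R x) \<le> norm x" by (simp add: power_one_over)
      then have "norm ((1 / 2 ^ Suc n) *\<^sub>R x) < d" using x by linarith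
      from step[OF this] Suc.IH have "norm (q (Suc n) x - q n x) + norm (q n x - s x)
        \<le> C * (norm x)\<^sup>2 * (1 / 2) ^ Suc n + C * (norm x)\<^sup>2 * (1 - (1 / 2) ^ n)" by linarith
      also have "\<dots> = C * (norm x)\<^sup>2 * (1 - (1 / 2) ^ Suc n)" by (simp add: algebra_simps)
      finally show ?case using norm_triangle_ineq[of "q (Suc n) x - q n x" "q n x - s x"] by simp
    qed
    then have "norm (q n x - s x) \<le> C * (norm x)\<^sup>2" for n
      using C by (smt (verit, best) mult_left_le mult_nonneg_nonneg zero_le_power zero_le_power2 zero_le_divide_1_iff)
    then have "norm (E x - s x) \<le> C * (norm x)\<^sup>2"
      by (intro Lim_norm_ubound[OF _ tendsto_diff[OF lim tendsto_const]]) auto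
    then show ?thesis by (simp add: norm_minus_commute)
  qed
  have s0: "s 0 = 0" using bound[of 0] d by simp
  have E0: "E 0 = 0" using E by (simp add: linear_simps)
  have "(s has_derivative E) (at 0)"
  proof (rule has_derivativeI_sandwich[OF d E, where H = "\<lambda>y. C * norm y"])
    fix y :: 'a assume "y \<noteq> 0" "dist y 0 < d"
    then show "norm (s y - s 0 - E (y - 0)) / norm (y - 0) \<le> C * norm y"
      using close[of y] by (simp add: s0 E0 divide_le_eq power2_eq_square mult.assoc)
  next
    show "((\<lambda>y. C * norm y) \<longlongrightarrow> 0) (at (0::'a))"
      using tendsto_mult[OF tendsto_const tendsto_norm[OF tendsto_ident_at[of "0::'a" UNIV]], of C] by simp
  qed
  then show ?thesis by blast
qed

text \<open>Here \<open>m\<close> is a local group law, equal to addition up to a bilinear error.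
  First a Lipschitz bound at 0 (\<open>lip0\<close>): powers of a small \<open>x\<close> stay in the
  ball for about \<open>1 / norm x\<close> steps, and a telescoping sum shows that
  \<open>\<rho> x - id_blinfun\<close> cannot be larger than of order \<open>norm x\<close>. Solving
  \<open>m x k = x + u\<close> spreads the bound to nearby points (\<open>lip\<close>). Then
  \<open>\<rho> - id_blinfun\<close> is additive up to a bilinear error, and the preceding lemma
  applies.\<close>

lemma local_hom_differentiable:
  fixes \<rho> :: "'a::real_normed_vector \<Rightarrow> ('v::euclidean_space \<Rightarrow>\<^sub>L 'v)" and m :: "'a \<Rightarrow> 'a \<Rightarrow> 'a"
  assumes r: "r > 0" and C: "C \<ge> 0"
    and m: "\<And>x y. norm x < r \<Longrightarrow> norm y < r \<Longrightarrow> norm (m x y - (x + y)) \<le> C * norm x * norm y"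
    and hom: "\<And>x y. norm x < r \<Longrightarrow> norm y < r \<Longrightarrow> \<rho> (m x y) = \<rho> x o\<^sub>L \<rho> y"
    and one: "\<rho> 0 = id_blinfun" and cont: "isCont \<rho> 0"
    and div: "\<exists>d>0. \<forall>x u. norm x < d \<longrightarrow> norm u < d \<longrightarrow> (\<exists>k. norm k < r \<and> m x k = x + u)"
  shows "\<exists>E. (\<rho> has_derivative E) (at 0)"
proof -
  obtain d0 where d0: "d0 > 0" "\<And>x. norm x < d0 \<Longrightarrow> norm (\<rho> x - id_blinfun) < 1 / 2"
    using cont[unfolded continuous_at_eps_delta, rule_format, of "1 / 2"] by (auto simp: dist_norm one)
  \<comment> \<open>\<open>C * r1 \<le> 1 / 2\<close> keeps the error of a product below half the
    length of one factor; \<open>r1 \<le> d0\<close> keeps \<open>\<rho>\<close> within 1/2 of the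
    identity.\<close>
  define r1 where "r1 = min r (min d0 (1 / (2 * (C + 1))))"
  have r1: "r1 > 0" "r1 \<le> r" "r1 \<le> d0" "C * r1 \<le> 1 / 2"
  proof -
    show "r1 > 0" "r1 \<le> r" "r1 \<le> d0" using r C d0 by (auto simp: r1_def)
    have "C * r1 \<le> C * (1 / (2 * (C + 1)))" using C by (intro mult_left_mono) (auto simp: r1_def)
    also have "\<dots> \<le> 1 / 2" using C by (simp add: field_simps)
    finally show "C * r1 \<le> 1 / 2" .
  qed
  \<comment> \<open>Below, \<open>k * norm (\<rho> x - id_blinfun) \<le> 1\<close> for the integer
    part \<open>k\<close> of \<open>r1 / (4 * norm x)\<close>; a factor 2 pays for
    \<open>k + 1 \<le> 2 * k\<close>.\<close>
  define K where "K = 8 / r1"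
  have K: "K > 0" using r1 by (simp add: K_def)
  have lip0: "norm (\<rho> x - id_blinfun) \<le> K * norm x" if x: "norm x < r1 / 4" for x
  proof (cases "x = 0")
    case False
    \<comment> \<open>\<open>p j\<close> is the \<open>j\<close>-th power of \<open>x\<close> for
      the local law. Each factor adds at most \<open>3 / 2 * norm x\<close> to the norm, hence the
      generous bound \<open>2 * real j * norm x\<close>.\<close>
    define p where "p = rec_nat 0 (\<lambda>_ y. m y x)"
    have p: "p 0 = 0" "\<And>j. p (Suc j) = m (p j) x" by (simp_all add: p_def)
    have xr: "norm x < r" using x r1 by linarith
    have pj: "norm (p j) \<le> 2 * real j * norm x" if "2 * real j * norm x < r1" for j
      using that
    proof (induction j)
      case (Suc j)
      have "2 * real j * norm x \<le> 2 * real (Suc j) * norm x" by (intro mult_right_mono) auto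
      then have IH: "norm (p j) \<le> 2 * real j * norm x" and lt: "norm (p j) < r1"
        using Suc by linarith+
      have "norm (m (p j) x - (p j + x)) \<le> C * norm (p j) * norm x" using m[of "p j" x] lt r1 xr by simp
      also have "\<dots> \<le> C * r1 * norm x" using lt C by (intro mult_right_mono mult_left_mono) auto
      also have "\<dots> \<le> 1 / 2 * norm x" using r1 by (intro mult_right_mono) auto
      finally have "norm (m (p j) x) \<le> norm (p j) + norm x + 1 / 2 * norm x"
        using norm_triangle_ineq[of "p j" x] norm_triangle_sub[of "m (p j) x" "p j + x"] by linarith
      moreover have "2 * real (Suc j) * norm x = 2 * real j * norm x + 2 * norm x" by (simp add: algebra_simps)
      ultimately have "norm (m (p j) x) \<le> 2 * real (Suc j) * norm x" using IH norm_ge_zero[of x] by linarith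
      then show ?case by (simp add: p)
    qed (simp add: p)
    define k where "k = nat \<lfloor>r1 / (4 * norm x)\<rfloor>"
    have pos: "norm x > 0" using False by simp
    have ge1: "1 \<le> r1 / (4 * norm x)" using x pos by (simp add: field_simps)
    have k: "real k \<le> r1 / (4 * norm x)" "r1 / (4 * norm x) < real k + 1" "k \<ge> 1"
      using ge1 unfolding k_def by linarith+
    have kx: "2 * real j * norm x < r1" if "j \<le> k" for j
    proof -
      have "real j \<le> r1 / (4 * norm x)" using that k(1) by linarith
      then have "4 * (real j * norm x) \<le> r1" using pos by (simp add: field_simps)
      then show ?thesis using r1(1) by linarith
    qed
    have near: "norm (\<rho> (p j) - id_blinfun) \<le> 1 / 2" and small: "norm (p j) < r" if "j \<le> k" for j
      using pj[OF kx[OF that]] kx[OF that] d0(2)[of "p j"] r1 by linarith+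
    have idr: "f o\<^sub>L id_blinfun = f" for f :: "'v \<Rightarrow>\<^sub>L 'v" by (rule blinfun_eqI) simp
    have split_diff: "f - g = h \<Longrightarrow> f - k = h + (g - k)" for f g h k :: "'v \<Rightarrow>\<^sub>L 'v"
      by (auto simp: algebra_simps)
    let ?U = "\<rho> x - id_blinfun"
    have tele: "\<rho> (p j) - id_blinfun = real j *\<^sub>R ?U + (\<Sum>i<j. (\<rho> (p i) - id_blinfun) o\<^sub>L ?U)" if "j \<le> k" for j
      using that
    proof (induction j)
      case (Suc j)
      have "\<rho> (p (Suc j)) - \<rho> (p j) = (\<rho> (p j) o\<^sub>L \<rho> x) - (\<rho> (p j) o\<^sub>L id_blinfun)"
        using Suc.prems hom[OF small[of j] xr] by (simp add: p idr)
      also have "\<dots> = ?U + ((\<rho> (p j) - id_blinfun) o\<^sub>L ?U)"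
        by (rule blinfun_eqI) (simp add: blinfun.bilinear_simps)
      finally have "\<rho> (p (Suc j)) - id_blinfun
          = (?U + ((\<rho> (p j) - id_blinfun) o\<^sub>L ?U)) + (\<rho> (p j) - id_blinfun)" by (rule split_diff)
      moreover have "\<rho> (p j) - id_blinfun = real j *\<^sub>R ?U + (\<Sum>i<j. (\<rho> (p i) - id_blinfun) o\<^sub>L ?U)"
        using Suc by simp
      ultimately have "\<rho> (p (Suc j)) - id_blinfun = (?U + ((\<rho> (p j) - id_blinfun) o\<^sub>L ?U))
          + (real j *\<^sub>R ?U + (\<Sum>i<j. (\<rho> (p i) - id_blinfun) o\<^sub>L ?U))" by (simp only:)
      then show ?case by (simp only: sum.lessThan_Suc of_nat_Suc scaleR_add_left scaleR_one add_ac)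
    qed (simp add: p one)
    \<comment> \<open>All powers up to \<open>k\<close> are within 1/2 of the identity, so the sum
      in \<open>tele\<close> is at most half of the main term and can be absorbed:
      \<open>k * norm ?U \<le> 1\<close>.\<close>
    have "norm (\<Sum>i<k. (\<rho> (p i) - id_blinfun) o\<^sub>L ?U) \<le> (\<Sum>i<k. 1 / 2 * norm ?U)"
    proof (rule sum_norm_le)
      fix i assume "i \<in> {..<k}"
      then have "norm (\<rho> (p i) - id_blinfun) * norm ?U \<le> 1 / 2 * norm ?U" by (intro mult_right_mono near) auto
      then show "norm ((\<rho> (p i) - id_blinfun) o\<^sub>L ?U) \<le> 1 / 2 * norm ?U"
        using norm_blinfun_compose order_trans by blast
    qed
    moreover have "real k * norm ?U \<le> norm (\<rho> (p k) - id_blinfun) + norm (\<Sum>i<k. (\<rho> (p i) - id_blinfun) o\<^sub>L ?U)"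
    proof -
      have "real k *\<^sub>R ?U = (\<rho> (p k) - id_blinfun) - (\<Sum>i<k. (\<rho> (p i) - id_blinfun) o\<^sub>L ?U)"
        using tele[of k] by (simp add: algebra_simps)
      then have "norm (real k *\<^sub>R ?U) \<le> norm (\<rho> (p k) - id_blinfun) + norm (\<Sum>i<k. (\<rho> (p i) - id_blinfun) o\<^sub>L ?U)"
        by (metis norm_triangle_ineq4)
      then show ?thesis by simp
    qed
    ultimately have "real k * norm ?U \<le> 1" using near[of k] by simp
    then have "(real k + 1) * norm ?U \<le> 2 * 1"
      using k(3) by (smt (verit) mult_right_mono norm_ge_zero of_nat_1 of_nat_mono distrib_right)
    moreover have "r1 / (4 * norm x) * norm ?U \<le> (real k + 1) * norm ?U" using k(2) by (intro mult_right_mono) auto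
    ultimately have "r1 / (4 * norm x) * norm ?U \<le> 2" by linarith
    then show ?thesis using pos r1(1) by (simp add: K_def field_simps)
  qed (simp add: one)
  obtain d1 where d1: "d1 > 0" "\<And>x u. norm x < d1 \<Longrightarrow> norm u < d1 \<Longrightarrow> \<exists>k. norm k < r \<and> m x k = x + u"
    using div by blast
  define d2 where "d2 = min d1 (r1 / 8)"
  have d2: "d2 > 0" "d2 \<le> d1" "d2 \<le> r1 / 8" using d1 r1 by (auto simp: d2_def)
  \<comment> \<open>\<open>\<rho> (x + u) - \<rho> x\<close> is \<open>\<rho> x\<close> composed
    with \<open>\<rho> k - id_blinfun\<close>, where \<open>norm k \<le> 2 * norm u\<close> and
    \<open>norm (\<rho> x) \<le> 3 / 2\<close>; this gives the factor 3.\<close>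
  have lip: "norm (\<rho> (x + u) - \<rho> x) \<le> 3 * K * norm u" if xu: "norm x < d2" "norm u < d2" for x u
  proof -
    have "norm x < d1" "norm u < d1" using xu d2 by linarith+
    then obtain k where k: "norm k < r" "m x k = x + u" using d1(2) by blast
    have xr: "norm x < r" "norm x < r1" using xu d2 r1 by linarith+
    have "norm (u - k) \<le> C * norm x * norm k" using m[OF xr(1) k(1)] k(2) by simp
    also have "\<dots> \<le> C * r1 * norm k" using xr C by (intro mult_right_mono mult_left_mono) auto
    also have "\<dots> \<le> 1 / 2 * norm k" using r1 by (intro mult_right_mono) auto
    finally have k2: "norm k \<le> 2 * norm u" using norm_triangle_sub[of k u] by (simp add: norm_minus_commute)
    then have "norm k < r1 / 4" using xu d2 by linarith
    from lip0[OF this] have 1: "norm (\<rho> k - id_blinfun) \<le> K * (2 * norm u)"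
      using k2 K by (meson mult_left_mono order_trans less_imp_le)
    have "norm (\<rho> x) \<le> norm (id_blinfun :: 'v \<Rightarrow>\<^sub>L 'v) + 1 / 2"
      using d0(2)[of x] xr r1 norm_triangle_sub[of "\<rho> x" id_blinfun] by linarith
    then have 2: "norm (\<rho> x) \<le> 3 / 2" by simp
    have "\<rho> (x + u) - \<rho> x = \<rho> x o\<^sub>L (\<rho> k - id_blinfun)"
      using hom[OF xr(1) k(1)] k(2) by (intro blinfun_eqI) (simp add: blinfun.bilinear_simps)
    then have "norm (\<rho> (x + u) - \<rho> x) \<le> norm (\<rho> x) * norm (\<rho> k - id_blinfun)"
      by (simp add: norm_blinfun_compose)
    also have "\<dots> \<le> 3 / 2 * (K * (2 * norm u))" using 1 2 by (intro mult_mono) auto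
    finally show ?thesis by simp
  qed
  define d where "d = min (d2 / 2) (min (1 / 2) (d2 / (C + 1)))"
  have d: "d > 0" "d \<le> d2 / 2" "d \<le> 1 / 2" "C * d \<le> d2"
  proof -
    show "d > 0" using d2 C by (auto simp: d_def)
    show "d \<le> d2 / 2" "d \<le> 1 / 2" unfolding d_def by linarith+
    have "C * d \<le> C * (d2 / (C + 1))" using C by (intro mult_left_mono) (auto simp: d_def)
    also have "\<dots> \<le> d2" using C d2 by (simp add: field_simps)
    finally show "C * d \<le> d2" .
  qed
  let ?s = "\<lambda>x. \<rho> x - id_blinfun"
  \<comment> \<open>\<open>K * K\<close> bounds the product of the two increments,
    \<open>3 * K * C\<close> the effect of replacing \<open>m x y\<close> by
    \<open>x + y\<close>.\<close>
  have "\<exists>E. (?s has_derivative E) (at 0)"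
  proof (rule almost_additive_differentiable[OF d(1), of "3 * K * C + K * K"])
    show "0 \<le> 3 * K * C + K * K" using K C by simp
    show "norm (?s x) \<le> K * norm x" if "norm x < d" for x
      using that d d2 r1 by (intro lip0) linarith
    fix x y :: 'a assume xy: "norm x < d" "norm y < d"
    have r: "norm x < r" "norm y < r" "norm x < r1 / 4" "norm y < r1 / 4" using xy d d2 r1 by linarith+
    define u where "u = m x y - (x + y)"
    have u: "norm u \<le> C * norm x * norm y" using m[OF r(1,2)] by (simp add: u_def)
    also have "\<dots> \<le> C * d * (1 / 2)" using xy d C by (intro mult_mono) auto
    also have "\<dots> < d2" using d d2 by linarith
    finally have ud: "norm u < d2" .
    have "norm (x + y) < d2" using norm_triangle_ineq[of x y] xy d by linarith
    from lip[OF this ud] have 1: "norm (\<rho> (m x y) - \<rho> (x + y)) \<le> 3 * K * (C * norm x * norm y)"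
      using u K by (smt (verit) add_diff_cancel_left' diff_add_cancel mult_left_mono u_def)
    have 2: "norm (?s x o\<^sub>L ?s y) \<le> (K * norm x) * (K * norm y)"
      using norm_blinfun_compose[of "?s x" "?s y"] mult_mono[OF lip0[OF r(3)] lip0[OF r(4)]] K
      by (smt (verit) mult_nonneg_nonneg norm_ge_zero)
    have "?s (x + y) - ?s x - ?s y = (?s x o\<^sub>L ?s y) - (\<rho> (m x y) - \<rho> (x + y))"
      unfolding hom[OF r(1,2)] by (rule blinfun_eqI) (simp add: blinfun.bilinear_simps)
    then have "norm (?s (x + y) - ?s x - ?s y) = norm ((?s x o\<^sub>L ?s y) - (\<rho> (m x y) - \<rho> (x + y)))"
      by (rule arg_cong)
    then have "norm (?s (x + y) - ?s x - ?s y) \<le> (K * norm x) * (K * norm y) + 3 * K * (C * norm x * norm y)"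
      using 1 2 norm_triangle_ineq4[of "?s x o\<^sub>L ?s y" "\<rho> (m x y) - \<rho> (x + y)"] by linarith
    then show "norm (?s (x + y) - ?s x - ?s y) \<le> (3 * K * C + K * K) * norm x * norm y"
      by (simp add: algebra_simps)
  qed
  then obtain E where "(?s has_derivative E) (at 0)" by blast
  from has_derivative_add[OF this has_derivative_const[of id_blinfun]] show ?thesis by auto
qed

lemma norm_le_Basis_bound:
  fixes f :: "'a::euclidean_space \<Rightarrow> 'b::real_normed_vector"
  assumes "bounded_linear f" "\<And>b. b \<in> Basis \<Longrightarrow> norm (f b) \<le> K"
  shows "norm (f v) \<le> real DIM('a) * K * norm v"
proof -
  interpret bounded_linear f by fact
  have "f (\<Sum>b\<in>Basis. (v \<bullet> b) *\<^sub>R b) = (\<Sum>b\<in>Basis. (v \<bullet> b) *\<^sub>R f b)" by (simp add: sum scaleR)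
  then have "f v = (\<Sum>b\<in>Basis. (v \<bullet> b) *\<^sub>R f b)" by (simp only: euclidean_representation)
  moreover have "norm (\<Sum>b\<in>Basis. (v \<bullet> b) *\<^sub>R f b) \<le> (\<Sum>b\<in>(Basis::'a set). norm v * K)"
  proof (rule sum_norm_le)
    fix b :: 'a assume b: "b \<in> Basis"
    have "\<bar>v \<bullet> b\<bar> * norm (f b) \<le> norm v * K"
      using assms(2)[OF b] Basis_le_norm[OF b, of v] by (intro mult_mono) auto
    then show "norm ((v \<bullet> b) *\<^sub>R f b) \<le> norm v * K" by simp
  qed
  ultimately show ?thesis by (simp add: mult_ac)
qed

lemma derivative_Basis_lipschitz:
  fixes f :: "'a::euclidean_space \<Rightarrow> 'b::real_normed_vector"
  assumes "convex S" "x \<in> S" "y \<in> S"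
    and d: "\<And>x. x \<in> S \<Longrightarrow> (f has_derivative f' x) (at x)"
    and K: "\<And>x b. x \<in> S \<Longrightarrow> b \<in> Basis \<Longrightarrow> norm (f' x b) \<le> K"
  shows "norm (f y - f x) \<le> real DIM('a) * K * norm (y - x)"
proof (rule differentiable_bound[OF assms(1) _ _ assms(3,2)])
  fix z assume z: "z \<in> S"
  show "(f has_derivative f' z) (at z within S)" using d[OF z] by (rule has_derivative_at_withinI)
  show "onorm (f' z) \<le> real DIM('a) * K"
    by (rule onorm_le) (rule norm_le_Basis_bound[OF has_derivative_bounded_linear[OF d[OF z]] K[OF z]])
qed

text \<open>Two mean value inequalities. \<open>F\<close> vanishes for \<open>x = c\<close>, so it
  is bounded by its derivative in the first variable times \<open>norm (x - c)\<close>; this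
  derivative vanishes for \<open>y = c\<close>, where \<open>F\<close> is zero along the whole axis,
  so it is bounded by a second derivative times \<open>norm (y - c)\<close>.\<close>

lemma C2_product_bound:
  fixes F :: "'a::euclidean_space \<times> 'a \<Rightarrow> 'b::euclidean_space"
  assumes F: "Ck_on 2 S F" and S: "open S" "(c, c) \<in> S"
    and left: "\<And>x. (x, c) \<in> S \<Longrightarrow> F (x, c) = 0" and right: "\<And>y. (c, y) \<in> S \<Longrightarrow> F (c, y) = 0"
  shows "\<exists>r>0. \<exists>C\<ge>0. ball c r \<times> ball c r \<subseteq> S \<and>
    (\<forall>x\<in>ball c r. \<forall>y\<in>ball c r. norm (F (x, y)) \<le> C * norm (x - c) * norm (y - c))"
proof -
  obtain A B where AB: "open A" "open B" "(c, c) \<in> A \<times> B" "A \<times> B \<subseteq> S"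
    by (rule open_prod_elim[OF S])
  have "open (A \<inter> B)" "c \<in> A \<inter> B" using AB by auto
  then obtain r where r: "r > 0" "cball c r \<subseteq> A \<inter> B" using open_contains_cball by metis
  let ?K = "cball c r \<times> cball c r"
  have KS: "?K \<subseteq> S" using r AB by blast
  let ?D1 = "\<lambda>v p. frechet_derivative F (at p) (v, 0)"
  let ?D2 = "\<lambda>v w p. frechet_derivative (?D1 v) (at p) (0, w)"
  have cont: "continuous_on ?K (?D2 v w)" for v w
    using F by (auto simp: numeral_2_eq_2 intro: continuous_on_subset[OF _ KS])
  have "\<exists>M. \<forall>p\<in>?K. norm (?D2 v w p) \<le> M" for v w
  proof -
    have "compact (?D2 v w ` ?K)" by (intro compact_continuous_image cont compact_Times compact_cball)
    then show ?thesis by (meson bounded_iff compact_imp_bounded imageI)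
  qed
  then obtain M where M: "\<And>v w p. p \<in> ?K \<Longrightarrow> norm (?D2 v w p) \<le> M v w" by metis
  define K where "K = (\<Sum>v\<in>Basis. \<Sum>w\<in>Basis. \<bar>M v w\<bar>)"
  have K: "norm (?D2 v w p) \<le> K" if "p \<in> ?K" "v \<in> Basis" "w \<in> Basis" for v w p
  proof -
    have "norm (?D2 v w p) \<le> \<bar>M v w\<bar>" using M[OF that(1), of v w] by linarith
    also have "\<dots> \<le> (\<Sum>w\<in>Basis. \<bar>M v w\<bar>)" by (rule member_le_sum) (use that in auto)
    also have "\<dots> \<le> K" unfolding K_def
      by (rule member_le_sum[of v Basis "\<lambda>v. \<Sum>w\<in>Basis. \<bar>M v w\<bar>"]) (use that in \<open>auto intro: sum_nonneg\<close>)
    finally show ?thesis .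
  qed
  have K0: "K \<ge> 0" by (auto simp: K_def intro!: sum_nonneg)
  have Fd: "(F has_derivative frechet_derivative F (at p)) (at p)" if "p \<in> S" for p
    using F that by (simp add: numeral_2_eq_2 frechet_derivative_works)
  have D1d: "(?D1 v has_derivative frechet_derivative (?D1 v) (at p)) (at p)" if "p \<in> S" for p v
    using F that by (simp add: numeral_2_eq_2 frechet_derivative_works)
  have px: "((\<lambda>x. (x, y)) has_derivative (\<lambda>v. (v, 0))) (at x)" for x y :: 'a
    by (auto intro!: derivative_eq_intros)
  have py: "((\<lambda>y. (x, y)) has_derivative (\<lambda>v. (0, v))) (at y)" for x y :: 'a
    by (auto intro!: derivative_eq_intros)
  let ?n = "real DIM('a)"
  have Fx: "((\<lambda>x. F (x, y)) has_derivative (\<lambda>v. ?D1 v (x, y))) (at x)" if "x \<in> cball c r" "y \<in> cball c r" for x y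
    using has_derivative_compose[OF px Fd] KS that by blast
  have D1y: "((\<lambda>y. ?D1 v (x, y)) has_derivative (\<lambda>w. ?D2 v w (x, y))) (at y)" if "x \<in> cball c r" "y \<in> cball c r" for v x y
    using has_derivative_compose[OF py D1d] KS that by blast
  have D1c: "?D1 v (x, c) = 0" if x: "x \<in> cball c r" for v x
  proof -
    have "open ((\<lambda>x. (x, c)) -` S)" by (intro open_vimage S(1) continuous_intros)
    then have "open {x. (x, c) \<in> S}" by (simp add: vimage_def)
    moreover have xc: "(x, c) \<in> S" using x KS r(1) by auto
    ultimately have "((\<lambda>x. F (x, c)) has_derivative (\<lambda>v. 0)) (at x)"
      using left by (intro has_derivative_transform_within_open[OF has_derivative_const[of 0]]) auto
    from has_derivative_unique[OF this Fx[OF x, of c]] r(1) show ?thesis by (metis centre_in_cball less_imp_le)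
  qed
  have D1b: "norm (?D1 v (x, y)) \<le> ?n * K * norm (y - c)" if "x \<in> cball c r" "y \<in> cball c r" "v \<in> Basis" for v x y
  proof -
    have "norm (?D1 v (x, y) - ?D1 v (x, c)) \<le> ?n * K * norm (y - c)"
      by (rule derivative_Basis_lipschitz[where S = "cball c r" and f' = "\<lambda>y w. ?D2 v w (x, y)"])
        (use that r(1) D1y[OF that(1)] K in auto)
    then show ?thesis by (simp add: D1c[OF that(1)])
  qed
  have "norm (F (x, y)) \<le> ?n * (?n * K * norm (y - c)) * norm (x - c)" if "x \<in> ball c r" "y \<in> ball c r" for x y
  proof -
    have xy: "x \<in> cball c r" "y \<in> cball c r" using that by auto
    have "norm (F (x, y) - F (c, y)) \<le> ?n * (?n * K * norm (y - c)) * norm (x - c)"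
      by (rule derivative_Basis_lipschitz[where S = "cball c r" and f' = "\<lambda>x v. ?D1 v (x, y)"])
        (use xy r(1) Fx D1b in auto)
    moreover have "(c, y) \<in> S" using xy KS r(1) by auto
    ultimately show ?thesis by (simp add: right)
  qed
  then have "norm (F (x, y)) \<le> (?n * ?n * K) * norm (x - c) * norm (y - c)" if "x \<in> ball c r" "y \<in> ball c r" for x y
    using that by (metis (no_types, opaque_lifting) mult.assoc mult.commute)
  moreover have "ball c r \<times> ball c r \<subseteq> S" using KS ball_subset_cball[of c r] by blast
  ultimately show ?thesis
    using K0 by - (rule exI[of _ r], rule conjI[OF r(1)], rule exI[of _ "?n * ?n * K"], auto)
qed

context lie_grp
begin

text \<open>In coordinates centred at the unit, the group law differs from addition by a smooth
  function that vanishes on both axes. This supplies the bilinear error required of a local group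
  law.\<close>

lemma representation_differentiable:
  fixes R :: "'g \<Rightarrow> ('v::euclidean_space \<Rightarrow>\<^sub>L 'v)"
  assumes hom: "\<And>g h. R (g \<otimes> h) = R g o\<^sub>L R h" and one: "R \<one> = id_blinfun"
    and cont: "continuous_on UNIV R"
  shows "\<exists>E. ((\<lambda>z. R (near_unit z)) has_derivative E) (at unit_coord)"
proof -
  let ?c = "unit_chart" and ?z = "unit_coord"
  let ?R = "coord_range ?c"
  let ?S = "{(x, y). x \<in> ?R \<and> y \<in> ?R \<and> param ?c x \<otimes> param ?c y \<in> fst ?c}"
  \<comment> \<open>The product in coordinates minus the sum, where the sum is taken relative to the
    coordinates \<open>?z\<close> of the unit.\<close>
  define F where "F = (\<lambda>p. (case p of (x, y) \<Rightarrow> snd ?c (param ?c x \<otimes> param ?c y)) + (- 1) *\<^sub>R (fst p + snd p + - ?z))"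
  have S: "open ?S" by (rule open_mult_domain[OF unit_chart(1) unit_chart(1) open_chart_domain[OF unit_chart(1)]])
  have zS: "(?z, ?z) \<in> ?S"
    using unit_coord_in unit_chart(2) near_unit_unit_coord by (simp add: near_unit_def)
  have "smooth_on ?S F"
    unfolding F_def by (intro smooth_on_add[OF S] smooth_on_scaleR[OF S] mult_smooth unit_chart(1) smooth_on_const
        smooth_on_bounded_linear bounded_linear_fst bounded_linear_snd)
  then have F: "Ck_on 2 ?S F" by (rule smooth_onD)
  have pz: "param ?c ?z = \<one>" using near_unit_unit_coord by (simp add: near_unit_def)
  have axes: "(x, ?z) \<in> ?S \<Longrightarrow> F (x, ?z) = 0" "(?z, x) \<in> ?S \<Longrightarrow> F (?z, x) = 0" for x
    by (simp_all add: F_def pz coord_param[OF unit_chart(1)])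
  obtain r C where rC: "r > 0" "C \<ge> 0" "ball ?z r \<times> ball ?z r \<subseteq> ?S"
    "\<And>x y. x \<in> ball ?z r \<Longrightarrow> y \<in> ball ?z r \<Longrightarrow> norm (F (x, y)) \<le> C * norm (x - ?z) * norm (y - ?z)"
    using C2_product_bound[OF F S zS axes] by blast
  define m where "m x y = snd ?c (near_unit (?z + x) \<otimes> near_unit (?z + y)) - ?z" for x y
  have in_S: "(?z + x, ?z + y) \<in> ?S" if "norm x < r" "norm y < r" for x y
    using subsetD[OF rC(3), of "(?z + x, ?z + y)"] that by (simp add: dist_norm)
  have in_R: "?z + x \<in> ?R" if "norm x < r" for x using in_S[OF that that] by simp
  have near_m: "near_unit (?z + m x y) = near_unit (?z + x) \<otimes> near_unit (?z + y)" if "norm x < r" "norm y < r" for x y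
    using in_S[OF that] by (simp add: m_def near_unit_def param_coord[OF unit_chart(1)])
  define P where "P x = R (near_unit (?z + x))" for x
  have nearc: "isCont (\<lambda>x. near_unit (?z + x)) 0"
  proof -
    have "isCont near_unit ?z"
      using continuous_near_unit unit_coord_in
      unfolding continuous_on_eq_continuous_at[OF open_coord_range[OF unit_chart(1)]] by blast
    then have "isCont near_unit (?z + 0)" by simp
    moreover have "isCont (\<lambda>x. ?z + x) 0" by (intro continuous_intros)
    ultimately show ?thesis by (rule isCont_o2[rotated])
  qed
  have "\<exists>E. (P has_derivative E) (at 0)"
  proof (rule local_hom_differentiable[OF rC(1,2), where m = m])
    fix x y :: "real^'n" assume xy: "norm x < r" "norm y < r"
    show "norm (m x y - (x + y)) \<le> C * norm x * norm y"
      using rC(4)[of "?z + x" "?z + y"] xy by (simp add: F_def dist_norm m_def near_unit_def algebra_simps)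
    show "P (m x y) = P x o\<^sub>L P y" by (simp add: P_def near_m[OF xy] hom)
  next
    show "P 0 = id_blinfun" by (simp add: P_def one)
    have "isCont R (near_unit (?z + 0))" using cont by (simp add: continuous_on_eq_continuous_at)
    then show "isCont P 0" unfolding P_def by (rule isCont_o2[OF nearc])
    let ?W = "{g \<in> fst ?c. snd ?c g \<in> ball ?z r}"
    have W: "open ?W"
      using continuous_open_preimage[OF continuous_on_chart[OF unit_chart(1)] open_chart_domain[OF unit_chart(1)], of "ball ?z r"]
      by (simp add: vimage_def Int_def)
    \<comment> \<open>The quotient that solves the division hypothesis; it is continuous and equals
      the unit at \<open>(0, 0)\<close>, so for small arguments it lies in the chart with
      coordinates near \<open>?z\<close>.\<close>
    define q where "q = (\<lambda>p. inv (near_unit (?z + fst p)) \<otimes> near_unit (?z + (fst p + snd p)))"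
    let ?N = "ball (0::real^'n) (r / 2) \<times> ball (0::real^'n) (r / 2)"
    have contN: "continuous_on ?N (\<lambda>p. near_unit (?z + h p))"
      if h: "continuous_on ?N h" "\<And>p. p \<in> ?N \<Longrightarrow> norm (h p) < r" for h :: "(real^'n) \<times> (real^'n) \<Rightarrow> real^'n"
      by (rule continuous_on_compose2[OF continuous_near_unit continuous_on_add[OF continuous_on_const h(1)]])
        (use in_R h(2) in auto)
    have "continuous_on ?N q" unfolding q_def
    proof (intro continuous_on_group_mult continuous_on_group_inv contN continuous_on_add continuous_on_fst continuous_on_snd continuous_on_id)
      fix p :: "(real^'n) \<times> (real^'n)" assume "p \<in> ?N"
      then have "norm (fst p) < r / 2" "norm (snd p) < r / 2" by (cases p, simp)+
      then show "norm (fst p) < r" "norm (fst p + snd p) < r" using norm_triangle_ineq[of "fst p" "snd p"] rC(1) by linarith+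
    qed
    then have "open (?N \<inter> q -` ?W)" by (intro continuous_open_preimage W open_Times open_ball)
    moreover have "(0, 0) \<in> ?N \<inter> q -` ?W" using rC(1) unit_chart(2) by (simp add: q_def unit_coord_def[symmetric])
    ultimately obtain B1 B2 where B: "open B1" "open B2" "(0, 0) \<in> B1 \<times> B2" "B1 \<times> B2 \<subseteq> ?N \<inter> q -` ?W"
      by (rule open_prod_elim)
    have "open (B1 \<inter> B2)" "0 \<in> B1 \<inter> B2" using B by auto
    then obtain d where d: "d > 0" "ball 0 d \<subseteq> B1 \<inter> B2" by (rule openE)
    show "\<exists>d>0. \<forall>x u. norm x < d \<longrightarrow> norm u < d \<longrightarrow> (\<exists>k. norm k < r \<and> m x k = x + u)"
    proof (intro exI[of _ d] conjI allI impI d(1))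
      fix x u :: "real^'n" assume xu: "norm x < d" "norm u < d"
      then have "(x, u) \<in> B1 \<times> B2" using d(2) by auto
      then have "(x, u) \<in> ?N" "q (x, u) \<in> ?W" using B(4) by blast+
      then have n: "norm x < r / 2" "norm u < r / 2" and w: "q (x, u) \<in> fst ?c" "dist ?z (snd ?c (q (x, u))) < r" by auto
      have xr: "norm x < r" "norm (x + u) < r" using n norm_triangle_ineq[of x u] rC(1) by linarith+
      let ?k = "snd ?c (q (x, u)) - ?z"
      have k: "norm ?k < r" using w(2) by (simp add: dist_norm norm_minus_commute)
      have "near_unit (?z + ?k) = q (x, u)" by (simp add: near_unit_def param_coord[OF unit_chart(1) w(1)])
      then have "near_unit (?z + x) \<otimes> near_unit (?z + ?k) = near_unit (?z + (x + u))" by (simp add: q_def)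
      then have "m x ?k = snd ?c (near_unit (?z + (x + u))) - ?z" by (simp add: m_def)
      also have "\<dots> = x + u" using in_R[OF xr(2)] by (simp add: near_unit_def coord_param[OF unit_chart(1)])
      finally show "\<exists>k. norm k < r \<and> m x k = x + u" using k by blast
    qed
  qed
  then obtain E where E: "(P has_derivative E) (at 0)" by blast
  have "((\<lambda>z. z - ?z) has_derivative (\<lambda>v. v)) (at ?z)" by (auto intro!: derivative_eq_intros)
  from has_derivative_compose[OF this, of P E] E have "((\<lambda>z. P (z - ?z)) has_derivative E) (at ?z)" by simp
  then show ?thesis by (auto simp: P_def)
qed

definition rep_deriv :: "('g \<Rightarrow> ('v::euclidean_space \<Rightarrow>\<^sub>L 'v)) \<Rightarrow> real^'n \<Rightarrow> ('v \<Rightarrow>\<^sub>L 'v)" where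
  "rep_deriv R = frechet_derivative (\<lambda>z. R (near_unit z)) (at unit_coord)"

definition blinfun_rep :: "('g \<Rightarrow> ('v::euclidean_space \<Rightarrow>\<^sub>L 'v)) \<Rightarrow> bool" where
  "blinfun_rep R \<longleftrightarrow> (\<forall>g h. R (g \<otimes> h) = R g o\<^sub>L R h) \<and> R \<one> = id_blinfun \<and> continuous_on UNIV R"

lemma
  assumes "blinfun_rep R"
  shows rep_mult: "R (g \<otimes> h) = R g o\<^sub>L R h" and rep_one: "R \<one> = id_blinfun"
    and rep_continuous: "continuous_on UNIV R"
  using assms by (auto simp: blinfun_rep_def)

lemma rep_has_derivative:
  assumes "blinfun_rep R"
  shows "((\<lambda>z. R (near_unit z)) has_derivative rep_deriv R) (at unit_coord)"
  using representation_differentiable[OF rep_mult[OF assms] rep_one[OF assms] rep_continuous[OF assms]]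
  unfolding rep_deriv_def by (metis frechet_derivative_eqI)

text \<open>Near \<open>p\<close>, \<open>R q\<close> is \<open>R p\<close> composed with
  \<open>R (inv p \<otimes> q)\<close>, which carries the derivative at the unit to
  \<open>p\<close>. A tangent vector is given through the frame, so that the result no longer
  depends on the chart.\<close>

lemma rep_chart_derivative:
  assumes R: "blinfun_rep R" and c: "c \<in> A" "p \<in> fst c"
  obtains D where "((\<lambda>y. R (param c y)) has_derivative D) (at (snd c p))"
    "\<And>v. D (frame c p v) = R p o\<^sub>L rep_deriv R v"
proof -
  let ?L = "\<lambda>q. inv p \<otimes> q"
  let ?J = "chart_deriv ?L c unit_chart p"
  have J: "((\<lambda>y. snd unit_chart (?L (param c y))) has_derivative ?J) (at (snd c p))"
    using chart_deriv_has_derivative[OF smooth_map_left c unit_chart(1), of "inv p"] unit_chart(2) by simp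
  have "(?L (param c (snd c p))) = \<one>" by (simp add: param_coord[OF c])
  then have "((\<lambda>z. R (near_unit z)) has_derivative rep_deriv R) (at (snd unit_chart (?L (param c (snd c p)))))"
    using rep_has_derivative[OF R] by (simp add: unit_coord_def)
  from has_derivative_compose[OF J this]
  have "((\<lambda>y. R (near_unit (snd unit_chart (?L (param c y))))) has_derivative (\<lambda>w. rep_deriv R (?J w))) (at (snd c p))" .
  then have d1: "((\<lambda>y. R p o\<^sub>L R (near_unit (snd unit_chart (?L (param c y))))) has_derivative
      (\<lambda>w. R p o\<^sub>L rep_deriv R (?J w))) (at (snd c p))"
    by (rule bounded_linear.has_derivative[OF bounded_bilinear.bounded_linear_right[OF bounded_bilinear_blinfun_compose]])
  let ?U = "{y \<in> coord_range c. ?L (param c y) \<in> fst unit_chart}"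
  have U: "open ?U" by (rule smooth_map_open_vimage[OF smooth_map_left c(1) unit_chart(1)])
  have sU: "snd c p \<in> ?U" using c unit_chart(2) by (simp add: param_coord coord_in)
  have D: "((\<lambda>y. R (param c y)) has_derivative (\<lambda>w. R p o\<^sub>L rep_deriv R (?J w))) (at (snd c p))"
    by (rule has_derivative_transform_within_open[OF d1 U sU])
      (auto simp: near_unit_def param_coord[OF unit_chart(1)] rep_mult[OF R, symmetric])
  \<comment> \<open>The differentials of translation by \<open>inv p\<close> and by \<open>p\<close>
    are inverse to each other.\<close>
  have "?J (frame c p v) = v" for v
  proof -
    have pc: "snd c (p \<otimes> near_unit unit_coord) = snd c p" by simp
    have "((\<lambda>z. snd unit_chart (?L (param c (snd c (p \<otimes> near_unit z))))) has_derivative (\<lambda>v. ?J (frame c p v))) (at unit_coord)"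
      by (rule has_derivative_compose[OF frame_has_derivative[OF c]]) (use J pc in simp)
    moreover let ?V = "{z \<in> coord_range unit_chart. p \<otimes> param unit_chart z \<in> fst c}"
    have V: "open ?V" by (rule smooth_map_open_vimage[OF smooth_map_left unit_chart(1) c(1)])
    have "((\<lambda>z. snd unit_chart (?L (param c (snd c (p \<otimes> near_unit z))))) has_derivative (\<lambda>v. v)) (at unit_coord)"
      by (rule has_derivative_transform_within_open[OF has_derivative_ident V])
        (use unit_coord_in c near_unit_unit_coord in \<open>auto simp: near_unit_def param_coord[OF c(1)] coord_param[OF unit_chart(1)]\<close>)
    ultimately show ?thesis using has_derivative_unique by metis
  qed
  then show thesis using that[OF D] by simp
qed

end

section \<open>Characters and continuous arguments\<close>

lemma continuous_on_UNIV_metricI: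
  fixes f :: "'a::topological_space \<Rightarrow> 'b::metric_space"
  assumes "\<And>x e. e > 0 \<Longrightarrow> \<exists>W. open W \<and> x \<in> W \<and> (\<forall>w\<in>W. dist (f w) (f x) < e)"
  shows "continuous_on UNIV f"
  unfolding continuous_on_def
proof
  fix x
  show "(f \<longlongrightarrow> f x) (at x within UNIV)"
  proof (rule tendstoI)
    fix e :: real assume "e > 0"
    then show "eventually (\<lambda>w. dist (f w) (f x) < e) (at x within UNIV)"
      using assms[of e x] unfolding eventually_at_topological by blast
  qed
qed

locale semisimple_compact_lie_group = bi_invariant_lie_group G A \<rho>
  for G :: "'g::t2_space monoid" (structure) and A :: "('g, 'n::finite) chart set" and \<rho> +
  assumes semisimple: "semisimple_lie_group G A"
    and compact: "compact (UNIV :: 'g set)" and connected: "connected (UNIV :: 'g set)"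

sublocale semisimple_compact_lie_group \<subseteq> compact_group G
  by standard (rule compact)

context semisimple_compact_lie_group
begin

lemma zero_derivative_imp_constant:
  fixes u :: "'g \<Rightarrow> 'b::real_normed_vector"
  assumes "\<And>c p. c \<in> A \<Longrightarrow> p \<in> fst c \<Longrightarrow> ((\<lambda>y. u (param c y)) has_derivative (\<lambda>v. 0)) (at (snd c p))"
  shows "u p = u \<one>"
proof -
  have "u constant_on UNIV"
  proof (rule locally_constant_imp_constant[OF connected])
    fix p :: 'g
    obtain c where c: "c \<in> A" "p \<in> fst c" by (rule chart_exists)
    obtain r where r: "r > 0" "cball (snd c p) r \<subseteq> coord_range c" by (rule chart_ball[OF c])
    have "\<exists>k. \<forall>y\<in>ball (snd c p) r. u (param c y) = k"
    proof (rule has_derivative_zero_constant)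
      fix y assume "y \<in> ball (snd c p) r"
      then have "y \<in> coord_range c" using r by auto
      then have "((\<lambda>y. u (param c y)) has_derivative (\<lambda>v. 0)) (at y)"
        using assms[OF c(1) param_in[OF c(1)]] coord_param[OF c(1)] by metis
      then show "((\<lambda>y. u (param c y)) has_derivative (\<lambda>v. 0)) (at y within ball (snd c p) r)"
        by (rule has_derivative_at_withinI)
    qed simp
    then obtain k where k: "\<And>y. y \<in> ball (snd c p) r \<Longrightarrow> u (param c y) = k" by blast
    let ?W = "{q \<in> fst c. snd c q \<in> ball (snd c p) r}"
    have "open ?W"
      using continuous_open_preimage[OF continuous_on_chart[OF c(1)] open_chart_domain[OF c(1)] open_ball[of "snd c p" r]]
      by (simp add: vimage_def Int_def)
    moreover have "u q = k" if "q \<in> ?W" for q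
      using k[of "snd c q"] that param_coord[OF c(1), of q] by simp
    moreover have "p \<in> ?W" using c r by simp
    ultimately show "\<exists>T. openin (top_of_set UNIV) T \<and> p \<in> T \<and> (\<forall>x\<in>T. u x = u p)"
      by (intro exI[of _ ?W]) auto
  qed
  then show ?thesis unfolding constant_on_def by auto
qed

lemma rep_apply_constant:
  assumes R: "blinfun_rep R" and z: "\<And>v. blinfun_apply (rep_deriv R v) x = 0"
  shows "blinfun_apply (R p) x = x"
proof -
  have "blinfun_apply (R p) x = blinfun_apply (R \<one>) x"
  proof (rule zero_derivative_imp_constant[of "\<lambda>p. blinfun_apply (R p) x"])
    fix c p assume c: "c \<in> A" "p \<in> fst c"
    obtain D where D: "((\<lambda>y. R (param c y)) has_derivative D) (at (snd c p))"
      "\<And>v. D (frame c p v) = R p o\<^sub>L rep_deriv R v" using rep_chart_derivative[OF R c] by blast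
    have "((\<lambda>y. blinfun_apply (R (param c y)) x) has_derivative (\<lambda>w. blinfun_apply (D w) x)) (at (snd c p))"
      by (rule bounded_linear.has_derivative[OF blinfun.bounded_linear_left D(1)])
    moreover have "blinfun_apply (D w) x = 0" for w
    proof -
      obtain v where "w = frame c p v" using frame_surj[OF c] by (metis surjD)
      then show ?thesis by (simp add: D(2) z)
    qed
    ultimately show "((\<lambda>y. blinfun_apply (R (param c y)) x) has_derivative (\<lambda>v. 0)) (at (snd c p))" by simp
  qed
  then show ?thesis by (simp add: rep_one[OF R])
qed

lemma rep_deriv_Ad:
  assumes R: "blinfun_rep R" and inv: "\<And>q. R (conjugation g q) = R q"
  shows "rep_deriv R (Ad g v) = rep_deriv R v"
proof -
  have d: "((\<lambda>z. R (near_unit z)) has_derivative rep_deriv R) (at (snd unit_chart (conjugation g (near_unit unit_coord))))"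
    using rep_has_derivative[OF R] near_unit_unit_coord conjugation_one[of g] unit_coord_def by metis
  have sm: "smooth_map (conjugation g)" using diffeo_conjugation by (simp add: diffeo_def)
  let ?U = "{z \<in> coord_range unit_chart. conjugation g (param unit_chart z) \<in> fst unit_chart}"
  have U: "open ?U" by (rule smooth_map_open_vimage[OF sm unit_chart(1) unit_chart(1)])
  have uU: "unit_coord \<in> ?U"
    using unit_coord_in unit_chart(2) near_unit_unit_coord by (simp add: near_unit_def)
  have "((\<lambda>z. R (near_unit z)) has_derivative (\<lambda>v. rep_deriv R (Ad g v))) (at unit_coord)"
    by (rule has_derivative_transform_within_open[OF has_derivative_compose[OF Ad_has_derivative d] U uU])
      (auto simp: near_unit_def param_coord[OF unit_chart(1)] inv)
  from has_derivative_unique[OF this rep_has_derivative[OF R]] show ?thesis by metis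
qed

text \<open>As values in a commutative field, characters are constant on conjugacy classes, so the
  real and imaginary parts of the differential are Ad-invariant functionals and vanish. The
  character is then constant on the connected group.\<close>

lemma character_trivial:
  fixes \<eta> :: "'g \<Rightarrow> complex"
  assumes cont: "continuous_on UNIV \<eta>" and hom: "\<And>g h. \<eta> (g \<otimes> h) = \<eta> g * \<eta> h" and one: "\<eta> \<one> = 1"
  shows "\<eta> g = 1"
proof -
  define R where "R g = blinfun_mult_right (\<eta> g)" for g
  have ap: "blinfun_apply (R g) z = \<eta> g * z" for g z by (simp add: R_def)
  have R: "blinfun_rep R"
    unfolding blinfun_rep_def
  proof (intro conjI allI)
    show "R (g \<otimes> h) = R g o\<^sub>L R h" for g h by (rule blinfun_eqI) (simp add: ap hom)
    show "R \<one> = id_blinfun" by (rule blinfun_eqI) (simp add: ap one)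
    show "continuous_on UNIV R"
      unfolding R_def by (intro bounded_linear.continuous_on[OF bounded_linear_blinfun_mult_right] cont)
  qed
  have inv: "R (conjugation g q) = R q" for g q
  proof (rule blinfun_eqI)
    have "\<eta> g * \<eta> (inv g) = 1" using hom[of g "inv g"] by (simp add: one)
    then show "blinfun_apply (R (conjugation g q)) z = blinfun_apply (R q) z" for z
      by (simp add: ap conjugation_def hom mult_ac)
  qed
  interpret E: bounded_linear "rep_deriv R" using rep_has_derivative[OF R] by (rule has_derivative_bounded_linear)
  have "Re (blinfun_apply (rep_deriv R v) 1) = 0" for v
    by (rule semisimple_no_invariant_functional[OF semisimple])
      (auto intro!: linearI simp: E.add E.scaleR blinfun.bilinear_simps rep_deriv_Ad[OF R inv])
  moreover have "Im (blinfun_apply (rep_deriv R v) 1) = 0" for v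
    by (rule semisimple_no_invariant_functional[OF semisimple])
      (auto intro!: linearI simp: E.add E.scaleR blinfun.bilinear_simps rep_deriv_Ad[OF R inv])
  ultimately have "blinfun_apply (rep_deriv R v) 1 = 0" for v by (simp add: complex_eq_iff)
  from rep_apply_constant[OF R this, of g] show ?thesis by (simp add: ap)
qed

text \<open>\<open>\<theta>\<close> is a continuous argument of
  \<open>\<psi> (g \<otimes> h) / \<psi> h\<close> as a function of \<open>h\<close>, for
  \<open>\<psi>\<close> of modulus 1. It exists for each \<open>g\<close> even before
  \<open>\<psi>\<close> is known to have a continuous argument.\<close>

definition angle_shift :: "('g \<Rightarrow> complex) \<Rightarrow> 'g \<Rightarrow> ('g \<Rightarrow> real) \<Rightarrow> bool" where
  "angle_shift \<psi> g \<theta> \<longleftrightarrow> continuous_on UNIV \<theta> \<and> (\<forall>h. \<psi> (g \<otimes> h) = \<psi> h * cis (\<theta> h))"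

lemma angle_shift_mult:
  assumes "angle_shift \<psi> g \<theta>" "angle_shift \<psi> g' \<theta>'"
  shows "angle_shift \<psi> (g \<otimes> g') (\<lambda>h. \<theta> (g' \<otimes> h) + \<theta>' h)"
  using assms unfolding angle_shift_def
  by (auto intro!: continuous_on_add continuous_on_translate_left simp: m_assoc mult_ac cis_mult[symmetric])

lemma angle_shift_inv:
  assumes "angle_shift \<psi> g \<theta>"
  shows "angle_shift \<psi> (inv g) (\<lambda>h. - \<theta> (inv g \<otimes> h))"
proof -
  have "\<psi> (inv g \<otimes> h) = \<psi> h * cis (- \<theta> (inv g \<otimes> h))" for h
  proof -
    have "\<psi> (g \<otimes> (inv g \<otimes> h)) = \<psi> (inv g \<otimes> h) * cis (\<theta> (inv g \<otimes> h))"
      using assms unfolding angle_shift_def by blast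
    then show ?thesis by (simp add: mult.assoc cis_mult)
  qed
  then show ?thesis using assms unfolding angle_shift_def
    by (auto intro!: continuous_on_minus continuous_on_translate_left)
qed

text \<open>For \<open>u\<close> near the unit the quotient
  \<open>\<psi> (u \<otimes> h) / \<psi> h\<close> is close to 1 uniformly in \<open>h\<close>, so
  the principal logarithm gives a continuous and small argument.\<close>

lemma angle_shift_near_one:
  assumes cont: "continuous_on UNIV \<psi>" and norm1: "\<And>g. cmod (\<psi> g) = 1" and e: "e > 0"
  shows "\<exists>U. open U \<and> \<one> \<in> U \<and> (\<forall>u\<in>U. \<exists>\<theta>. angle_shift \<psi> u \<theta> \<and> (\<forall>h. \<bar>\<theta> h\<bar> < e))"
proof -
  have "isCont Ln 1" by (rule continuous_at_Ln) auto
  then obtain d where d: "d > 0" "\<And>w. dist w 1 < d \<Longrightarrow> dist (Ln w) (Ln 1) < e"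
    using e unfolding continuous_at_eps_delta by blast
  \<comment> \<open>The bound \<open>d\<close> makes the logarithm small; the bound 1 makes the real
    part positive and keeps the quotient off the branch cut.\<close>
  obtain U where U: "open U" "\<one> \<in> U" "\<And>u h. u \<in> U \<Longrightarrow> dist (\<psi> (u \<otimes> h)) (\<psi> h) < min d 1"
    using uniform_left_continuity[OF cont, of "min d 1"] d(1) by auto
  have "\<exists>\<theta>. angle_shift \<psi> u \<theta> \<and> (\<forall>h. \<bar>\<theta> h\<bar> < e)" if u: "u \<in> U" for u
  proof -
    let ?w = "\<lambda>h. \<psi> (u \<otimes> h) / \<psi> h"
    have nz: "\<psi> h \<noteq> 0" for h using norm1[of h] by auto
    have w1: "dist (?w h) 1 < min d 1" for h
    proof -
      have "?w h - 1 = (\<psi> (u \<otimes> h) - \<psi> h) / \<psi> h" using nz[of h] by (simp add: field_simps)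
      then have "dist (?w h) 1 = dist (\<psi> (u \<otimes> h)) (\<psi> h)" by (simp add: dist_norm norm_divide norm1)
      then show ?thesis using U(3)[OF u, of h] by simp
    qed
    have re: "Re (?w h) > 0" for h
    proof -
      have "\<bar>Re (?w h) - 1\<bar> \<le> cmod (?w h - 1)" using abs_Re_le_cmod[of "?w h - 1"] by simp
      moreover have "cmod (?w h - 1) < 1" using w1[of h] by (simp add: dist_norm)
      ultimately show ?thesis by linarith
    qed
    have wnz: "?w h \<noteq> 0" for h using nz by simp
    have wn: "cmod (?w h) = 1" for h by (simp add: norm_divide norm1)
    have "continuous_on UNIV (\<lambda>h. Im (Ln (?w h)))"
    proof (intro continuous_on_Im continuous_on_Ln' continuous_on_divide continuous_on_translate_left cont)
      show "?w h \<notin> \<real>\<^sub>\<le>\<^sub>0" for h using re[of h] by (auto simp: complex_nonpos_Reals_iff)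
    qed (simp add: nz)
    moreover have "\<psi> (u \<otimes> h) = \<psi> h * cis (Im (Ln (?w h)))" for h
    proof -
      have "exp (Ln (?w h)) = ?w h" using wnz by (rule exp_Ln)
      moreover have "exp (Ln (?w h)) = exp (Re (Ln (?w h))) * cis (Im (Ln (?w h)))" by (rule exp_eq_polar)
      moreover have "Re (Ln (?w h)) = 0" using wnz[of h] wn[of h] by simp
      ultimately have "cis (Im (Ln (?w h))) = ?w h" by simp
      then show ?thesis using nz[of h] by simp
    qed
    moreover have "\<bar>Im (Ln (?w h))\<bar> < e" for h
    proof -
      have "dist (Ln (?w h)) (Ln 1) < e" using d(2) w1[of h] by simp
      then show ?thesis using abs_Im_le_cmod[of "Ln (?w h)"] by simp
    qed
    ultimately show ?thesis unfolding angle_shift_def by blast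
  qed
  then show ?thesis using U by blast
qed

lemma open_right_translate: "open U \<Longrightarrow> open {w. w \<otimes> inv g \<in> U}"
  using open_vimage[of U "\<lambda>w. w \<otimes> inv g"] continuous_on_group_mult[OF continuous_on_id continuous_on_const, of UNIV "inv g"]
  by (simp add: vimage_def)

text \<open>The elements that have a shift form a subgroup containing a neighbourhood of the unit.
  It is open, its complement is open too, and the group is connected.\<close>

lemma angle_shift_exists:
  assumes cont: "continuous_on UNIV \<psi>" and norm1: "\<And>g. cmod (\<psi> g) = 1"
  shows "\<exists>\<theta>. angle_shift \<psi> g \<theta>"
proof -
  from angle_shift_near_one[OF cont norm1 zero_less_one] obtain U where U: "open U" "\<one> \<in> U"
    "\<forall>u\<in>U. \<exists>\<theta>. angle_shift \<psi> u \<theta> \<and> (\<forall>h. \<bar>\<theta> h\<bar> < 1)" by (elim exE conjE)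
  define H where "H = {g. \<exists>\<theta>. angle_shift \<psi> g \<theta>}"
  have mult: "g \<otimes> h \<in> H" if gh: "g \<in> H" "h \<in> H" for g h
  proof -
    obtain \<theta> \<theta>' where "angle_shift \<psi> g \<theta>" "angle_shift \<psi> h \<theta>'" using gh unfolding H_def by blast
    from angle_shift_mult[OF this] show ?thesis unfolding H_def by blast
  qed
  have inv: "inv g \<in> H" if g: "g \<in> H" for g
  proof -
    obtain \<theta> where "angle_shift \<psi> g \<theta>" using g unfolding H_def by blast
    from angle_shift_inv[OF this] show ?thesis unfolding H_def by blast
  qed
  have UH: "U \<subseteq> H" using U(3) by (auto simp: H_def)
  have eq: "w = (w \<otimes> inv g) \<otimes> g" for w g by (simp add: m_assoc)
  have "open H"
    unfolding open_subopen[of H]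
  proof
    fix g assume g: "g \<in> H"
    have "{w. w \<otimes> inv g \<in> U} \<subseteq> H" using mult[OF _ g] UH eq[of _ g] by (metis (mono_tags, lifting) mem_Collect_eq subset_iff)
    then show "\<exists>T. open T \<and> g \<in> T \<and> T \<subseteq> H" using open_right_translate[OF U(1), of g] U(2)
      by (intro exI[of _ "{w. w \<otimes> inv g \<in> U}"]) simp
  qed
  moreover have "open (- H)"
    unfolding open_subopen[of "- H"]
  proof
    fix g assume g: "g \<in> - H"
    have "{w. w \<otimes> inv g \<in> U} \<subseteq> - H"
    proof
      fix w assume "w \<in> {w. w \<otimes> inv g \<in> U}"
      then have "inv (w \<otimes> inv g) \<in> H" using UH inv by blast
      moreover have "g = inv (w \<otimes> inv g) \<otimes> w" by (simp add: inv_mult_group m_assoc)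
      ultimately show "w \<in> - H" using mult[of "inv (w \<otimes> inv g)" w] g by auto
    qed
    then show "\<exists>T. open T \<and> g \<in> T \<and> T \<subseteq> - H" using open_right_translate[OF U(1), of g] U(2)
      by (intro exI[of _ "{w. w \<otimes> inv g \<in> U}"]) simp
  qed
  moreover have "\<one> \<in> H" using U(2) UH by blast
  ultimately have "H = UNIV"
    using connected connected_clopen[of "UNIV :: 'g set"] by (auto simp: closed_open)
  then show ?thesis unfolding H_def by blast
qed

text \<open>The difference of two shifts is continuous with values in the discrete set of multiples
  of \<open>2 * pi\<close>.\<close>

lemma angle_shift_unique:
  assumes "angle_shift \<psi> g \<theta>" "angle_shift \<psi> g \<theta>'" and norm1: "\<And>g. cmod (\<psi> g) = 1"
  obtains k where "cis k = 1" "\<And>h. \<theta> h = \<theta>' h + k"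
proof -
  let ?f = "\<lambda>h. \<theta> h - \<theta>' h"
  have cis1: "cis (?f h) = 1" for h
  proof -
    have "\<psi> h * cis (\<theta> h) = \<psi> h * cis (\<theta>' h)" using assms unfolding angle_shift_def by metis
    moreover have "\<psi> h \<noteq> 0" using norm1[of h] by auto
    ultimately show ?thesis by (simp add: cis_divide[symmetric])
  qed
  have int: "\<exists>n::int. ?f h = of_int n * 2 * pi" for h
    using cis1[of h] cos_one_2pi_int[of "?f h"] by (simp add: complex_eq_iff)
  have "?f constant_on UNIV"
  proof (rule continuous_discrete_range_constant[OF connected])
    show "continuous_on UNIV ?f" using assms unfolding angle_shift_def by (intro continuous_on_diff) auto
    fix h
    show "\<exists>e>0. \<forall>y. y \<in> UNIV \<and> ?f y \<noteq> ?f h \<longrightarrow> e \<le> norm (?f y - ?f h)"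
    proof (intro exI[of _ 1] conjI allI impI)
      fix y assume ne: "y \<in> UNIV \<and> ?f y \<noteq> ?f h"
      obtain n m :: int where nm: "?f y = of_int n * 2 * pi" "?f h = of_int m * 2 * pi" using int by meson
      have "n \<noteq> m" using ne nm by auto
      then have "1 \<le> \<bar>real_of_int n - real_of_int m\<bar>" by linarith
      then have "1 * 1 \<le> \<bar>real_of_int n - real_of_int m\<bar> * (2 * pi)" using pi_ge_two by (intro mult_mono) auto
      also have "\<dots> = norm ((real_of_int n - real_of_int m) * (2 * pi))" by (simp add: abs_mult)
      also have "(real_of_int n - real_of_int m) * (2 * pi) = ?f y - ?f h" unfolding nm by (simp add: algebra_simps)
      finally show "1 \<le> norm (?f y - ?f h)" by simp
    qed simp
  qed
  then obtain k where k: "\<And>h. ?f h = k" unfolding constant_on_def by auto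
  have "cis k = 1" using cis1[of \<one>] k[of \<one>] by simp
  moreover have "\<theta> h = \<theta>' h + k" for h using k[of h] by linarith
  ultimately show thesis by (rule that)
qed

lemma cis_eq_1_small: "cis m = 1 \<Longrightarrow> \<bar>m\<bar> < 1 \<Longrightarrow> m = 0"
proof -
  assume m: "cis m = 1" "\<bar>m\<bar> < 1"
  then obtain n :: int where n: "m = of_int n * 2 * pi" using cos_one_2pi_int[of m] by (auto simp: complex_eq_iff)
  have "n = 0"
  proof (rule ccontr)
    assume "n \<noteq> 0"
    then have "1 * 1 \<le> \<bar>real_of_int n\<bar> * (2 * pi)" using pi_ge_two by (intro mult_mono) auto
    then show False using m(2) by (simp add: n abs_mult)
  qed
  then show "m = 0" by (simp add: n)
qed

text \<open>The average \<open>mean \<theta>\<close> of an angle shift is well defined modulo \<open>2\<pi>\<close> and its exponential is a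
  character of \<open>G\<close>. As this is trivial, there is a shift of mean zero for every group element,
  and these depend continuously and additively on the element.\<close>

lemma continuous_argument:
  assumes cont: "continuous_on UNIV \<psi>" and norm1: "\<And>g. cmod (\<psi> g) = 1"
  obtains b where "continuous_on UNIV b" "\<And>g. \<psi> g = \<psi> \<one> * cis (b g)"
proof -
  note near = angle_shift_near_one[OF cont norm1]
  note ex = angle_shift_exists[OF cont norm1]
  \<comment> \<open>The choice of the shift does not matter: two shifts differ by a constant
    \<open>k\<close> with \<open>cis k = 1\<close>, and so do their means.\<close>
  define \<eta> where "\<eta> g = cis (mean (SOME \<theta>. angle_shift \<psi> g \<theta>))" for g
  have cs: "continuous_on UNIV \<theta>" if "angle_shift \<psi> g \<theta>" for g \<theta>
    using that by (simp add: angle_shift_def)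
  have mean_shift: "mean \<theta> = mean \<theta>' + k" if "continuous_on UNIV \<theta>'" "\<And>h. \<theta> h = \<theta>' h + k" for \<theta> \<theta>' k
  proof -
    have "\<theta> = (\<lambda>h. \<theta>' h + k)" using that(2) by blast
    then show ?thesis using mean_add[OF that(1) continuous_on_const[of UNIV k]] by simp
  qed
  have \<eta>: "\<eta> g = cis (mean \<theta>)" if t: "angle_shift \<psi> g \<theta>" for g \<theta>
  proof -
    have s: "angle_shift \<psi> g (SOME \<theta>. angle_shift \<psi> g \<theta>)" using ex by (rule someI_ex)
    obtain k where k: "cis k = 1" "\<And>h. (SOME \<theta>. angle_shift \<psi> g \<theta>) h = \<theta> h + k"
      using angle_shift_unique[OF s t norm1] by blast
    show ?thesis unfolding \<eta>_def mean_shift[OF cs[OF t] k(2)] by (simp add: cis_mult[symmetric] k(1))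
  qed
  have \<eta>_mult: "\<eta> (g \<otimes> h) = \<eta> g * \<eta> h" for g h
  proof -
    obtain \<theta> \<theta>' where t: "angle_shift \<psi> g \<theta>" "angle_shift \<psi> h \<theta>'" using ex by meson
    have "\<eta> (g \<otimes> h) = cis (mean (\<lambda>k. \<theta> (h \<otimes> k) + \<theta>' k))" by (rule \<eta>[OF angle_shift_mult[OF t]])
    also have "mean (\<lambda>k. \<theta> (h \<otimes> k) + \<theta>' k) = mean \<theta> + mean \<theta>'"
      by (simp add: mean_add continuous_on_translate_left cs[OF t(1)] cs[OF t(2)] mean_translate_left)
    finally show ?thesis by (simp add: \<eta>[OF t(1)] \<eta>[OF t(2)] cis_mult)
  qed
  have one: "angle_shift \<psi> \<one> (\<lambda>h. 0)" by (simp add: angle_shift_def)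
  have \<eta>_one: "\<eta> \<one> = 1" using \<eta>[OF one] by simp
  have \<eta>_norm: "cmod (\<eta> g) = 1" for g by (simp add: \<eta>_def)
  have "continuous_on UNIV \<eta>"
  proof (rule continuous_on_UNIV_metricI)
    fix g and e :: real assume e: "e > 0"
    have "isCont (\<lambda>t. exp (\<i> * complex_of_real t)) 0" by (intro continuous_intros)
    then have "isCont cis 0" by (simp add: cis_conv_exp[abs_def])
    then obtain d where d: "d > 0" "\<And>t. dist t 0 < d \<Longrightarrow> dist (cis t) (cis 0) < e"
      using e unfolding continuous_at_eps_delta by blast
    then obtain U where U: "open U" "\<one> \<in> U" "\<And>u. u \<in> U \<Longrightarrow> \<exists>\<theta>. angle_shift \<psi> u \<theta> \<and> (\<forall>h. \<bar>\<theta> h\<bar> < d / 2)"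
      using near[of "d / 2"] by auto
    show "\<exists>W. open W \<and> g \<in> W \<and> (\<forall>w\<in>W. dist (\<eta> w) (\<eta> g) < e)"
    proof (intro exI[of _ "{w. w \<otimes> inv g \<in> U}"] conjI ballI open_right_translate U(1))
      show "g \<in> {w. w \<otimes> inv g \<in> U}" using U(2) by simp
      fix w assume "w \<in> {w. w \<otimes> inv g \<in> U}"
      then obtain \<theta> where t: "angle_shift \<psi> (w \<otimes> inv g) \<theta>" "\<And>h. \<bar>\<theta> h\<bar> < d / 2" using U(3) by blast
      have "\<bar>mean \<theta>\<bar> \<le> d / 2" using abs_mean_le[OF cs[OF t(1)]] t(2) less_imp_le by blast
      then have "dist (mean \<theta>) 0 < d" using d(1) by simp
      then have "dist (\<eta> (w \<otimes> inv g)) 1 < e" using d(2) by (simp add: \<eta>[OF t(1)])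
      moreover have "\<eta> w = \<eta> (w \<otimes> inv g) * \<eta> g" unfolding \<eta>_mult[symmetric] by (simp add: m_assoc)
      moreover have "dist (\<eta> (w \<otimes> inv g) * \<eta> g) (\<eta> g) = dist (\<eta> (w \<otimes> inv g)) 1 * cmod (\<eta> g)"
        by (simp add: dist_norm norm_mult[symmetric] left_diff_distrib)
      ultimately show "dist (\<eta> w) (\<eta> g) < e" by (simp add: \<eta>_norm)
    qed
  qed
  from character_trivial[OF this \<eta>_mult \<eta>_one] have triv: "cis (mean \<theta>) = 1" if "angle_shift \<psi> g \<theta>" for g \<theta>
    using \<eta>[OF that] by simp
  define normal where "normal g \<theta> \<longleftrightarrow> angle_shift \<psi> g \<theta> \<and> mean \<theta> = 0" for g \<theta>
  have normal_ex: "\<exists>\<theta>. normal g \<theta>" for g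
  proof -
    obtain \<theta> where t: "angle_shift \<psi> g \<theta>" using ex by blast
    have "angle_shift \<psi> g (\<lambda>h. \<theta> h + - mean \<theta>)"
    proof -
      have "cis (\<theta> h + - mean \<theta>) = cis (\<theta> h)" for h
        using triv[OF t] by (simp add: cis_divide[symmetric])
      then show ?thesis using t unfolding angle_shift_def by (auto intro!: continuous_on_diff continuous_on_const)
    qed
    moreover have "mean (\<lambda>h. \<theta> h + - mean \<theta>) = 0" using mean_shift[OF cs[OF t], of "\<lambda>h. \<theta> h + - mean \<theta>" "- mean \<theta>"] by simp
    ultimately show ?thesis unfolding normal_def by blast
  qed
  \<comment> \<open>At \<open>h = \<one>\<close> a shift relates \<open>\<psi> g\<close> to
    \<open>\<psi> \<one>\<close>, so its value there is an argument; mean zero makes the shift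
    unique.\<close>
  define b where "b g = (SOME \<theta>. normal g \<theta>) \<one>" for g
  have b: "b g = \<theta> \<one>" if n: "normal g \<theta>" for g \<theta>
  proof -
    have s: "normal g (SOME \<theta>. normal g \<theta>)" using normal_ex by (rule someI_ex)
    have s': "angle_shift \<psi> g (SOME \<theta>. normal g \<theta>)" and n': "angle_shift \<psi> g \<theta>"
      using s n by (simp_all only: normal_def)
    obtain k where k: "\<And>h. (SOME \<theta>. normal g \<theta>) h = \<theta> h + k"
      using angle_shift_unique[OF s' n' norm1] by blast
    have "continuous_on UNIV \<theta>" by (rule cs[OF n'])
    from mean_shift[OF this k] have "k = 0" using s n by (simp add: normal_def)
    then show ?thesis by (simp add: b_def k)
  qed
  have b_mult: "b (u \<otimes> g) = \<theta> g + b g" if u: "normal u \<theta>" for u g \<theta>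
  proof -
    obtain \<theta>' where t': "normal g \<theta>'" using normal_ex by blast
    have c: "continuous_on UNIV \<theta>" "continuous_on UNIV \<theta>'" using u t' cs by (auto simp: normal_def)
    have "normal (u \<otimes> g) (\<lambda>h. \<theta> (g \<otimes> h) + \<theta>' h)"
      using u t' angle_shift_mult unfolding normal_def
      by (simp add: mean_add continuous_on_translate_left c mean_translate_left)
    from b[OF this] show ?thesis by (simp add: b[OF t'])
  qed
  have "continuous_on UNIV b"
  proof (rule continuous_on_UNIV_metricI)
    fix g and e :: real assume e: "e > 0"
    \<comment> \<open>Besides \<open>d < e\<close>, the bound \<open>d < 1\<close> matters: the mean
      of a shift smaller than \<open>d\<close> is a multiple of \<open>2 * pi\<close> of modulus
      below 1, hence 0, so this shift is the normalised one and measures the increment of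
      \<open>b\<close>.\<close>
    define d where "d = min e 1 / 2"
    have d: "d > 0" "d < e" "d < 1" using e by (auto simp: d_def)
    obtain U where U: "open U" "\<one> \<in> U" "\<And>u. u \<in> U \<Longrightarrow> \<exists>\<theta>. angle_shift \<psi> u \<theta> \<and> (\<forall>h. \<bar>\<theta> h\<bar> < d)"
      using near[OF d(1)] by auto
    show "\<exists>W. open W \<and> g \<in> W \<and> (\<forall>w\<in>W. dist (b w) (b g) < e)"
    proof (intro exI[of _ "{w. w \<otimes> inv g \<in> U}"] conjI ballI open_right_translate U(1))
      show "g \<in> {w. w \<otimes> inv g \<in> U}" using U(2) by simp
      fix w assume "w \<in> {w. w \<otimes> inv g \<in> U}"
      then obtain \<theta> where t: "angle_shift \<psi> (w \<otimes> inv g) \<theta>" "\<And>h. \<bar>\<theta> h\<bar> < d" using U(3) by blast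
      have "\<bar>mean \<theta>\<bar> \<le> d" using abs_mean_le[OF cs[OF t(1)]] t(2) less_imp_le by blast
      then have "mean \<theta> = 0" using d by (intro cis_eq_1_small triv[OF t(1)]) simp
      then have "normal (w \<otimes> inv g) \<theta>" using t(1) by (simp add: normal_def)
      from b_mult[OF this, of g] have "b w = \<theta> g + b g" by (simp add: m_assoc)
      then show "dist (b w) (b g) < e" using t(2)[of g] d(2) by (simp add: dist_real_def)
    qed
  qed
  moreover have "\<psi> g = \<psi> \<one> * cis (b g)" for g
  proof -
    obtain \<theta> where t: "normal g \<theta>" using normal_ex by blast
    then have "\<psi> (g \<otimes> \<one>) = \<psi> \<one> * cis (\<theta> \<one>)" unfolding normal_def angle_shift_def by blast
    then show ?thesis by (simp add: b[OF t])
  qed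
  ultimately show thesis by (rule that)
qed

end

section \<open>The Laplace--Beltrami operator on matrix elements\<close>

lemma matrix_inv_eqI:
  fixes M :: "real^'n^'n"
  assumes "M ** N = mat 1"
  shows "matrix_inv M = N"
proof -
  have N: "N ** M = mat 1" using assms by (simp add: matrix_left_right_inverse)
  have "M ** matrix_inv M = mat 1 \<and> matrix_inv M ** M = mat 1"
    unfolding matrix_inv_def by (rule someI[of _ N]) (use assms N in simp)
  then have "matrix_inv M = (N ** M) ** matrix_inv M" using N by simp
  also have "\<dots> = N" using \<open>M ** matrix_inv M = mat 1 \<and> matrix_inv M ** M = mat 1\<close>
    by (metis matrix_mul_assoc matrix_mul_rid)
  finally show ?thesis .
qed

lemma inner_transpose: "v \<bullet> (transpose X *v z) = (X *v v) \<bullet> (z :: real^'n)"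
  using dot_lmul_matrix[of z X v] by (simp add: inner_commute)

lemma matrix_pullback:
  fixes X M N :: "real^'n^'n"
  assumes "\<And>v w. (X *v v) \<bullet> (M *v (X *v w)) = v \<bullet> (N *v w)"
  shows "transpose X ** M ** X = N"
proof -
  have "v \<bullet> ((transpose X ** M ** X) *v w) = v \<bullet> (N *v w)" for v w
    using assms[of v w] inner_transpose[of v X "M *v (X *v w)"]
    by (simp only: matrix_vector_mul_assoc matrix_mul_assoc)
  then show ?thesis by (metis matrix_eq vector_eq_ldot)
qed

text \<open>Applied with the frame matrix as \<open>X\<close>, the metric of a chart as
  \<open>M\<close> and the metric at the unit as \<open>N\<close>: it expresses the inverse metric
  through a constant matrix and the frame.\<close>

lemma matrix_inv_pullback:
  fixes X M N :: "real^'n^'n"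
  assumes eq: "transpose X ** M ** X = N" and N: "det N \<noteq> 0"
  shows "matrix_inv M = X ** matrix_inv N ** transpose X" and "det M \<noteq> 0"
proof -
  have d: "det X * det M * det X = det N" unfolding eq[symmetric] by (simp add: det_mul)
  then show "det M \<noteq> 0" using N by auto
  have dX: "det X \<noteq> 0" "det (transpose X) \<noteq> 0" using d N by auto
  then obtain Y where Y: "Y ** transpose X = mat 1"
    using invertible_det_nz invertible_left_inverse by blast
  obtain I where I: "N ** I = mat 1" using N invertible_det_nz invertible_right_inverse by blast
  have inv: "matrix_inv N = I" by (rule matrix_inv_eqI[OF I])
  have "M ** (X ** I ** transpose X) = (Y ** transpose X) ** M ** (X ** I ** transpose X)" by (simp add: Y)
  also have "\<dots> = Y ** (transpose X ** M ** X) ** I ** transpose X" by (simp only: matrix_mul_assoc)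
  also have "\<dots> = Y ** (N ** I) ** transpose X" by (simp only: eq matrix_mul_assoc)
  also have "\<dots> = mat 1" by (simp add: I Y)
  finally show "matrix_inv M = X ** matrix_inv N ** transpose X" unfolding inv by (rule matrix_inv_eqI)
qed

text \<open>Jacobi's formula at the identity. A nontrivial permutation moves at least two indices,
  so after one factor of its product has been differentiated another off-diagonal factor, equal to
  0, remains.\<close>

lemma det_has_derivative_at_identity:
  fixes J :: "real \<Rightarrow> real^'n^'n"
  assumes J: "\<And>i j. ((\<lambda>t. J t $ i $ j) has_real_derivative J' i j) (at t0)" and one: "J t0 = mat 1"
  shows "((\<lambda>t. det (J t)) has_real_derivative (\<Sum>i\<in>UNIV. J' i i)) (at t0)"
proof -
  let ?P = "{p. p permutes (UNIV :: 'n set)}"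
  let ?T = "\<lambda>p. of_int (sign p) * (\<Sum>i\<in>UNIV. J' i (p i) * (\<Prod>j\<in>UNIV - {i}. J t0 $ j $ p j))"
  have fin: "finite ?P" by (rule finite_permutations) simp
  have "((\<lambda>t. \<Sum>p\<in>?P. of_int (sign p) * (\<Prod>i\<in>UNIV. J t $ i $ p i)) has_real_derivative (\<Sum>p\<in>?P. ?T p)) (at t0)"
    by (intro DERIV_sum DERIV_cmult has_field_derivative_prod J)
  moreover have "(\<Sum>p\<in>?P. ?T p) = (\<Sum>p\<in>{id}. ?T p)"
  proof (rule sum.mono_neutral_right[OF fin])
    show "{id} \<subseteq> ?P" by (simp add: permutes_id)
    show "\<forall>p\<in>?P - {id}. ?T p = 0"
    proof
      fix p assume p: "p \<in> ?P - {id}"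
      have inj: "inj p" using p permutes_inj by blast
      obtain k where k: "p k \<noteq> k" using p by (auto simp: fun_eq_iff)
      have "(\<Prod>j\<in>UNIV - {i}. J t0 $ j $ p j) = 0" for i
      proof -
        have "\<exists>j. j \<noteq> i \<and> p j \<noteq> j"
        proof (cases "k = i")
          case True
          then have "p (p k) \<noteq> p k" using k inj by (auto dest: injD)
          then show ?thesis using k True by blast
        qed (use k in blast)
        then obtain j where "j \<noteq> i" "p j \<noteq> j" by blast
        then show ?thesis by (intro prod_zero) (auto simp: one mat_def intro!: bexI[of _ j])
      qed
      then show "?T p = 0" by (simp only: mult_zero_right sum.neutral_const)
    qed
  qed
  moreover have "?T id = (\<Sum>i\<in>UNIV. J' i i)" by (simp add: one mat_def sign_id)
  ultimately show ?thesis by (simp add: det_def)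
qed

lemma smooth_on_prod:
  fixes f :: "'i \<Rightarrow> 'a::euclidean_space \<Rightarrow> real"
  assumes "open S" "\<And>i. i \<in> I \<Longrightarrow> smooth_on S (f i)"
  shows "smooth_on S (\<lambda>x. \<Prod>i\<in>I. f i x)"
  using assms(2)
proof (induction I rule: infinite_finite_induct)
  case (insert i I)
  then have "smooth_on S (\<lambda>x. f i x * (\<Prod>i\<in>I. f i x))" by (intro smooth_on_mult assms(1)) auto
  with insert show ?case by simp
qed (simp_all add: smooth_on_const)

lemma smooth_on_det:
  fixes M :: "'a::euclidean_space \<Rightarrow> real^'n^'n"
  assumes "open S" "\<And>i j. smooth_on S (\<lambda>x. M x $ i $ j)"
  shows "smooth_on S (\<lambda>x. det (M x))"
  unfolding det_def using assms by (intro smooth_on_sum smooth_on_mult smooth_on_const smooth_on_prod)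

text \<open>The real square root is continued to negative numbers as an odd function and is
  differentiable off 0; hence nonvanishing of the determinant of the metric is enough in what
  follows.\<close>

lemma sqrt_differentiable:
  assumes "(f has_derivative f') (at x)" "f x \<noteq> (0::real)"
  shows "(\<lambda>y. sqrt (f y)) differentiable (at x)"
proof -
  have "\<exists>D. DERIV sqrt (f x) :> D"
    using DERIV_real_sqrt_generic[OF assms(2)] by (metis assms(2) less_asym linorder_neqE_linordered_idom)
  then obtain D where "(sqrt has_derivative (*) D) (at (f x))" by (auto simp: has_field_derivative_def)
  from has_derivative_compose[OF assms(1) this] show ?thesis unfolding differentiable_def by blast
qed

lemma partial_deriv_eqI: "(f has_derivative f') (at x) \<Longrightarrow> partial_deriv i f x = f' (axis i 1)"
  by (simp add: partial_deriv_def frechet_derivative_eqI)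

lemma partial_deriv_cong:
  assumes "open S" "x \<in> S" "\<And>y. y \<in> S \<Longrightarrow> f y = g y" "g differentiable (at x)"
  shows "partial_deriv i f x = partial_deriv i g x"
proof -
  have "(f has_derivative frechet_derivative g (at x)) (at x)"
    by (rule has_derivative_transform_within_open[of g _ x UNIV S])
      (use assms in \<open>auto simp: frechet_derivative_works\<close>)
  then show ?thesis by (simp add: partial_deriv_def frechet_derivative_eqI)
qed

lemma linear_axis_expansion:
  assumes "bounded_linear (D :: real^'n \<Rightarrow> 'b::real_normed_vector)"
  shows "D v = (\<Sum>i\<in>UNIV. v $ i *\<^sub>R D (axis i 1))"
proof -
  interpret bounded_linear D by fact
  have "v = (\<Sum>i\<in>UNIV. v $ i *\<^sub>R axis i 1)" by (simp add: basis_expansion scalar_mult_eq_scaleR[symmetric])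
  then have "D v = D (\<Sum>i\<in>UNIV. v $ i *\<^sub>R axis i 1)" by metis
  then show ?thesis by (simp add: sum scaleR)
qed

lemma matrix_apply:
  fixes f :: "real^'n \<Rightarrow> real^'n"
  assumes "bounded_linear f"
  shows "matrix f *v v = f v"
proof -
  have "(matrix f *v v) $ k = (\<Sum>i\<in>UNIV. v $ i *\<^sub>R f (axis i 1)) $ k" for k
    by (simp add: matrix_vector_mult_def matrix_def mult.commute)
  then show ?thesis unfolding linear_axis_expansion[OF assms, of v, symmetric] by (simp add: vec_eq_iff)
qed

section \<open>The metric in the left-invariant frame\<close>

context bi_invariant_lie_group
begin

definition frame_mat :: "('g, 'n) chart \<Rightarrow> real^'n \<Rightarrow> real^'n^'n" where
  "frame_mat c y = matrix (frame c (param c y))"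

lemma frame_mat_nth: "frame_mat c y $ k $ i = frame c (param c y) (axis i 1) $ k"
  by (simp add: frame_mat_def matrix_def)

lemma frame_mat_mult:
  assumes "c \<in> A" "y \<in> coord_range c"
  shows "frame_mat c y *v v = frame c (param c y) v"
  unfolding frame_mat_def
  by (rule matrix_apply[OF linear_frame[OF assms(1) param_in[OF assms]]])

abbreviation metric_mat :: "('g, 'n) chart \<Rightarrow> real^'n \<Rightarrow> real^'n^'n" where
  "metric_mat c y \<equiv> metric_coeffs A \<rho> c y"

lemma smooth_on_frame_mat: "c \<in> A \<Longrightarrow> smooth_on (coord_range c) (\<lambda>y. frame_mat c y $ k $ i)"
  unfolding frame_mat_nth by (intro smooth_on_vec_nth open_coord_range smooth_on_frame)

lemma frame_mat_metric:
  assumes "c \<in> A" "y \<in> coord_range c"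
  shows "transpose (frame_mat c y) ** metric_mat c y ** frame_mat c y = unit_metric"
  by (rule matrix_pullback)
    (use frame_metric[OF assms(1) param_in[OF assms]] in \<open>simp add: frame_mat_mult[OF assms] coord_param[OF assms]\<close>)

lemma det_unit_metric: "det unit_metric \<noteq> 0"
proof -
  have "inj ((*v) unit_metric)"
  proof (rule linear_injective_0[THEN iffD2])
    show "\<forall>u. unit_metric *v u = 0 \<longrightarrow> u = 0"
    proof (intro allI impI)
      fix u assume "unit_metric *v u = 0"
      then show "u = 0" using metric_at_pos[OF unit_chart, of u] by (cases "u = 0") auto
    qed
  qed simp
  then show ?thesis
    using matrix_left_invertible_injective[of unit_metric] invertible_left_inverse invertible_det_nz by metis
qed

abbreviation inverse_metric :: "real^'n^'n" where
  "inverse_metric \<equiv> matrix_inv unit_metric"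

lemma matrix_inv_metric:
  assumes "c \<in> A" "y \<in> coord_range c"
  shows "matrix_inv (metric_mat c y) = frame_mat c y ** inverse_metric ** transpose (frame_mat c y)"
    and "det (metric_mat c y) \<noteq> 0"
  using matrix_inv_pullback[OF frame_mat_metric[OF assms] det_unit_metric] by blast+

definition volume_density :: "('g, 'n) chart \<Rightarrow> real^'n \<Rightarrow> real" where
  "volume_density c y = sqrt (det (metric_mat c y))"

lemma volume_density_nonzero: "c \<in> A \<Longrightarrow> y \<in> coord_range c \<Longrightarrow> volume_density c y \<noteq> 0"
  using matrix_inv_metric(2) by (simp add: volume_density_def)

lemma volume_density_differentiable:
  assumes "c \<in> A" "y \<in> coord_range c"
  shows "volume_density c differentiable (at y)"
proof -
  have "smooth_on (coord_range c) (\<lambda>y. det (metric_mat c y))"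
    using metric assms(1) unfolding riemannian_metric_def by (intro smooth_on_det open_coord_range) blast+
  from sqrt_differentiable[OF smooth_on_has_derivative[OF this assms(2)] matrix_inv_metric(2)[OF assms]]
  show ?thesis by (simp add: volume_density_def[abs_def])
qed

text \<open>Left-invariant fields are divergence free: their flows are right translations, which are
  isometries, so the Jacobian determinant times the volume density is constant along the flow.\<close>

lemma frame_divergence_free:
  assumes c: "c \<in> A" and y: "y \<in> coord_range c"
  shows "(\<Sum>k\<in>UNIV. partial_deriv k (\<lambda>y. volume_density c y * frame_mat c y $ k $ i) y) = 0"
proof -
  let ?u = unit_chart and ?z = unit_coord
  let ?F = "\<lambda>(y, z). snd c (param c y \<otimes> param ?u z)"
  let ?O = "{(y, z). y \<in> coord_range c \<and> z \<in> coord_range ?u \<and> param c y \<otimes> param ?u z \<in> fst c}"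
  let ?e = "axis i 1 :: real^'n"
  let ?D = "\<lambda>q. frechet_derivative ?F (at q)"
  have O: "open ?O" by (rule open_mult_domain[OF c unit_chart(1) open_chart_domain[OF c]])
  have F: "smooth_on ?O ?F" by (rule mult_smooth[OF c unit_chart(1) c])
  have pz: "param ?u ?z = \<one>" using near_unit_unit_coord by (simp add: near_unit_def)
  have yO: "(y', ?z) \<in> ?O" if "y' \<in> coord_range c" for y'
    using that unit_coord_in param_in[OF c that] by (simp add: pz)
  have Fd: "(?F has_derivative ?D q) (at q)" if "q \<in> ?O" for q
    by (rule smooth_on_has_derivative[OF F that])
  have line: "((\<lambda>t. (y, ?z + t *\<^sub>R ?e)) has_derivative (\<lambda>h. h *\<^sub>R (0, ?e))) (at t)" for t
    by (auto intro!: derivative_eq_intros)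
  have contl: "continuous_on UNIV (\<lambda>t. (y, ?z + t *\<^sub>R ?e))" by (intro continuous_intros)
  let ?T = "(\<lambda>t. (y, ?z + t *\<^sub>R ?e)) -` ?O"
  have T: "open ?T" "0 \<in> ?T" using open_vimage[OF O contl] yO[OF y] by auto
  \<comment> \<open>A coordinate line through the unit serves in place of a one-parameter subgroup,
    since only its velocity \<open>?e\<close> at \<open>t = 0\<close> enters. \<open>J t\<close> is
    the Jacobian matrix at \<open>y\<close> of the right translation by its point.\<close>
  define \<Phi> where "\<Phi> t = ?F (y, ?z + t *\<^sub>R ?e)" for t
  define J where "J t = matrix (\<lambda>v. ?D (y, ?z + t *\<^sub>R ?e) (v, 0))" for t
  have J_nth: "J t $ k $ l = ?D (y, ?z + t *\<^sub>R ?e) (axis l 1, 0) $ k" for t k l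
    by (simp add: J_def matrix_def)
  have right: "J t *v v = chart_deriv (\<lambda>q. q \<otimes> near_unit (?z + t *\<^sub>R ?e)) c c (param c y) v"
    and in_c: "param c y \<otimes> near_unit (?z + t *\<^sub>R ?e) \<in> fst c"
    if t: "t \<in> ?T" for t v
  proof -
    let ?g = "near_unit (?z + t *\<^sub>R ?e)"
    have q: "(y, ?z + t *\<^sub>R ?e) \<in> ?O" using t by simp
    show in_c: "param c y \<otimes> ?g \<in> fst c" using q by (simp add: near_unit_def)
    have "((\<lambda>y. (y, ?z + t *\<^sub>R ?e)) has_derivative (\<lambda>v. (v, 0))) (at y)"
      by (auto intro!: derivative_eq_intros)
    from has_derivative_compose[OF this Fd[OF q]]
    have 1: "((\<lambda>y. snd c (param c y \<otimes> ?g)) has_derivative (\<lambda>v. ?D (y, ?z + t *\<^sub>R ?e) (v, 0))) (at y)"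
      by (simp add: near_unit_def)
    have 2: "((\<lambda>y. snd c (param c y \<otimes> ?g)) has_derivative chart_deriv (\<lambda>q. q \<otimes> ?g) c c (param c y)) (at y)"
      using chart_deriv_has_derivative[OF smooth_map_right c param_in[OF c y] c in_c] by (simp add: coord_param[OF c y])
    have "J t *v v = ?D (y, ?z + t *\<^sub>R ?e) (v, 0)"
      unfolding J_def by (rule matrix_apply[OF has_derivative_bounded_linear[OF 1]])
    then show "J t *v v = chart_deriv (\<lambda>q. q \<otimes> ?g) c c (param c y) v"
      using has_derivative_unique[OF 1 2] by metis
  qed
  \<comment> \<open>The isometry pulls the metric back to itself, so the metric determinants differ
    by the square of \<open>det (J t)\<close>. Its root leaves an absolute value, which disappears
    near \<open>t = 0\<close> because \<open>J 0 = mat 1\<close>.\<close>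
  have const: "\<bar>det (J t)\<bar> * volume_density c (\<Phi> t) = volume_density c y" if t: "t \<in> ?T" for t
  proof -
    have \<Phi>: "\<Phi> t = snd c (param c y \<otimes> near_unit (?z + t *\<^sub>R ?e))" by (simp add: \<Phi>_def near_unit_def)
    have "transpose (J t) ** metric_mat c (\<Phi> t) ** J t = metric_mat c y"
      by (rule matrix_pullback)
        (use isometric_metric[OF isometric_right c param_in[OF c y] c in_c[OF t]] in
          \<open>simp add: right[OF t] \<Phi> coord_param[OF c y]\<close>)
    then have "det (J t) * det (metric_mat c (\<Phi> t)) * det (J t) = det (metric_mat c y)"
      by (metis det_mul det_transpose)
    then have "(det (J t))\<^sup>2 * det (metric_mat c (\<Phi> t)) = det (metric_mat c y)"
      by (simp add: power2_eq_square mult_ac)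
    then have "sqrt ((det (J t))\<^sup>2 * det (metric_mat c (\<Phi> t))) = volume_density c y" by (simp add: volume_density_def)
    then show ?thesis by (simp add: real_sqrt_mult volume_density_def)
  qed
  have F_nth: "smooth_on ?O (\<lambda>q. ?F q $ k)" for k by (rule smooth_on_vec_nth[OF O F])
  have D_nth: "frechet_derivative (\<lambda>q. ?F q $ k) (at q) v = ?D q v $ k" if "q \<in> ?O" for q v k
  proof -
    have "((\<lambda>q. ?F q $ k) has_derivative (\<lambda>v. ?D q v $ k)) (at q)"
      by (rule bounded_linear.has_derivative[OF bounded_linear_vec_nth Fd[OF that]])
    then show ?thesis using frechet_derivative_eqI by metis
  qed
  define X' where "X' k v = frechet_derivative (\<lambda>y. frame_mat c y $ k $ i) (at y) v" for k v
  have X': "((\<lambda>y. frame_mat c y $ k $ i) has_derivative X' k) (at y)" for k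
    using smooth_on_has_derivative[OF smooth_on_frame_mat[OF c] y] unfolding X'_def .
  \<comment> \<open>The \<open>t\<close>-derivative of the Jacobian is a mixed derivative of the
    multiplication; in the other order it is the derivative in \<open>y\<close> of the frame
    component.\<close>
  have J': "((\<lambda>t. J t $ k $ l) has_real_derivative X' k (axis l 1)) (at 0)" for k l
  proof -
    let ?f = "\<lambda>q. ?F q $ k"
    let ?Dl = "\<lambda>q. frechet_derivative ?f (at q) (axis l 1, 0)"
    let ?De = "\<lambda>q. frechet_derivative ?f (at q) (0, ?e)"
    have dl: "(?Dl has_derivative frechet_derivative ?Dl (at q)) (at q)"
      and de: "(?De has_derivative frechet_derivative ?De (at q)) (at q)" if "q \<in> ?O" for q
      by (intro smooth_on_has_derivative[OF smooth_on_frechet[OF F_nth] that])+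
    have "(?Dl has_derivative frechet_derivative ?Dl (at (y, ?z))) (at (y, ?z + 0 *\<^sub>R ?e))"
      using dl[OF yO[OF y]] by simp
    from has_derivative_compose[OF line this]
    have "((\<lambda>t. ?Dl (y, ?z + t *\<^sub>R ?e)) has_derivative (\<lambda>h. frechet_derivative ?Dl (at (y, ?z)) (h *\<^sub>R (0, ?e)))) (at 0)" .
    then have "((\<lambda>t. J t $ k $ l) has_derivative (\<lambda>h. frechet_derivative ?Dl (at (y, ?z)) (h *\<^sub>R (0, ?e)))) (at 0)"
      by (rule has_derivative_transform_within_open[OF _ T]) (simp add: J_nth D_nth)
    moreover have "frechet_derivative ?Dl (at (y, ?z)) (h *\<^sub>R (0, ?e)) = X' k (axis l 1) * h" for h
    proof -
      interpret bounded_linear "frechet_derivative ?Dl (at (y, ?z))"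
        using dl[OF yO[OF y]] by (rule has_derivative_bounded_linear)
      have "frechet_derivative ?Dl (at (y, ?z)) (0, ?e) = frechet_derivative ?De (at (y, ?z)) (axis l 1, 0)"
        by (rule mixed_derivatives_commute[OF smooth_onD[OF F_nth] O yO[OF y]])
      also have "\<dots> = X' k (axis l 1)"
      proof -
        have "((\<lambda>y. (y, ?z)) has_derivative (\<lambda>v. (v, 0))) (at y)" by (auto intro!: derivative_eq_intros)
        from has_derivative_compose[OF this de[OF yO[OF y]]]
        have "((\<lambda>y. ?De (y, ?z)) has_derivative (\<lambda>v. frechet_derivative ?De (at (y, ?z)) (v, 0))) (at y)" .
        then have "((\<lambda>y. frame_mat c y $ k $ i) has_derivative (\<lambda>v. frechet_derivative ?De (at (y, ?z)) (v, 0))) (at y)"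
          by (rule has_derivative_transform_within_open[OF _ open_coord_range[OF c] y])
            (simp add: frame_mat_nth frame_eq_partial[OF c] D_nth[OF yO])
        from has_derivative_unique[OF this X'] show ?thesis by metis
      qed
      finally show ?thesis by (simp only: scaleR real_scaleR_def mult.commute)
    qed
    ultimately show ?thesis by (simp add: has_field_derivative_def)
  qed
  have J0: "J 0 = mat 1"
  proof -
    have "J 0 *v v = v" for v
    proof -
      have 1: "((\<lambda>y. snd c (param c y \<otimes> \<one>)) has_derivative chart_deriv (\<lambda>q. q \<otimes> \<one>) c c (param c y)) (at y)"
        using chart_deriv_has_derivative[OF smooth_map_right c param_in[OF c y] c, of \<one>] param_in[OF c y]
        by (simp add: coord_param[OF c y])
      have 2: "((\<lambda>y. snd c (param c y \<otimes> \<one>)) has_derivative (\<lambda>v. v)) (at y)"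
        by (rule has_derivative_transform_within_open[OF has_derivative_ident open_coord_range[OF c] y])
          (simp add: coord_param[OF c])
      have "J 0 *v v = chart_deriv (\<lambda>q. q \<otimes> \<one>) c c (param c y) v" using right[OF T(2), of v] by simp
      then show ?thesis using fun_cong[OF has_derivative_unique[OF 1 2], of v] by (simp only:)
    qed
    then show ?thesis by (metis matrix_eq matrix_vector_mul_lid)
  qed
  note detJ = det_has_derivative_at_identity[OF J' J0]
  define s' where "s' = frechet_derivative (volume_density c) (at y)"
  have s': "(volume_density c has_derivative s') (at y)"
    using volume_density_differentiable[OF c y] unfolding s'_def frechet_derivative_works .
  have \<Phi>0: "\<Phi> 0 = y" using y by (simp add: \<Phi>_def pz coord_param[OF c y])
  have frame_y: "?D (y, ?z) (0, ?e) = frame c (param c y) ?e" by (rule frame_eq_partial[OF c y, symmetric])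
  have "(?F has_derivative ?D (y, ?z)) (at (y, ?z + 0 *\<^sub>R ?e))" using Fd[OF yO[OF y]] by simp
  from has_derivative_compose[OF line this]
  have \<Phi>': "(\<Phi> has_derivative (\<lambda>h. ?D (y, ?z) (h *\<^sub>R (0, ?e)))) (at 0)" unfolding \<Phi>_def[abs_def] .
  have "((\<lambda>t. volume_density c (\<Phi> t)) has_derivative (\<lambda>h. s' (?D (y, ?z) (h *\<^sub>R (0, ?e))))) (at 0)"
    by (rule has_derivative_compose[OF \<Phi>']) (simp add: \<Phi>0 s')
  moreover have "s' (?D (y, ?z) (h *\<^sub>R (0, ?e))) = s' (frame c (param c y) ?e) * h" for h
  proof -
    interpret D: bounded_linear "?D (y, ?z)" using Fd[OF yO[OF y]] by (rule has_derivative_bounded_linear)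
    interpret s: bounded_linear s' using s' by (rule has_derivative_bounded_linear)
    show ?thesis by (simp only: D.scaleR s.scaleR frame_y real_scaleR_def mult.commute)
  qed
  ultimately have s\<Phi>: "((\<lambda>t. volume_density c (\<Phi> t)) has_real_derivative s' (frame c (param c y) ?e)) (at 0)"
    by (simp add: has_field_derivative_def)
  \<comment> \<open>The derivative at 0 of a function that is constant near 0. By the product rule
    it is the divergence sum: the trace of the derivative of the frame times the density, plus the
    derivative of the density along the frame.\<close>
  have prod: "((\<lambda>t. det (J t) * volume_density c (\<Phi> t)) has_real_derivative
      (\<Sum>k\<in>UNIV. X' k (axis k 1)) * volume_density c y + s' (frame c (param c y) ?e) * 1) (at 0)"
    using DERIV_mult[OF detJ s\<Phi>] by (simp add: \<Phi>0 J0)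
  have "isCont (\<lambda>t. det (J t)) 0" using detJ by (rule DERIV_isCont)
  then have "eventually (\<lambda>t. 0 < det (J t)) (at 0)"
    by (intro order_tendstoD(1)[of "\<lambda>t. det (J t)" 1]) (auto simp: isCont_def J0)
  then have "eventually (\<lambda>t. 0 < det (J t)) (nhds 0)" by (simp add: eventually_nhds_conv_at J0)
  moreover have "eventually (\<lambda>t. t \<in> ?T) (nhds 0)" using T by (rule eventually_nhds_in_open)
  ultimately have "eventually (\<lambda>t. det (J t) * volume_density c (\<Phi> t) = volume_density c y) (nhds 0)"
  proof eventually_elim
    case (elim t)
    then show ?case using const[of t] by simp
  qed
  then have "((\<lambda>t. det (J t) * volume_density c (\<Phi> t)) has_real_derivative 0) (at 0)"
    using DERIV_cong_ev[of 0 0 "\<lambda>t. det (J t) * volume_density c (\<Phi> t)" "\<lambda>t. volume_density c y" 0 0] by simp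
  from DERIV_unique[OF this prod]
  have zero: "(\<Sum>k\<in>UNIV. X' k (axis k 1)) * volume_density c y + s' (frame c (param c y) ?e) = 0" by simp
  have "partial_deriv k (\<lambda>y. volume_density c y * frame_mat c y $ k $ i) y
      = volume_density c y * X' k (axis k 1) + s' (axis k 1) * frame_mat c y $ k $ i" for k
    by (rule partial_deriv_eqI) (rule has_derivative_mult[OF s' X'])
  then have "(\<Sum>k\<in>UNIV. partial_deriv k (\<lambda>y. volume_density c y * frame_mat c y $ k $ i) y)
      = (\<Sum>k\<in>UNIV. X' k (axis k 1)) * volume_density c y + (\<Sum>k\<in>UNIV. frame_mat c y $ k $ i * s' (axis k 1))"
    by (simp add: sum.distrib sum_distrib_right sum_distrib_left mult.commute)
  also have "(\<Sum>k\<in>UNIV. frame_mat c y $ k $ i * s' (axis k 1)) = s' (frame c (param c y) ?e)"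
    unfolding linear_axis_expansion[OF has_derivative_bounded_linear[OF s'], of "frame c (param c y) ?e"]
    by (simp add: frame_mat_nth)
  finally show ?thesis using zero by simp
qed

end

section \<open>Symmetric operators with a single eigenvalue\<close>

text \<open>The Rayleigh quotient attains its maximum on the unit sphere of the type class norm,
  though it is formed with \<open>B\<close>; a maximum point is an eigenvector.\<close>

lemma symmetric_operator_max_eigenvalue:
  fixes B :: "'v::euclidean_space \<Rightarrow> 'v \<Rightarrow> real"
  assumes B: "bilinear B" and sym: "\<And>x y. B x y = B y x" and pos: "\<And>x. x \<noteq> 0 \<Longrightarrow> B x x > 0"
    and C: "linear C" and C_sym: "\<And>x y. B (C x) y = B x (C y)"
  obtains \<mu> v where "v \<noteq> 0" "C v = \<mu> *\<^sub>R v" "\<And>x. B (C x) x \<le> \<mu> * B x x"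
proof -
  have bb: "bounded_bilinear B" by (rule bilinear_conv_bounded_bilinear[THEN iffD1, OF B])
  interpret B: bounded_bilinear B by (rule bb)
  interpret C: linear C by (rule C)
  let ?S = "sphere (0::'v) 1"
  let ?f = "\<lambda>x. B (C x) x / B x x"
  obtain e :: 'v where "e \<in> Basis" using nonempty_Basis by blast
  then have ne: "?S \<noteq> {}" by (auto intro!: exI[of _ e])
  have nz: "B x x \<noteq> 0" if "x \<in> ?S" for x using pos[of x] that by (cases "x = 0") auto
  have "continuous_on ?S ?f"
    using nz by (intro continuous_on_divide B.continuous_on linear_continuous_on continuous_on_id)
      (auto simp: linear_conv_bounded_linear[symmetric] C)
  from continuous_attains_sup[OF compact_sphere ne this]
  obtain v where v: "v \<in> ?S" "\<And>x. x \<in> ?S \<Longrightarrow> ?f x \<le> ?f v" by blast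
  define \<mu> where "\<mu> = ?f v"
  have v0: "v \<noteq> 0" using v(1) by auto
  have le: "B (C x) x \<le> \<mu> * B x x" for x
  proof (cases "x = 0")
    case False
    define y where "y = (1 / norm x) *\<^sub>R x"
    have y: "y \<in> ?S" "x = norm x *\<^sub>R y" using False by (auto simp: y_def)
    have "B (C y) y \<le> \<mu> * B y y" using v(2)[OF y(1)] pos[of y] nz[OF y(1)] y(1)
      by (cases "y = 0") (auto simp: \<mu>_def field_simps)
    then have "(norm x)\<^sup>2 * B (C y) y \<le> (norm x)\<^sup>2 * (\<mu> * B y y)" by (intro mult_left_mono) auto
    moreover have "B (C x) x = (norm x)\<^sup>2 * B (C y) y" "B x x = (norm x)\<^sup>2 * B y y"
      by (subst (1 2) y(2), simp add: C.scaleR B.scaleR_left B.scaleR_right power2_eq_square)+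
    ultimately show ?thesis by (simp add: mult_ac)
  qed (simp add: B.zero_left B.zero_right)
  define w where "w = \<mu> *\<^sub>R v - C v"
  let ?P = "\<lambda>x. \<mu> * B x x - B (C x) x"
  have Pv: "?P v = 0" using nz[OF v(1)] by (simp add: \<mu>_def)
  have P: "0 \<le> ?P x" for x using le[of x] by simp
  \<comment> \<open>First variation of the nonnegative form \<open>?P\<close>, which vanishes at
    \<open>v\<close>, in the direction \<open>w\<close>: for small \<open>t\<close> the linear term
    would prevail unless \<open>B w w = 0\<close>.\<close>
  have small: "2 * B w w \<le> t * ?P w" if t: "t > 0" for t
  proof -
    have "?P (v - t *\<^sub>R w) = ?P v - t * (2 * (\<mu> * B v w - B (C v) w)) + t * t * ?P w"
      by (simp add: C.diff C.scaleR B.diff_left B.diff_right B.scaleR_left B.scaleR_right sym[of w v]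
          C_sym[of w v] sym[of w "C v"] algebra_simps)
    also have "\<mu> * B v w - B (C v) w = B w w" by (simp add: w_def B.diff_left B.scaleR_left)
    finally have "0 \<le> t * (t * ?P w - 2 * B w w)" using P[of "v - t *\<^sub>R w"] Pv by (simp add: algebra_simps)
    then show ?thesis using t by (simp add: zero_le_mult_iff)
  qed
  have "w = 0"
  proof (rule ccontr)
    assume "w \<noteq> 0"
    then have Bw: "B w w > 0" by (rule pos)
    \<comment> \<open>Makes \<open>t * ?P w \<le> B w w\<close>; the summand 1 allows for
      \<open>?P w = 0\<close>.\<close>
    define t where "t = B w w / (?P w + 1)"
    have "t > 0" using Bw P[of w] by (simp add: t_def)
    moreover have "t * ?P w \<le> B w w" using Bw P[of w] by (simp add: t_def divide_le_eq mult_left_mono)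
    ultimately show False using small[of t] Bw by linarith
  qed
  then have "C v = \<mu> *\<^sub>R v" by (simp add: w_def)
  then show thesis using that v0 le by blast
qed

text \<open>The maximal eigenvalues of \<open>C\<close> and \<open>- C\<close> are \<open>l\<close>
  and \<open>- l\<close>, so the quadratic forms of \<open>C\<close> and of \<open>l\<close> times
  the identity coincide, and polarisation identifies the operators. No diagonalisation
  enters.\<close>

lemma symmetric_operator_single_eigenvalue:
  fixes B :: "'v::euclidean_space \<Rightarrow> 'v \<Rightarrow> real"
  assumes B: "bilinear B" and sym: "\<And>x y. B x y = B y x" and pos: "\<And>x. x \<noteq> 0 \<Longrightarrow> B x x > 0"
    and C: "linear C" and C_sym: "\<And>x y. B (C x) y = B x (C y)"
    and eig: "\<And>\<mu> x. x \<noteq> 0 \<Longrightarrow> C x = \<mu> *\<^sub>R x \<Longrightarrow> \<mu> = l"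
  shows "C x = l *\<^sub>R x"
proof -
  have bb: "bounded_bilinear B" by (rule bilinear_conv_bounded_bilinear[THEN iffD1, OF B])
  interpret B: bounded_bilinear B by (rule bb)
  interpret C: linear C by (rule C)
  have upper: "B (C x) x \<le> l * B x x" for x
    using symmetric_operator_max_eigenvalue[OF B sym pos C C_sym] eig by metis
  have "linear (\<lambda>x. - C x)" using C by (rule linear_compose_neg)
  moreover have "B (- C x) y = B x (- C y)" for x y by (simp add: B.minus_left B.minus_right C_sym)
  ultimately obtain \<mu> v where v: "v \<noteq> 0" "- C v = \<mu> *\<^sub>R v" "\<And>x. B (- C x) x \<le> \<mu> * B x x"
    using symmetric_operator_max_eigenvalue[OF B sym pos, of "\<lambda>x. - C x"] by metis
  have "C v = (- \<mu>) *\<^sub>R v" using v(2) by (metis minus_minus scaleR_minus_left)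
  then have "\<mu> = - l" using eig[OF v(1)] by fastforce
  then have lower: "l * B x x \<le> B (C x) x" for x using v(3)[of x] by (simp add: B.minus_left)
  let ?D = "\<lambda>x. C x - l *\<^sub>R x"
  have zero: "B (?D x) x = 0" for x using upper[of x] lower[of x] by (simp add: B.diff_left B.scaleR_left)
  have D_sym: "B (?D x) y = B (?D y) x" for x y
    using C_sym[of x y] by (simp add: B.diff_left B.diff_right B.scaleR_left B.scaleR_right sym[of x "C y"] sym[of x y])
  have "B (?D (x + y)) (x + y) = B (?D x) x + B (?D y) y + 2 * B (?D x) y" for x y
  proof -
    have "?D (x + y) = ?D x + ?D y" by (simp add: C.add algebra_simps)
    then show ?thesis by (simp only: B.add_left B.add_right D_sym[of y x])
  qed
  then have "B (?D x) y = 0" for x y using zero[of "x + y"] zero[of x] zero[of y] by simp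
  from this[of x "?D x"] have "?D x = 0" using pos[of "?D x"] by (cases "?D x = 0") auto
  then show ?thesis by simp
qed

section \<open>The Casimir operator and the Laplacian\<close>

context bi_invariant_lie_group
begin

lemma inverse_metric_right: "unit_metric ** inverse_metric = mat 1"
proof -
  obtain I where I: "unit_metric ** I = mat 1" using det_unit_metric invertible_det_nz invertible_right_inverse by blast
  then show ?thesis using matrix_inv_eqI[OF I] by simp
qed

lemma inverse_metric_sym: "inverse_metric $ a $ b = inverse_metric $ b $ a"
proof -
  have "transpose unit_metric = unit_metric"
  proof -
    have "v \<bullet> (transpose unit_metric *v w) = v \<bullet> (unit_metric *v w)" for v w
      using inner_transpose[of v unit_metric w] metric_at_sym[OF unit_chart, of v w] by (simp add: inner_commute)
    then show ?thesis by (metis matrix_eq vector_eq_ldot)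
  qed
  moreover have "transpose (inverse_metric ** unit_metric) = mat 1"
  proof -
    have "inverse_metric ** unit_metric = mat 1" using inverse_metric_right matrix_left_right_inverse by blast
    then show ?thesis by (simp only: transpose_mat)
  qed
  ultimately have "unit_metric ** transpose inverse_metric = mat 1" by (simp add: matrix_transpose_mul)
  from matrix_inv_eqI[OF this] have "inverse_metric $ b $ a = transpose inverse_metric $ b $ a" by (simp only:)
  then show ?thesis by (simp only: transpose_def vec_lambda_beta)
qed

lemma inverse_metric_pos:
  assumes "w \<noteq> 0"
  shows "w \<bullet> (inverse_metric *v w) > 0"
proof -
  let ?u = "inverse_metric *v w"
  have w: "unit_metric *v ?u = w" by (simp only: matrix_vector_mul_assoc inverse_metric_right matrix_vector_mul_lid)
  then have "?u \<noteq> 0" using assms by (metis matrix_vector_mult_0_right)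
  from metric_at_pos[OF unit_chart this] show ?thesis unfolding w by (simp only: inner_commute)
qed

text \<open>The coordinate basis at the unit need not be orthonormal, hence the coefficients of the
  inverse metric.\<close>

definition casimir :: "('g \<Rightarrow> ('v::euclidean_space \<Rightarrow>\<^sub>L 'v)) \<Rightarrow> 'v \<Rightarrow> 'v" where
  "casimir R x = (\<Sum>a\<in>UNIV. \<Sum>b\<in>UNIV. inverse_metric $ a $ b *\<^sub>R
     blinfun_apply (rep_deriv R (axis a 1)) (blinfun_apply (rep_deriv R (axis b 1)) x))"

lemma rep_functional_derivative:
  assumes R: "blinfun_rep R" and \<phi>: "bounded_linear \<phi>" and c: "c \<in> A" "y \<in> coord_range c"
  obtains D where "((\<lambda>y. \<phi> (blinfun_apply (R (param c y)) w)) has_derivative D) (at y)"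
    "\<And>v. D (frame c (param c y) v) = \<phi> (blinfun_apply (R (param c y)) (blinfun_apply (rep_deriv R v) w))"
proof -
  obtain D where D: "((\<lambda>y. R (param c y)) has_derivative D) (at (snd c (param c y)))"
    "\<And>v. D (frame c (param c y) v) = R (param c y) o\<^sub>L rep_deriv R v"
    using rep_chart_derivative[OF R c(1) param_in[OF c]] by blast
  have "((\<lambda>y. R (param c y)) has_derivative D) (at y)" using D(1) by (simp add: coord_param[OF c])
  from bounded_linear.has_derivative[OF \<phi> bounded_linear.has_derivative[OF blinfun.bounded_linear_left this]]
  have "((\<lambda>y. \<phi> (blinfun_apply (R (param c y)) w)) has_derivative (\<lambda>v. \<phi> (blinfun_apply (D v) w))) (at y)" .
  then show thesis by (rule that) (simp add: D(2))
qed

lemma sum_product_reorder: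
  fixes X a :: "'n \<Rightarrow> 'n \<Rightarrow> real"
  shows "(\<Sum>j\<in>UNIV. (\<Sum>b\<in>UNIV. (\<Sum>i\<in>UNIV. X k i * a i b) * X j b) * d j)
    = (\<Sum>i\<in>UNIV. X k i * (\<Sum>b\<in>UNIV. a i b * (\<Sum>j\<in>UNIV. X j b * d j)))"
proof -
  have "(\<Sum>j\<in>UNIV. (\<Sum>b\<in>UNIV. (\<Sum>i\<in>UNIV. X k i * a i b) * X j b) * d j)
      = (\<Sum>j\<in>UNIV. \<Sum>b\<in>UNIV. \<Sum>i\<in>UNIV. X k i * a i b * X j b * d j)"
    by (simp only: sum_distrib_right)
  also have "\<dots> = (\<Sum>b\<in>UNIV. \<Sum>j\<in>UNIV. \<Sum>i\<in>UNIV. X k i * a i b * X j b * d j)" by (rule sum.swap)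
  also have "\<dots> = (\<Sum>b\<in>UNIV. \<Sum>i\<in>UNIV. \<Sum>j\<in>UNIV. X k i * a i b * X j b * d j)"
    by (rule sum.cong[OF refl]) (rule sum.swap)
  also have "\<dots> = (\<Sum>i\<in>UNIV. \<Sum>b\<in>UNIV. \<Sum>j\<in>UNIV. X k i * a i b * X j b * d j)" by (rule sum.swap)
  finally show ?thesis by (simp only: sum_distrib_left mult.assoc)
qed

text \<open>In the left-invariant frame the inverse metric has constant coefficients, so the
  gradient has the components \<open>V i\<close>. The product rule for the divergence gives
  derivatives of \<open>V i\<close> along the frame, which yield the Casimir operator, and multiples
  of the divergence of the frame, which vanish.\<close>

lemma chart_laplacian_rep:
  assumes R: "blinfun_rep R" and \<phi>: "bounded_linear \<phi>" and c: "c \<in> A" "y \<in> coord_range c"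
  shows "chart_laplacian A \<rho> c (\<lambda>g. \<phi> (blinfun_apply (R g) x)) y = \<phi> (blinfun_apply (R (param c y)) (casimir R x))"
proof -
  let ?q = "\<lambda>y. param c y"
  let ?E = "\<lambda>i. blinfun_apply (rep_deriv R (axis i 1))"
  let ?X = "\<lambda>y k i. frame_mat c y $ k $ i"
  let ?s = "volume_density c"
  let ?a = "\<lambda>i j. inverse_metric $ i $ j"
  \<comment> \<open>\<open>U b\<close> is the derivative of the matrix element along the
    left-invariant field of the \<open>b\<close>-th basis vector; it is again a matrix element, so
    it can be differentiated in the same way.\<close>
  define U where "U b y = \<phi> (blinfun_apply (R (?q y)) (?E b x))" for b y
  define V where "V i y = (\<Sum>b\<in>UNIV. ?a i b * U b y)" for i y
  have exp: "D (frame c (?q y) (axis i 1)) = (\<Sum>j\<in>UNIV. ?X y j i * D (axis j 1))"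
    if "bounded_linear (D :: real^'n \<Rightarrow> real)" for D y i
    using linear_axis_expansion[OF that, of "frame c (?q y) (axis i 1)"] by (simp add: frame_mat_nth)
  have inner: "sqrt (det (metric_mat c y)) * (\<Sum>j\<in>UNIV. matrix_inv (metric_mat c y) $ k $ j *
      partial_deriv j (\<lambda>z. \<phi> (blinfun_apply (R (?q z)) x)) y) = (\<Sum>i\<in>UNIV. ?s y * ?X y k i * V i y)"
    if y: "y \<in> coord_range c" for k y
  proof -
    obtain D where D: "((\<lambda>y. \<phi> (blinfun_apply (R (?q y)) x)) has_derivative D) (at y)"
      "\<And>v. D (frame c (?q y) v) = \<phi> (blinfun_apply (R (?q y)) (blinfun_apply (rep_deriv R v) x))"
      using rep_functional_derivative[OF R \<phi> c(1) y] by blast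
    have U: "U b y = (\<Sum>j\<in>UNIV. ?X y j b * D (axis j 1))" for b
      unfolding exp[OF has_derivative_bounded_linear[OF D(1)], symmetric] by (simp add: U_def D(2))
    have "matrix_inv (metric_mat c y) $ k $ j = (\<Sum>b\<in>UNIV. (\<Sum>i\<in>UNIV. ?X y k i * ?a i b) * ?X y j b)" for j
      unfolding matrix_inv_metric(1)[OF c(1) y] by (simp add: matrix_matrix_mult_def transpose_def)
    then have "(\<Sum>j\<in>UNIV. matrix_inv (metric_mat c y) $ k $ j * partial_deriv j (\<lambda>z. \<phi> (blinfun_apply (R (?q z)) x)) y)
        = (\<Sum>i\<in>UNIV. ?X y k i * V i y)"
      using sum_product_reorder[of "?X y" k ?a "\<lambda>j. D (axis j 1)"]
      by (simp only: partial_deriv_eqI[OF D(1)] V_def U)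
    then show ?thesis by (simp add: volume_density_def sum_distrib_left mult.assoc)
  qed
  have "\<exists>D. (U b has_derivative D) (at y) \<and>
      (\<forall>v. D (frame c (?q y) v) = \<phi> (blinfun_apply (R (?q y)) (blinfun_apply (rep_deriv R v) (?E b x))))" for b
    using rep_functional_derivative[OF R \<phi> c, of "?E b x"] unfolding U_def by metis
  then obtain DU where DU: "\<And>b. (U b has_derivative DU b) (at y)"
    "\<And>b v. DU b (frame c (?q y) v) = \<phi> (blinfun_apply (R (?q y)) (blinfun_apply (rep_deriv R v) (?E b x)))"
    by metis
  define DV where "DV i v = (\<Sum>b\<in>UNIV. ?a i b * DU b v)" for i v
  have DV: "(V i has_derivative DV i) (at y)" for i
    unfolding V_def[abs_def] DV_def[abs_def] by (intro has_derivative_sum has_derivative_mult_right DU(1))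
  obtain s' where s': "(?s has_derivative s') (at y)"
    using volume_density_differentiable[OF c] by (auto simp: differentiable_def)
  have "\<exists>X'. ((\<lambda>y. ?X y k i) has_derivative X') (at y)" for k i
    using smooth_on_has_derivative[OF smooth_on_frame_mat[OF c(1)] c(2)] by blast
  then obtain X' where X': "\<And>k i. ((\<lambda>y. ?X y k i) has_derivative X' k i) (at y)" by metis
  note dsX = has_derivative_mult[OF s' X']
  have deriv_k: "partial_deriv k (\<lambda>y. sqrt (det (metric_mat c y)) * (\<Sum>j\<in>UNIV. matrix_inv (metric_mat c y) $ k $ j *
      partial_deriv j (\<lambda>z. \<phi> (blinfun_apply (R (?q z)) x)) y)) y
      = (\<Sum>i\<in>UNIV. ?s y * ?X y k i * DV i (axis k 1) + partial_deriv k (\<lambda>y. ?s y * ?X y k i) y * V i y)" for k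
  proof -
    have d: "((\<lambda>y. \<Sum>i\<in>UNIV. ?s y * ?X y k i * V i y) has_derivative
        (\<lambda>v. \<Sum>i\<in>UNIV. ?s y * ?X y k i * DV i v + (?s y * X' k i v + s' v * ?X y k i) * V i y)) (at y)"
      by (intro has_derivative_sum has_derivative_mult dsX DV)
    have "partial_deriv k (\<lambda>y. sqrt (det (metric_mat c y)) * (\<Sum>j\<in>UNIV. matrix_inv (metric_mat c y) $ k $ j *
        partial_deriv j (\<lambda>z. \<phi> (blinfun_apply (R (?q z)) x)) y)) y
        = partial_deriv k (\<lambda>y. \<Sum>i\<in>UNIV. ?s y * ?X y k i * V i y) y"
      by (rule partial_deriv_cong[OF open_coord_range[OF c(1)] c(2) inner]) (use d in \<open>auto simp: differentiable_def\<close>)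
    then show ?thesis unfolding partial_deriv_eqI[OF d] partial_deriv_eqI[OF dsX] .
  qed
  have main: "(\<Sum>k\<in>UNIV. ?X y k i * DV i (axis k 1)) = (\<Sum>b\<in>UNIV. ?a i b * \<phi> (blinfun_apply (R (?q y)) (?E i (?E b x))))" for i
    unfolding exp[OF has_derivative_bounded_linear[OF DV], symmetric] by (simp add: DV_def DU(2))
  have "(\<Sum>k\<in>UNIV. \<Sum>i\<in>UNIV. ?s y * ?X y k i * DV i (axis k 1) + partial_deriv k (\<lambda>y. ?s y * ?X y k i) y * V i y)
      = (\<Sum>i\<in>UNIV. \<Sum>k\<in>UNIV. ?s y * ?X y k i * DV i (axis k 1) + partial_deriv k (\<lambda>y. ?s y * ?X y k i) y * V i y)"
    by (rule sum.swap)
  also have "\<dots> = (\<Sum>i\<in>UNIV. ?s y * (\<Sum>k\<in>UNIV. ?X y k i * DV i (axis k 1))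
      + (\<Sum>k\<in>UNIV. partial_deriv k (\<lambda>y. ?s y * ?X y k i) y) * V i y)"
    by (simp only: sum.distrib sum_distrib_left sum_distrib_right mult.assoc)
  also have "\<dots> = ?s y * (\<Sum>i\<in>UNIV. \<Sum>b\<in>UNIV. ?a i b * \<phi> (blinfun_apply (R (?q y)) (?E i (?E b x))))"
    by (simp only: frame_divergence_free[OF c] main mult_zero_left add_0_right sum_distrib_left)
  finally have eq: "chart_laplacian A \<rho> c (\<lambda>g. \<phi> (blinfun_apply (R g) x)) y
      = (\<Sum>i\<in>UNIV. \<Sum>b\<in>UNIV. ?a i b * \<phi> (blinfun_apply (R (?q y)) (?E i (?E b x))))"
    unfolding chart_laplacian_def deriv_k using volume_density_nonzero[OF c] by (simp add: volume_density_def)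
  interpret \<phi>: bounded_linear \<phi> by (rule \<phi>)
  show ?thesis
    unfolding eq by (simp add: casimir_def blinfun.sum_right blinfun.scaleR_right \<phi>.sum \<phi>.scaleR)
qed

lemma laplace_beltrami_rep:
  assumes R: "blinfun_rep R" and \<phi>: "bounded_linear \<phi>"
  shows "laplace_beltrami A \<rho> (\<lambda>g. \<phi> (blinfun_apply (R g) x)) = (\<lambda>g. \<phi> (blinfun_apply (R g) (casimir R x)))"
proof
  fix p
  define c where "c = (SOME c. c \<in> A \<and> p \<in> fst c)"
  have "\<exists>c. c \<in> A \<and> p \<in> fst c" using chart_exists by metis
  then have "c \<in> A \<and> p \<in> fst c" unfolding c_def by (rule someI_ex)
  then have c: "c \<in> A" "p \<in> fst c" by auto
  show "laplace_beltrami A \<rho> (\<lambda>g. \<phi> (blinfun_apply (R g) x)) p = \<phi> (blinfun_apply (R p) (casimir R x))"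
    unfolding laplace_beltrami_def Let_def c_def[symmetric]
    using chart_laplacian_rep[OF R \<phi> c(1) coord_in[OF c(2)]] by (simp add: param_coord[OF c])
qed

lemma linear_casimir: "linear (casimir R)"
proof (rule linearI)
  show "casimir R (x + y) = casimir R x + casimir R y" for x y
    unfolding casimir_def by (simp only: blinfun.add_right scaleR_add_right sum.distrib)
  show "casimir R (r *\<^sub>R x) = r *\<^sub>R casimir R x" for r x
    unfolding casimir_def
    by (simp add: blinfun.scaleR_right scaleR_sum_right mult.commute)
qed

text \<open>Differentiate the invariance of \<open>B\<close> at the unit.\<close>

lemma rep_deriv_skew:
  assumes R: "blinfun_rep R" and B: "bounded_bilinear B"
    and inv: "\<And>g x y. B (blinfun_apply (R g) x) (blinfun_apply (R g) y) = (B x y :: real)"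
  shows "B (blinfun_apply (rep_deriv R v) x) y = - B x (blinfun_apply (rep_deriv R v) y)"
proof -
  have d: "((\<lambda>z. blinfun_apply (R (near_unit z)) x) has_derivative (\<lambda>v. blinfun_apply (rep_deriv R v) x)) (at unit_coord)" for x
    by (rule bounded_linear.has_derivative[OF blinfun.bounded_linear_left rep_has_derivative[OF R]])
  have "((\<lambda>z. B x y) has_derivative (\<lambda>v. B x (blinfun_apply (rep_deriv R v) y) + B (blinfun_apply (rep_deriv R v) x) y)) (at unit_coord)"
    using bounded_bilinear.FDERIV[OF B d d, of x y] by (simp add: inv rep_one[OF R])
  from has_derivative_unique[OF this has_derivative_const]
  have "B x (blinfun_apply (rep_deriv R v) y) + B (blinfun_apply (rep_deriv R v) x) y = 0" by metis
  then show ?thesis by linarith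
qed

text \<open>Moving two skew factors across \<open>B\<close> gives two signs and reverses their
  order; the symmetry of the inverse metric restores it.\<close>

lemma casimir_sym:
  assumes R: "blinfun_rep R" and B: "bounded_bilinear B"
    and inv: "\<And>g x y. B (blinfun_apply (R g) x) (blinfun_apply (R g) y) = (B x y :: real)"
  shows "B (casimir R x) y = B x (casimir R y)"
proof -
  interpret B: bounded_bilinear B by (rule B)
  note skew = rep_deriv_skew[OF R B inv]
  let ?E = "\<lambda>i. blinfun_apply (rep_deriv R (axis i 1))"
  have "B (casimir R x) y = (\<Sum>a\<in>UNIV. \<Sum>b\<in>UNIV. inverse_metric $ a $ b * B (?E a (?E b x)) y)"
    by (simp add: casimir_def B.sum_left B.scaleR_left)
  also have "\<dots> = (\<Sum>a\<in>UNIV. \<Sum>b\<in>UNIV. inverse_metric $ b $ a * B x (?E b (?E a y)))"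
    by (intro sum.cong refl) (simp add: skew inverse_metric_sym B.minus_right)
  also have "\<dots> = (\<Sum>b\<in>UNIV. \<Sum>a\<in>UNIV. inverse_metric $ b $ a * B x (?E b (?E a y)))" by (rule sum.swap)
  also have "\<dots> = B x (casimir R y)" by (simp add: casimir_def B.sum_right B.scaleR_right)
  finally show ?thesis .
qed

end

section \<open>Energy argument\<close>

text \<open>\<open>p\<close> and \<open>q\<close> span the orthogonal complement of \<open>L\<close>
  for the inner product of the type class. Any two functionals cutting out a part of
  \<open>L\<close> will do, so there is no need to take the invariant \<open>B\<close>.\<close>

lemma codim2_orthogonal:
  fixes L :: "'v::euclidean_space set"
  assumes L: "subspace L" "dim L + 2 = DIM('v)"
  obtains p q where "\<And>y. y \<bullet> p = 0 \<Longrightarrow> y \<bullet> q = 0 \<Longrightarrow> y \<in> L"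
proof -
  define P where "P = {y \<in> UNIV. \<forall>x\<in>L. orthogonal x y}"
  have "dim P + dim L = dim (UNIV :: 'v set)"
    unfolding P_def by (rule dim_subspace_orthogonal_to_vectors) (use L in auto)
  then have dP: "dim P = 2" using L(2) by simp
  obtain S where S: "S \<subseteq> P" "independent S" "P \<subseteq> span S" "card S = dim P" using basis_exists by blast
  then obtain p q where pq: "S = {p, q}" using dP by (metis card_2_iff)
  have "y \<in> L" if y: "y \<bullet> p = 0" "y \<bullet> q = 0" for y
  proof -
    obtain a b where ab: "a \<in> span L" "\<And>w. w \<in> span L \<Longrightarrow> orthogonal b w" "y = a + b"
      using orthogonal_subspace_decomp_exists[of L y] by blast
    have "b \<in> P" using ab(2) span_base by (auto simp: P_def orthogonal_commute)
    then have "b \<in> span S" using S(3) by blast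
    moreover have "orthogonal y s" if "s \<in> S" for s using that y by (auto simp: pq orthogonal_def)
    ultimately have "orthogonal y b" by (rule orthogonal_to_span)
    moreover have "orthogonal b a" using ab(1,2) by blast
    ultimately have "b \<bullet> b = 0" by (simp add: ab(3) orthogonal_def inner_add_left inner_add_right inner_commute[of b a])
    then show "y \<in> L" using ab(1,3) L(1) by (simp add: span_eq_iff[THEN iffD2])
  qed
  then show thesis using that by blast
qed

context semisimple_compact_lie_group
begin

section \<open>Uniform derivatives and the mean\<close>

definition axis_curve :: "'n \<Rightarrow> real \<Rightarrow> 'g" where
  "axis_curve i t = near_unit (unit_coord + t *\<^sub>R axis i 1)"

text \<open>The derivative along the left-invariant field of the \<open>i\<close>-th basis vector.
  The error is uniform in \<open>h\<close>, so that the mean, which is bounded by the supremum, can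
  be applied to the expansion.\<close>

definition unif_deriv :: "'n \<Rightarrow> ('g \<Rightarrow> real) \<Rightarrow> ('g \<Rightarrow> real) \<Rightarrow> bool" where
  "unif_deriv i u u' \<longleftrightarrow>
     (\<forall>e>0. \<exists>d>0. \<forall>t h. \<bar>t\<bar> < d \<longrightarrow> \<bar>u (h \<otimes> axis_curve i t) - u h - t * u' h\<bar> \<le> e * \<bar>t\<bar>)"

lemma axis_curve_small:
  assumes "open U" "\<one> \<in> U"
  obtains d where "d > 0" "\<And>t. \<bar>t\<bar> < d \<Longrightarrow> axis_curve i t \<in> U"
proof -
  let ?V = "{z \<in> coord_range unit_chart. param unit_chart z \<in> U}"
  have "open ?V" using open_param_vimage[OF unit_chart(1) assms(1) continuous_on_id] by simp
  moreover have "unit_coord \<in> ?V" using unit_coord_in assms(2) near_unit_unit_coord by (simp add: near_unit_def)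
  ultimately obtain d where d: "d > 0" "ball unit_coord d \<subseteq> ?V" by (rule openE)
  have "axis_curve i t \<in> U" if "\<bar>t\<bar> < d" for t
  proof -
    have "unit_coord + t *\<^sub>R axis i 1 \<in> ball unit_coord d" using that by (simp add: dist_norm norm_axis_1)
    then show ?thesis using d(2) by (auto simp: axis_curve_def near_unit_def)
  qed
  then show thesis using that d(1) by blast
qed

lemma continuous_bounded:
  fixes f :: "'g \<Rightarrow> 'b::real_normed_vector"
  assumes "continuous_on UNIV f"
  obtains K where "K > 0" "\<And>h. norm (f h) \<le> K"
proof -
  have "compact (range f)" using assms compact by (rule compact_continuous_image)
  then have "bounded (range f)" by (rule compact_imp_bounded)
  then obtain K where K: "K > 0" "\<forall>x\<in>range f. norm x \<le> K" unfolding bounded_pos by blast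
  then show thesis using that[OF K(1)] by blast
qed

text \<open>\<open>u (h \<otimes> axis_curve i t)\<close> and \<open>u h\<close> have the same mean,
  so \<open>t * mean u'\<close> is at most \<open>e * \<bar>t\<bar>\<close> in modulus. This
  replaces the divergence theorem.\<close>

lemma mean_unif_deriv:
  assumes u: "continuous_on UNIV u" and u': "continuous_on UNIV u'" and d: "unif_deriv i u u'"
  shows "mean u' = 0"
proof -
  have "\<bar>mean u'\<bar> \<le> e" if e: "e > 0" for e
  proof -
    obtain d where d: "d > 0" "\<And>t h. \<bar>t\<bar> < d \<Longrightarrow> \<bar>u (h \<otimes> axis_curve i t) - u h - t * u' h\<bar> \<le> e * \<bar>t\<bar>"
      using d e unfolding unif_deriv_def by blast
    let ?t = "d / 2"
    let ?g = "axis_curve i ?t"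
    have t: "\<bar>?t\<bar> < d" "?t > 0" using d(1) by auto
    note ct = continuous_on_translate_right[OF u, of ?g]
    have "mean (\<lambda>h. u (h \<otimes> ?g) - u h - ?t * u' h) = - ?t * mean u'"
      by (simp add: mean_diff continuous_on_diff continuous_on_mult_left ct u u' mean_cmult mean_translate_right
          del: times_divide_eq_left)
    moreover have "\<bar>mean (\<lambda>h. u (h \<otimes> ?g) - u h - ?t * u' h)\<bar> \<le> e * \<bar>?t\<bar>"
      by (rule abs_mean_le) (intro continuous_on_diff continuous_on_mult_left ct u u', rule d(2)[OF t(1)])
    ultimately have "?t * \<bar>mean u'\<bar> \<le> ?t * e" using t(2) by (simp add: abs_mult)
    then show ?thesis using t(2) mult_le_cancel_left_pos by blast
  qed
  then show ?thesis using field_le_epsilon[of "\<bar>mean u'\<bar>" 0] by auto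
qed

lemma unif_deriv_diff:
  assumes "unif_deriv i u u'" "unif_deriv i v v'"
  shows "unif_deriv i (\<lambda>h. u h - v h) (\<lambda>h. u' h - v' h)"
  unfolding unif_deriv_def
proof (intro allI impI)
  fix e :: real assume "e > 0"
  then have "e / 2 > 0" by simp
  then obtain d1 d2 where d: "d1 > 0" "d2 > 0"
    "\<And>t h. \<bar>t\<bar> < d1 \<Longrightarrow> \<bar>u (h \<otimes> axis_curve i t) - u h - t * u' h\<bar> \<le> e / 2 * \<bar>t\<bar>"
    "\<And>t h. \<bar>t\<bar> < d2 \<Longrightarrow> \<bar>v (h \<otimes> axis_curve i t) - v h - t * v' h\<bar> \<le> e / 2 * \<bar>t\<bar>"
    using assms unfolding unif_deriv_def by metis
  show "\<exists>d>0. \<forall>t h. \<bar>t\<bar> < d \<longrightarrow> \<bar>u (h \<otimes> axis_curve i t) - v (h \<otimes> axis_curve i t) - (u h - v h) - t * (u' h - v' h)\<bar> \<le> e * \<bar>t\<bar>"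
  proof (intro exI[of _ "min d1 d2"] conjI allI impI)
    fix t h assume "\<bar>t\<bar> < min d1 d2"
    then have a: "\<bar>u (h \<otimes> axis_curve i t) - u h - t * u' h\<bar> \<le> e / 2 * \<bar>t\<bar>"
      and b: "\<bar>v (h \<otimes> axis_curve i t) - v h - t * v' h\<bar> \<le> e / 2 * \<bar>t\<bar>" using d(3,4) by auto
    have "t * (u' h - v' h) = t * u' h - t * v' h" "e * \<bar>t\<bar> = e / 2 * \<bar>t\<bar> + e / 2 * \<bar>t\<bar>" by (simp_all add: algebra_simps)
    then show "\<bar>u (h \<otimes> axis_curve i t) - v (h \<otimes> axis_curve i t) - (u h - v h) - t * (u' h - v' h)\<bar> \<le> e * \<bar>t\<bar>"
      using a b by linarith
  qed (use d in simp)
qed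

lemma unif_deriv_mult:
  assumes u: "unif_deriv i u u'" and v: "unif_deriv i v v'"
    and c: "continuous_on UNIV u" "continuous_on UNIV u'" "continuous_on UNIV v" "continuous_on UNIV v'"
  shows "unif_deriv i (\<lambda>h. u h * v h) (\<lambda>h. u' h * v h + u h * v' h)"
  unfolding unif_deriv_def
proof (intro allI impI)
  fix e :: real assume e: "e > 0"
  obtain K1 where K1: "K1 > 0" "\<And>h. norm (u h) \<le> K1" using continuous_bounded[OF c(1)] by blast
  obtain K2 where K2: "K2 > 0" "\<And>h. norm (u' h) \<le> K2" using continuous_bounded[OF c(2)] by blast
  obtain K3 where K3: "K3 > 0" "\<And>h. norm (v h) \<le> K3" using continuous_bounded[OF c(3)] by blast
  obtain K4 where K4: "K4 > 0" "\<And>h. norm (v' h) \<le> K4" using continuous_bounded[OF c(4)] by blast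
  \<comment> \<open>The two remainder terms together take \<open>e / 2 * \<bar>t\<bar>\<close>; the
    third entry in \<open>d\<close> below limits the quadratic cross term to the same amount.
    \<open>e1 \<le> 1\<close> gives \<open>u\<close> the Lipschitz constant
    \<open>1 + K2\<close>.\<close>
  define e1 where "e1 = min 1 (e / (2 * (K1 + K3)))"
  have e1: "e1 > 0" "e1 \<le> 1" "(K1 + K3) * e1 \<le> e / 2"
  proof -
    show "e1 > 0" "e1 \<le> 1" using e K1 K3 by (auto simp: e1_def)
    have "(K1 + K3) * e1 \<le> (K1 + K3) * (e / (2 * (K1 + K3)))" using K1 K3 by (intro mult_left_mono) (auto simp: e1_def)
    also have "\<dots> = e / 2" using K1(1) K3(1) by (simp add: field_simps)
    finally show "(K1 + K3) * e1 \<le> e / 2" .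
  qed
  obtain d1 where d1: "d1 > 0" "\<And>t h. \<bar>t\<bar> < d1 \<Longrightarrow> \<bar>u (h \<otimes> axis_curve i t) - u h - t * u' h\<bar> \<le> e1 * \<bar>t\<bar>"
    using u e1(1) unfolding unif_deriv_def by blast
  obtain d2 where d2: "d2 > 0" "\<And>t h. \<bar>t\<bar> < d2 \<Longrightarrow> \<bar>v (h \<otimes> axis_curve i t) - v h - t * v' h\<bar> \<le> e1 * \<bar>t\<bar>"
    using v e1(1) unfolding unif_deriv_def by blast
  define d where "d = min (min d1 d2) (e / (2 * (K4 * (1 + K2))))"
  have d: "d > 0" using d1 d2 e K2 K4 by (auto simp: d_def)
  show "\<exists>d>0. \<forall>t h. \<bar>t\<bar> < d \<longrightarrow> \<bar>u (h \<otimes> axis_curve i t) * v (h \<otimes> axis_curve i t) - u h * v h - t * (u' h * v h + u h * v' h)\<bar> \<le> e * \<bar>t\<bar>"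
  proof (intro exI[of _ d] conjI allI impI d)
    fix t h assume t: "\<bar>t\<bar> < d"
    let ?U = "u (h \<otimes> axis_curve i t)" and ?V = "v (h \<otimes> axis_curve i t)"
    have a: "\<bar>?U - u h - t * u' h\<bar> \<le> e1 * \<bar>t\<bar>" and b: "\<bar>?V - v h - t * v' h\<bar> \<le> e1 * \<bar>t\<bar>"
      using d1 d2 t by (auto simp: d_def)
    have tK: "\<bar>t\<bar> * (K4 * (1 + K2)) \<le> e / 2"
    proof -
      have "\<bar>t\<bar> \<le> e / (2 * (K4 * (1 + K2)))" using t by (simp add: d_def)
      then have "\<bar>t\<bar> * (K4 * (1 + K2)) \<le> e / (2 * (K4 * (1 + K2))) * (K4 * (1 + K2))" using K2 K4 by (intro mult_right_mono) auto
      also have "\<dots> = e / 2" using K2 K4 by simp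
      finally show ?thesis .
    qed
    have "\<bar>t * u' h\<bar> \<le> K2 * \<bar>t\<bar>" using mult_left_mono[OF K2(2)[of h], of "\<bar>t\<bar>"] by (simp add: abs_mult mult.commute)
    moreover have "e1 * \<bar>t\<bar> \<le> 1 * \<bar>t\<bar>" using e1 by (intro mult_right_mono) auto
    ultimately have Uu: "\<bar>?U - u h\<bar> \<le> (1 + K2) * \<bar>t\<bar>" using a unfolding distrib_right by linarith
    have tri: "\<bar>x + y + z\<bar> \<le> \<bar>x\<bar> + \<bar>y\<bar> + \<bar>z\<bar>" for x y z :: real by linarith
    have eq: "?U * ?V - u h * v h - t * (u' h * v h + u h * v' h)
        = ?U * (?V - v h - t * v' h) + t * v' h * (?U - u h) + v h * (?U - u h - t * u' h)"
      by (simp add: algebra_simps)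
    have "\<bar>?U * ?V - u h * v h - t * (u' h * v h + u h * v' h)\<bar> \<le> \<bar>?U\<bar> * \<bar>?V - v h - t * v' h\<bar> + \<bar>t\<bar> * \<bar>v' h\<bar> * \<bar>?U - u h\<bar> + \<bar>v h\<bar> * \<bar>?U - u h - t * u' h\<bar>"
      unfolding eq using tri[of "?U * (?V - v h - t * v' h)" "t * v' h * (?U - u h)" "v h * (?U - u h - t * u' h)"] by (simp only: abs_mult)
    also have "\<dots> \<le> K1 * (e1 * \<bar>t\<bar>) + \<bar>t\<bar> * K4 * ((1 + K2) * \<bar>t\<bar>) + K3 * (e1 * \<bar>t\<bar>)"
    proof (intro add_mono)
      show "\<bar>?U\<bar> * \<bar>?V - v h - t * v' h\<bar> \<le> K1 * (e1 * \<bar>t\<bar>)"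
        using K1(1) K1(2)[of "h \<otimes> axis_curve i t"] b by (intro mult_mono) auto
      show "\<bar>t\<bar> * \<bar>v' h\<bar> * \<bar>?U - u h\<bar> \<le> \<bar>t\<bar> * K4 * ((1 + K2) * \<bar>t\<bar>)"
        using K4(1) K4(2)[of h] Uu by (intro mult_mono) auto
      show "\<bar>v h\<bar> * \<bar>?U - u h - t * u' h\<bar> \<le> K3 * (e1 * \<bar>t\<bar>)"
        using K3(1) K3(2)[of h] a by (intro mult_mono) auto
    qed
    also have "\<dots> = ((K1 + K3) * e1) * \<bar>t\<bar> + (\<bar>t\<bar> * (K4 * (1 + K2))) * \<bar>t\<bar>" by (simp add: algebra_simps)
    also have "\<dots> \<le> e / 2 * \<bar>t\<bar> + e / 2 * \<bar>t\<bar>" using e1(3) tK by (intro add_mono mult_right_mono) auto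
    finally show "\<bar>?U * ?V - u h * v h - t * (u' h * v h + u h * v' h)\<bar> \<le> e * \<bar>t\<bar>" by simp
  qed
qed

lemma continuous_rep_functional:
  assumes R: "blinfun_rep R" and \<phi>: "bounded_linear \<phi>"
  shows "continuous_on UNIV (\<lambda>h. \<phi> (blinfun_apply (R h) w))"
  by (intro bounded_linear.continuous_on[OF \<phi>] bounded_linear.continuous_on[OF blinfun.bounded_linear_left]
      rep_continuous[OF R])

text \<open>\<open>R (h \<otimes> axis_curve i t)\<close> is \<open>R h\<close> composed with
  \<open>R (axis_curve i t)\<close>: the expansion at the unit alone is used, and it is uniform
  because \<open>R\<close> is bounded.\<close>

lemma unif_deriv_rep:
  assumes R: "blinfun_rep R" and \<phi>: "bounded_linear (\<phi> :: 'v::euclidean_space \<Rightarrow> real)"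
  shows "unif_deriv i (\<lambda>h. \<phi> (blinfun_apply (R h) w)) (\<lambda>h. \<phi> (blinfun_apply (R h) (blinfun_apply (rep_deriv R (axis i 1)) w)))"
  unfolding unif_deriv_def
proof (intro allI impI)
  fix e :: real assume e: "e > 0"
  let ?E = "rep_deriv R (axis i 1)"
  interpret \<phi>: bounded_linear \<phi> by (rule \<phi>)
  obtain K where K: "K > 0" "\<And>h. norm (R h) \<le> K" using continuous_bounded[OF rep_continuous[OF R]] by blast
  obtain M where M: "M > 0" "\<And>x. norm (\<phi> x) \<le> norm x * M" using \<phi>.pos_bounded by blast
  define C where "C = K * (norm w + 1) * M"
  have C: "C > 0" using K M by (simp add: C_def add_nonneg_pos)
  have line: "((\<lambda>t. unit_coord + t *\<^sub>R axis i 1) has_derivative (\<lambda>t. t *\<^sub>R axis i 1)) (at 0)"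
    by (auto intro!: derivative_eq_intros)
  have "((\<lambda>z. R (near_unit z)) has_derivative rep_deriv R) (at (unit_coord + 0 *\<^sub>R axis i 1))"
    using rep_has_derivative[OF R] by simp
  from has_derivative_compose[OF line this]
  have "((\<lambda>t. R (axis_curve i t)) has_derivative (\<lambda>t. rep_deriv R (t *\<^sub>R axis i 1))) (at 0)"
    by (simp add: axis_curve_def)
  moreover have "rep_deriv R (t *\<^sub>R axis i 1) = t *\<^sub>R ?E" for t
    using rep_has_derivative[OF R] by (intro linear_cmul has_derivative_linear)
  ultimately have "((\<lambda>t. R (axis_curve i t)) has_derivative (\<lambda>t. t *\<^sub>R ?E)) (at 0)" by simp
  then have "\<exists>d>0. \<forall>t. norm (t - 0) < d \<longrightarrow>
      norm (R (axis_curve i t) - R (axis_curve i 0) - (t - 0) *\<^sub>R ?E) \<le> e / C * norm (t - 0)"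
    unfolding has_derivative_at_alt using e C by (metis divide_pos_pos)
  then obtain d where d: "d > 0" "\<And>t. \<bar>t\<bar> < d \<Longrightarrow> norm (R (axis_curve i t) - id_blinfun - t *\<^sub>R ?E) \<le> e / C * \<bar>t\<bar>"
    by (auto simp: axis_curve_def rep_one[OF R])
  show "\<exists>d>0. \<forall>t h. \<bar>t\<bar> < d \<longrightarrow> \<bar>\<phi> (blinfun_apply (R (h \<otimes> axis_curve i t)) w) - \<phi> (blinfun_apply (R h) w)
      - t * \<phi> (blinfun_apply (R h) (blinfun_apply ?E w))\<bar> \<le> e * \<bar>t\<bar>"
  proof (intro exI[of _ d] conjI allI impI d(1))
    fix t h assume t: "\<bar>t\<bar> < d"
    let ?D = "R (axis_curve i t) - id_blinfun - t *\<^sub>R ?E"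
    have eq: "\<phi> (blinfun_apply (R (h \<otimes> axis_curve i t)) w) - \<phi> (blinfun_apply (R h) w)
        - t * \<phi> (blinfun_apply (R h) (blinfun_apply ?E w)) = \<phi> (blinfun_apply (R h) (blinfun_apply ?D w))"
      by (simp add: rep_mult[OF R] blinfun.bilinear_simps \<phi>.diff \<phi>.scaleR)
    have "\<bar>\<phi> (blinfun_apply (R h) (blinfun_apply ?D w))\<bar> \<le> norm (blinfun_apply (R h) (blinfun_apply ?D w)) * M"
      using M(2)[of "blinfun_apply (R h) (blinfun_apply ?D w)"] by (simp only: real_norm_def)
    also have "\<dots> \<le> (K * ((e / C * \<bar>t\<bar>) * (norm w + 1))) * M"
    proof (rule mult_right_mono)
      have "norm (blinfun_apply ?D w) \<le> norm ?D * norm w" by (rule norm_blinfun)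
      also have "\<dots> \<le> (e / C * \<bar>t\<bar>) * (norm w + 1)" using d(2)[OF t] e C by (intro mult_mono) auto
      finally have 1: "norm (blinfun_apply ?D w) \<le> (e / C * \<bar>t\<bar>) * (norm w + 1)" .
      have "norm (blinfun_apply (R h) (blinfun_apply ?D w)) \<le> norm (R h) * norm (blinfun_apply ?D w)" by (rule norm_blinfun)
      also have "\<dots> \<le> K * ((e / C * \<bar>t\<bar>) * (norm w + 1))" using 1 K by (intro mult_mono) auto
      finally show "norm (blinfun_apply (R h) (blinfun_apply ?D w)) \<le> K * ((e / C * \<bar>t\<bar>) * (norm w + 1))" .
    qed (use M in simp)
    also have "\<dots> = e / C * C * \<bar>t\<bar>" unfolding C_def by (simp only: mult_ac)
    also have "\<dots> = e * \<bar>t\<bar>" using C by simp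
    finally show "\<bar>\<phi> (blinfun_apply (R (h \<otimes> axis_curve i t)) w) - \<phi> (blinfun_apply (R h) w)
      - t * \<phi> (blinfun_apply (R h) (blinfun_apply ?E w))\<bar> \<le> e * \<bar>t\<bar>" unfolding eq .
  qed
qed

lemma uniform_right_continuity:
  fixes b :: "'g \<Rightarrow> real"
  assumes b: "continuous_on UNIV b" and e: "e > 0"
  obtains d where "d > 0" "\<And>t h. \<bar>t\<bar> < d \<Longrightarrow> \<bar>b (h \<otimes> axis_curve i t) - b h\<bar> < e"
proof -
  have "continuous_on UNIV (\<lambda>h. b (inv h))" by (rule continuous_on_compose2[OF b cont_inv]) simp
  from uniform_left_continuity[OF this e] obtain U where U: "open U" "\<one> \<in> U"
    "\<And>u h. u \<in> U \<Longrightarrow> dist (b (inv (u \<otimes> h))) (b (inv h)) < e" by blast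
  let ?U = "{g. inv g \<in> U}"
  have "open ?U" using open_vimage[OF U(1) cont_inv] by (simp add: vimage_def)
  moreover have "\<one> \<in> ?U" using U(2) by simp
  ultimately obtain d where d: "d > 0" "\<And>t. \<bar>t\<bar> < d \<Longrightarrow> axis_curve i t \<in> ?U"
    using axis_curve_small by blast
  have "\<bar>b (h \<otimes> axis_curve i t) - b h\<bar> < e" if "\<bar>t\<bar> < d" for t h
    using U(3)[of "inv (axis_curve i t)" "inv h"] d(2)[OF that] by (simp add: inv_mult_group dist_real_def)
  then show thesis using that d(1) by blast
qed

text \<open>For small \<open>t\<close> the increment of the argument is the imaginary part of the principal logarithm
  of the quotient.\<close>

lemma unif_deriv_argument:
  assumes f: "continuous_on UNIV f1" "continuous_on UNIV f2" and nz: "\<And>h. (f1 h)\<^sup>2 + (f2 h)\<^sup>2 \<noteq> 0"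
    and b: "continuous_on UNIV b"
    and arg: "\<And>h. Complex (f1 h) (f2 h) = of_real (r h) * \<kappa> * cis (b h)" "\<And>h. r h > 0" 
    and d: "unif_deriv i f1 f1'" "unif_deriv i f2 f2'" and c': "continuous_on UNIV f1'" "continuous_on UNIV f2'"
  shows "unif_deriv i b (\<lambda>h. (f1 h * f2' h - f2 h * f1' h) / ((f1 h)\<^sup>2 + (f2 h)\<^sup>2))"
  unfolding unif_deriv_def
proof (intro allI impI)
  fix e :: real assume e: "e > 0"
  define F where "F h = Complex (f1 h) (f2 h)" for h
  define F' where "F' h = Complex (f1' h) (f2' h)" for h
  have Fnz: "F h \<noteq> 0" for h using nz[of h] by (auto simp: F_def complex_eq_iff)
  have cF: "continuous_on UNIV F" and cF': "continuous_on UNIV F'"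
    unfolding F_def F'_def Complex_eq by (intro continuous_intros f c')+
  obtain K1 where K1: "K1 > 0" "\<And>h. norm (inverse (F h)) \<le> K1"
    using continuous_bounded[OF continuous_on_inverse[OF cF]] Fnz by blast
  obtain K2 where K2: "K2 > 0" "\<And>h. norm (F' h) \<le> K2" using continuous_bounded[OF cF'] by blast
  \<comment> \<open>The error has two parts, each allowed \<open>e / 2 * \<bar>t\<bar>\<close>: the
    remainder of \<open>F\<close>, at most \<open>2 * e1 * \<bar>t\<bar>\<close> from its two
    components and multiplied by \<open>K1\<close>, and the remainder of \<open>Ln\<close> at
    1.\<close>
  define e1 where "e1 = min 1 (e / (4 * K1))"
  have e1: "e1 > 0" "e1 \<le> 1" "K1 * (2 * e1) \<le> e / 2"
  proof -
    show "e1 > 0" "e1 \<le> 1" using e K1 by (auto simp: e1_def)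
    have "K1 * (2 * e1) \<le> K1 * (2 * (e / (4 * K1)))" using K1 by (intro mult_left_mono) (auto simp: e1_def)
    then show "K1 * (2 * e1) \<le> e / 2" using K1 by simp
  qed
  define C where "C = K1 * (2 + K2)"
  have C: "C > 0" using K1 K2 by (simp add: C_def)
  have "(Ln has_field_derivative inverse 1) (at 1)" by (rule has_field_derivative_Ln) auto
  then have "(Ln has_derivative (\<lambda>z. z)) (at 1)" unfolding has_field_derivative_def lambda_one by simp
  then have "\<exists>d>0. \<forall>y. norm (y - 1) < d \<longrightarrow> norm (Ln y - Ln 1 - (y - 1)) \<le> e / (2 * C) * norm (y - 1)"
    unfolding has_derivative_at_alt using e C by (metis divide_pos_pos mult_pos_pos zero_less_numeral)
  then obtain d0 where d0: "d0 > 0" "\<And>z. norm z < d0 \<Longrightarrow> norm (Ln (1 + z) - z) \<le> e / (2 * C) * norm z"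
    by (metis Ln_1 add_diff_cancel_left' diff_zero)
  obtain d1 where d1: "d1 > 0" "\<And>t h. \<bar>t\<bar> < d1 \<Longrightarrow> \<bar>f1 (h \<otimes> axis_curve i t) - f1 h - t * f1' h\<bar> \<le> e1 * \<bar>t\<bar>"
    using d(1) e1(1) unfolding unif_deriv_def by blast
  obtain d2 where d2: "d2 > 0" "\<And>t h. \<bar>t\<bar> < d2 \<Longrightarrow> \<bar>f2 (h \<otimes> axis_curve i t) - f2 h - t * f2' h\<bar> \<le> e1 * \<bar>t\<bar>"
    using d(2) e1(1) unfolding unif_deriv_def by blast
  obtain d3 where d3: "d3 > 0" "\<And>t h. \<bar>t\<bar> < d3 \<Longrightarrow> \<bar>b (h \<otimes> axis_curve i t) - b h\<bar> < 1"
    using uniform_right_continuity[OF b zero_less_one] by blast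
  define d where "d = min (min d1 d2) (min d3 (d0 / C))"
  have d: "d > 0" using d0 d1 d2 d3 C by (simp add: d_def)
  show "\<exists>d>0. \<forall>t h. \<bar>t\<bar> < d \<longrightarrow> \<bar>b (h \<otimes> axis_curve i t) - b h
      - t * ((f1 h * f2' h - f2 h * f1' h) / ((f1 h)\<^sup>2 + (f2 h)\<^sup>2))\<bar> \<le> e * \<bar>t\<bar>"
  proof (intro exI[of _ d] conjI allI impI d)
    fix t h assume t: "\<bar>t\<bar> < d"
    let ?k = "h \<otimes> axis_curve i t"
    define D where "D = F ?k - F h - of_real t * F' h"
    have "Re D = f1 ?k - f1 h - t * f1' h" "Im D = f2 ?k - f2 h - t * f2' h" by (simp_all add: D_def F_def F'_def)
    then have "\<bar>Re D\<bar> \<le> e1 * \<bar>t\<bar>" "\<bar>Im D\<bar> \<le> e1 * \<bar>t\<bar>" using d1(2)[of t h] d2(2)[of t h] t by (simp_all add: d_def)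
    then have D: "norm D \<le> 2 * e1 * \<bar>t\<bar>" using cmod_le[of D] by linarith
    define z where "z = F ?k * inverse (F h) - 1"
    have z: "z = (D + of_real t * F' h) * inverse (F h)" using Fnz[of h] by (simp add: z_def D_def field_simps)
    have "norm z \<le> (norm D + \<bar>t\<bar> * norm (F' h)) * norm (inverse (F h))"
      unfolding z norm_mult by (intro mult_right_mono order_trans[OF norm_triangle_ineq]) (auto simp: norm_mult)
    also have "\<dots> \<le> (2 * 1 * \<bar>t\<bar> + \<bar>t\<bar> * K2) * K1"
    proof (intro mult_mono add_mono)
      have "2 * e1 * \<bar>t\<bar> \<le> 2 * 1 * \<bar>t\<bar>" using e1 by (intro mult_right_mono) auto
      then show "norm D \<le> 2 * 1 * \<bar>t\<bar>" using D by linarith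
    qed (use K1 K2 in auto)
    finally have zC: "norm z \<le> C * \<bar>t\<bar>" by (simp add: C_def algebra_simps)
    have "C * \<bar>t\<bar> < C * (d0 / C)" using t C by (intro mult_strict_left_mono) (auto simp: d_def)
    then have "norm z < d0" using zC C by simp
    then have "norm (Ln (1 + z) - z) \<le> e / (2 * C) * norm z" by (rule d0(2))
    also have "\<dots> \<le> e / (2 * C) * (C * \<bar>t\<bar>)" using zC e C by (intro mult_left_mono) auto
    also have "\<dots> = e / 2 * \<bar>t\<bar>" using C by simp
    finally have Lz: "norm (Ln (1 + z) - z) \<le> e / 2 * \<bar>t\<bar>" .
    have "norm (z - of_real t * F' h * inverse (F h)) \<le> norm D * norm (inverse (F h))"
      unfolding z by (simp add: algebra_simps norm_mult)
    also have "\<dots> \<le> (2 * e1 * \<bar>t\<bar>) * K1" using D K1 e1 by (intro mult_mono) auto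
    also have "\<dots> = (K1 * (2 * e1)) * \<bar>t\<bar>" by simp
    also have "\<dots> \<le> e / 2 * \<bar>t\<bar>" using e1(3) by (intro mult_right_mono) auto
    finally have zt: "norm (z - of_real t * F' h * inverse (F h)) \<le> e / 2 * \<bar>t\<bar>" .
    \<comment> \<open>The increment of \<open>b\<close> is below 1 in modulus by the choice of
      \<open>d3\<close>, so it lies in the range of the principal argument and no multiple of
      \<open>2 * pi\<close> appears.\<close>
    have "Im (Ln (1 + z)) = b ?k - b h"
    proof -
      have \<kappa>: "\<kappa> \<noteq> 0" using arg(1)[of h] Fnz[of h] by (auto simp: F_def)
      have "1 + z = F ?k / F h" by (simp add: z_def field_simps)
      also have "\<dots> = of_real (r ?k / r h) * cis (b ?k - b h)"
        using \<kappa> arg(2)[of h] by (simp add: F_def arg(1) cis_divide[symmetric])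
      also have "\<dots> = exp (Complex (ln (r ?k / r h)) (b ?k - b h))"
        using arg(2)[of h] arg(2)[of ?k] by (simp add: exp_eq_polar)
      finally have "1 + z = exp (Complex (ln (r ?k / r h)) (b ?k - b h))" .
      moreover have "\<bar>b ?k - b h\<bar> < 1" using d3(2) t by (simp add: d_def)
      then have "- pi < b ?k - b h" "b ?k - b h \<le> pi" using pi_ge_two by linarith+
      ultimately show ?thesis by (simp add: Ln_exp)
    qed
    then have i1: "Im (Ln (1 + z) - z) = b ?k - b h - Im z" by simp
    let ?N = "(f1 h)\<^sup>2 + (f2 h)\<^sup>2"
    have "inverse (F h) = Complex (f1 h / ?N) (- f2 h / ?N)" by (simp add: complex_eq_iff F_def)
    then have "Im (of_real t * F' h * inverse (F h)) = t * ((f1 h * f2' h - f2 h * f1' h) / ?N)"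
      by (simp add: F'_def diff_divide_distrib algebra_simps)
    then have i2: "Im (z - of_real t * F' h * inverse (F h)) = Im z - t * ((f1 h * f2' h - f2 h * f1' h) / ?N)"
      by (simp only: minus_complex.sel)
    have "\<bar>b ?k - b h - Im z\<bar> \<le> e / 2 * \<bar>t\<bar>"
      using order_trans[OF abs_Im_le_cmod Lz] unfolding i1 .
    moreover have "\<bar>Im z - t * ((f1 h * f2' h - f2 h * f1' h) / ?N)\<bar> \<le> e / 2 * \<bar>t\<bar>"
      using order_trans[OF abs_Im_le_cmod zt] unfolding i2 .
    moreover have "\<bar>u - w\<bar> \<le> s + s" if "\<bar>u - v\<bar> \<le> s" "\<bar>v - w\<bar> \<le> s" for u v w s :: real
      using that by linarith
    ultimately have "\<bar>b ?k - b h - t * ((f1 h * f2' h - f2 h * f1' h) / ?N)\<bar> \<le> e / 2 * \<bar>t\<bar> + e / 2 * \<bar>t\<bar>"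
      by blast
    also have "\<dots> = e * \<bar>t\<bar>" by simp
    finally show "\<bar>b ?k - b h - t * ((f1 h * f2' h - f2 h * f1' h) / ?N)\<bar> \<le> e * \<bar>t\<bar>" .
  qed
qed

section \<open>Pairs of eigenfunctions without common zeros\<close>

text \<open>The quotient of \<open>F\<close> by its conjugate determines the line through 0 and
  \<open>F h\<close>. The numerator of its derivative is \<open>2 * \<i>\<close> times a Wronskian,
  so it is constant; this reaches the conclusion by derivatives in charts, without using
  \<open>b\<close>.\<close>

lemma rep_wronskian_zero_imp_parallel:
  assumes R: "blinfun_rep R" and \<phi>: "bounded_linear \<phi>1" "bounded_linear \<phi>2"
    and nz: "\<And>h. Complex (\<phi>1 (blinfun_apply (R h) x)) (\<phi>2 (blinfun_apply (R h) x)) \<noteq> 0"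
    and w: "\<And>i h. \<phi>1 (blinfun_apply (R h) x) * \<phi>2 (blinfun_apply (R h) (blinfun_apply (rep_deriv R (axis i 1)) x))
        - \<phi>2 (blinfun_apply (R h) x) * \<phi>1 (blinfun_apply (R h) (blinfun_apply (rep_deriv R (axis i 1)) x)) = 0"
  shows "\<phi>1 (blinfun_apply (R h) x) * \<phi>2 (blinfun_apply (R \<one>) x) = \<phi>2 (blinfun_apply (R h) x) * \<phi>1 (blinfun_apply (R \<one>) x)"
proof -
  define F where "F h = Complex (\<phi>1 (blinfun_apply (R h) x)) (\<phi>2 (blinfun_apply (R h) x))" for h
  have Fnz: "F h \<noteq> 0" "cnj (F h) \<noteq> 0" for h using nz[of h] by (simp_all add: F_def)
  have const: "F h / cnj (F h) = F \<one> / cnj (F \<one>)" for h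
  proof (rule zero_derivative_imp_constant[of "\<lambda>h. F h / cnj (F h)"])
    fix c p assume c: "c \<in> A" "p \<in> fst c"
    let ?y = "snd c p"
    have y: "?y \<in> coord_range c" and py: "param c ?y = p" using c by (auto simp: param_coord)
    obtain D1 where D1: "((\<lambda>y. \<phi>1 (blinfun_apply (R (param c y)) x)) has_derivative D1) (at ?y)"
      "\<And>v. D1 (frame c p v) = \<phi>1 (blinfun_apply (R p) (blinfun_apply (rep_deriv R v) x))"
      using rep_functional_derivative[OF R \<phi>(1) c(1) y] unfolding py by blast
    obtain D2 where D2: "((\<lambda>y. \<phi>2 (blinfun_apply (R (param c y)) x)) has_derivative D2) (at ?y)"
      "\<And>v. D2 (frame c p v) = \<phi>2 (blinfun_apply (R p) (blinfun_apply (rep_deriv R v) x))"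
      using rep_functional_derivative[OF R \<phi>(2) c(1) y] unfolding py by blast
    define DF where "DF v = of_real (D1 v) + \<i> * of_real (D2 v)" for v
    have Feq: "F (param c y) = of_real (\<phi>1 (blinfun_apply (R (param c y)) x)) + \<i> * of_real (\<phi>2 (blinfun_apply (R (param c y)) x))" for y
      by (simp add: F_def Complex_eq)
    have DF: "((\<lambda>y. F (param c y)) has_derivative DF) (at ?y)"
      unfolding Feq DF_def[abs_def] by (intro has_derivative_add has_derivative_mult_right has_derivative_of_real D1(1) D2(1))
    then have DcF: "((\<lambda>y. cnj (F (param c y))) has_derivative (\<lambda>v. cnj (DF v))) (at ?y)"
      by (rule bounded_linear.has_derivative[OF bounded_linear_cnj])
    have W: "\<phi>1 (blinfun_apply (R p) x) * D2 v - \<phi>2 (blinfun_apply (R p) x) * D1 v = 0" for v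
    proof -
      obtain u where u: "v = frame c p u" using frame_surj[OF c] by (metis surjD)
      let ?W = "\<lambda>u. \<phi>1 (blinfun_apply (R p) x) * D2 (frame c p u) - \<phi>2 (blinfun_apply (R p) x) * D1 (frame c p u)"
      interpret D1: bounded_linear D1 using D1(1) by (rule has_derivative_bounded_linear)
      interpret D2: bounded_linear D2 using D2(1) by (rule has_derivative_bounded_linear)
      interpret fr: bounded_linear "frame c p" using c by (rule linear_frame)
      have "linear ?W"
        by (rule linearI) (simp_all add: fr.add fr.scaleR D1.add D1.scaleR D2.add D2.scaleR algebra_simps)
      then have "bounded_linear ?W" by (simp add: linear_conv_bounded_linear)
      from linear_axis_expansion[OF this, of u] have "?W u = 0" using w[of p] by (simp only: D1(2) D2(2) scaleR_zero_right sum.neutral_const)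
      then show ?thesis by (simp only: u)
    qed
    have "DF v * cnj (F p) - F p * cnj (DF v) = 0" for v
      using W[of v] by (simp add: complex_eq_iff DF_def F_def algebra_simps)
    then have eq: "(DF v * cnj (F p) - F p * cnj (DF v)) / (cnj (F p) * cnj (F p)) = 0" for v by (simp only: div_0)
    have "((\<lambda>y. F (param c y) / cnj (F (param c y))) has_derivative
        (\<lambda>v. (DF v * cnj (F (param c ?y)) - F (param c ?y) * cnj (DF v)) / (cnj (F (param c ?y)) * cnj (F (param c ?y))))) (at ?y)"
      by (rule has_derivative_divide'[OF DF DcF]) (rule Fnz)
    then show "((\<lambda>y. F (param c y) / cnj (F (param c y))) has_derivative (\<lambda>v. 0)) (at ?y)"
      unfolding py eq .
  qed
  have "F h * cnj (F \<one>) = F \<one> * cnj (F h)" using const[of h] Fnz by (simp add: field_simps)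
  then have "Im (F h * cnj (F \<one>)) = Im (F \<one> * cnj (F h))" by (rule arg_cong)
  then show ?thesis by (simp add: F_def algebra_simps)
qed

lemma sum_symmetric_antisymmetric:
  fixes a d :: "'n \<Rightarrow> 'n \<Rightarrow> real"
  assumes "\<And>i j. a i j = a j i" "\<And>i j. d i j = - d j i"
  shows "(\<Sum>i\<in>UNIV. \<Sum>j\<in>UNIV. a i j * d i j) = 0"
proof -
  have "(\<Sum>i\<in>UNIV. \<Sum>j\<in>UNIV. a i j * d i j) = (\<Sum>i\<in>UNIV. \<Sum>j\<in>UNIV. - (a j i * d j i))"
    using assms by (intro sum.cong refl) (metis mult_minus_right)
  also have "\<dots> = - (\<Sum>i\<in>UNIV. \<Sum>j\<in>UNIV. a j i * d j i)" by (simp only: sum_negf)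
  also have "(\<Sum>i\<in>UNIV. \<Sum>j\<in>UNIV. a j i * d j i) = (\<Sum>i\<in>UNIV. \<Sum>j\<in>UNIV. a i j * d i j)" by (rule sum.swap)
  finally show ?thesis by simp
qed

lemma eigen_pair_common_zero:
  assumes R: "blinfun_rep R" and \<phi>1: "bounded_linear (\<phi>1 :: 'v::euclidean_space \<Rightarrow> real)" and \<phi>2: "bounded_linear (\<phi>2 :: 'v \<Rightarrow> real)"
    and cas: "\<And>x. casimir R x = l *\<^sub>R x" and l: "l \<noteq> 0"
  shows "\<exists>h. \<phi>1 (blinfun_apply (R h) x) = 0 \<and> \<phi>2 (blinfun_apply (R h) x) = 0"
proof (rule ccontr)
  assume no: "\<nexists>h. \<phi>1 (blinfun_apply (R h) x) = 0 \<and> \<phi>2 (blinfun_apply (R h) x) = 0"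
  let ?E = "\<lambda>i. blinfun_apply (rep_deriv R (axis i 1))"
  let ?a = "\<lambda>i j. inverse_metric $ i $ j"
  define f1 where "f1 y h = \<phi>1 (blinfun_apply (R h) y)" for y h
  define f2 where "f2 y h = \<phi>2 (blinfun_apply (R h) y)" for y h
  have c1: "continuous_on UNIV (f1 y)" and c2: "continuous_on UNIV (f2 y)" for y
    unfolding f1_def[abs_def] f2_def[abs_def] by (intro continuous_rep_functional[OF R] \<phi>1 \<phi>2)+
  have u1: "unif_deriv i (f1 y) (f1 (?E i y))" and u2: "unif_deriv i (f2 y) (f2 (?E i y))" for i y
    unfolding f1_def[abs_def] f2_def[abs_def] by (intro unif_deriv_rep[OF R] \<phi>1 \<phi>2)+
  have l1: "(\<Sum>i\<in>UNIV. \<Sum>j\<in>UNIV. ?a i j * f1 (?E i (?E j y)) h) = l * f1 y h"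
    and l2: "(\<Sum>i\<in>UNIV. \<Sum>j\<in>UNIV. ?a i j * f2 (?E i (?E j y)) h) = l * f2 y h" for y h
  proof -
    interpret \<phi>1: bounded_linear \<phi>1 by (rule \<phi>1)
    interpret \<phi>2: bounded_linear \<phi>2 by (rule \<phi>2)
    have "\<phi>1 (blinfun_apply (R h) (casimir R y)) = l * f1 y h" "\<phi>2 (blinfun_apply (R h) (casimir R y)) = l * f2 y h"
      by (simp_all add: cas f1_def f2_def blinfun.scaleR_right \<phi>1.scaleR \<phi>2.scaleR)
    then show "(\<Sum>i\<in>UNIV. \<Sum>j\<in>UNIV. ?a i j * f1 (?E i (?E j y)) h) = l * f1 y h"
      "(\<Sum>i\<in>UNIV. \<Sum>j\<in>UNIV. ?a i j * f2 (?E i (?E j y)) h) = l * f2 y h"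
      by (simp_all add: f1_def f2_def casimir_def blinfun.sum_right blinfun.scaleR_right \<phi>1.sum \<phi>1.scaleR \<phi>2.sum \<phi>2.scaleR)
  qed
  define F where "F h = Complex (f1 x h) (f2 x h)" for h
  have Fnz: "F h \<noteq> 0" for h using no by (auto simp: F_def f1_def f2_def complex_eq_iff)
  have N: "(f1 x h)\<^sup>2 + (f2 x h)\<^sup>2 > 0" for h
    using Fnz[of h] by (auto simp: F_def complex_eq_iff sum_power2_gt_zero_iff)
  have N0: "(f1 x h)\<^sup>2 + (f2 x h)\<^sup>2 \<noteq> 0" for h using N[of h] by (rule less_imp_neq[symmetric])
  have cF: "continuous_on UNIV F" unfolding F_def Complex_eq by (intro continuous_intros c1 c2)
  define \<psi> where "\<psi> h = F h / of_real (cmod (F h))" for h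
  have c\<psi>: "continuous_on UNIV \<psi>" unfolding \<psi>_def using Fnz by (intro continuous_intros cF) auto
  have n\<psi>: "cmod (\<psi> h) = 1" for h using Fnz[of h] by (simp add: \<psi>_def norm_divide)
  obtain b where b: "continuous_on UNIV b" "\<And>h. \<psi> h = \<psi> \<one> * cis (b h)"
    using continuous_argument[OF c\<psi> n\<psi>] by blast
  have arg: "Complex (f1 x h) (f2 x h) = of_real (cmod (F h)) * \<psi> \<one> * cis (b h)" for h
  proof -
    have "F h = of_real (cmod (F h)) * \<psi> h" using Fnz[of h] by (simp add: \<psi>_def)
    then show ?thesis unfolding b(2)[of h] by (simp add: F_def mult.assoc)
  qed
  \<comment> \<open>For \<open>F = r e\<^sup>i\<^sup>b\<close>, \<open>w j\<close> is
    \<open>r\<^sup>2\<close> times the derivative of \<open>b\<close> along the \<open>j\<close>-th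
    field, \<open>w' i j\<close> is the derivative of \<open>w j\<close> along the
    \<open>i\<close>-th field, and \<open>b' i\<close> is the derivative of
    \<open>b\<close>.\<close>
  define w where "w j h = f1 x h * f2 (?E j x) h - f2 x h * f1 (?E j x) h" for j h
  define w' where "w' i j h = (f1 (?E i x) h * f2 (?E j x) h + f1 x h * f2 (?E i (?E j x)) h)
      - (f2 (?E i x) h * f1 (?E j x) h + f2 x h * f1 (?E i (?E j x)) h)" for i j h
  define b' where "b' i h = w i h / ((f1 x h)\<^sup>2 + (f2 x h)\<^sup>2)" for i h
  have cw: "continuous_on UNIV (w j)" and cw': "continuous_on UNIV (w' i j)" for i j
    unfolding w_def[abs_def] w'_def[abs_def] by (intro continuous_intros c1 c2)+
  have cb': "continuous_on UNIV (b' i)" for i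
    unfolding b'_def[abs_def] using N by (intro continuous_on_divide continuous_on_add continuous_on_power c1 c2 cw) (metis less_irrefl)
  have uw: "unif_deriv i (w j) (w' i j)" for i j
    unfolding w_def[abs_def] w'_def[abs_def] by (intro unif_deriv_diff unif_deriv_mult u1 u2 c1 c2)
  have ub: "unif_deriv i b (b' i)" for i
    unfolding b'_def[abs_def] w_def
    by (rule unif_deriv_argument[where r = "\<lambda>h. cmod (F h)" and \<kappa> = "\<psi> \<one>"])
      (rule c1 c2 N0 b(1) arg u1 u2 | simp add: Fnz)+
  \<comment> \<open>The mean of the derivative of \<open>b * w j\<close> along the
    \<open>i\<close>-th field.\<close>
  have zero: "mean (\<lambda>h. b' i h * w j h + b h * w' i j h) = 0" for i j
    by (rule mean_unif_deriv[OF _ _ unif_deriv_mult[OF ub uw b(1) cb' cw cw']])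
      (intro continuous_intros b(1) cb' cw cw')+
  \<comment> \<open>The divergence of \<open>r\<^sup>2 \<nabla>b\<close> is
    \<open>f1 \<Delta>f2 - f2 \<Delta>f1\<close>, which vanishes since both functions have the
    eigenvalue \<open>l\<close>. The products of first derivatives are antisymmetric in
    \<open>i\<close> and \<open>j\<close> and cancel against the symmetric inverse metric.\<close>
  have w'0: "(\<Sum>i\<in>UNIV. \<Sum>j\<in>UNIV. ?a i j * w' i j h) = 0" for h
  proof -
    have "?a i j * w' i j h = ?a i j * (f1 (?E i x) h * f2 (?E j x) h - f2 (?E i x) h * f1 (?E j x) h)
        + (f1 x h * (?a i j * f2 (?E i (?E j x)) h) - f2 x h * (?a i j * f1 (?E i (?E j x)) h))" for i j
      by (simp add: w'_def algebra_simps)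
    then have "(\<Sum>i\<in>UNIV. \<Sum>j\<in>UNIV. ?a i j * w' i j h)
        = (\<Sum>i\<in>UNIV. \<Sum>j\<in>UNIV. ?a i j * (f1 (?E i x) h * f2 (?E j x) h - f2 (?E i x) h * f1 (?E j x) h))
        + (f1 x h * (\<Sum>i\<in>UNIV. \<Sum>j\<in>UNIV. ?a i j * f2 (?E i (?E j x)) h)
          - f2 x h * (\<Sum>i\<in>UNIV. \<Sum>j\<in>UNIV. ?a i j * f1 (?E i (?E j x)) h))"
      by (simp only: sum.distrib sum_subtractf sum_distrib_left)
    also have "(\<Sum>i\<in>UNIV. \<Sum>j\<in>UNIV. ?a i j * (f1 (?E i x) h * f2 (?E j x) h - f2 (?E i x) h * f1 (?E j x) h)) = 0"
      by (rule sum_symmetric_antisymmetric) (simp_all add: inverse_metric_sym algebra_simps)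
    finally show ?thesis by (simp add: l1 l2)
  qed
  \<comment> \<open>The energy density \<open>r\<^sup>2 \<bar>\<nabla>b\<bar>\<^sup>2\<close>; it is
    continuous and nonnegative, so mean 0 makes it vanish identically.\<close>
  define Q where "Q h = (\<Sum>i\<in>UNIV. \<Sum>j\<in>UNIV. ?a i j * (b' i h * w j h))" for h
  have "(\<Sum>i\<in>UNIV. \<Sum>j\<in>UNIV. ?a i j * (b' i h * w j h + b h * w' i j h)) = Q h" for h
  proof -
    have "(\<Sum>i\<in>UNIV. \<Sum>j\<in>UNIV. ?a i j * (b' i h * w j h + b h * w' i j h))
        = Q h + b h * (\<Sum>i\<in>UNIV. \<Sum>j\<in>UNIV. ?a i j * w' i j h)"
      by (simp only: Q_def distrib_left sum.distrib sum_distrib_left mult.left_commute)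
    then show ?thesis by (simp add: w'0)
  qed
  then have "mean Q = mean (\<lambda>h. \<Sum>i\<in>UNIV. \<Sum>j\<in>UNIV. ?a i j * (b' i h * w j h + b h * w' i j h))" by simp
  also have "\<dots> = (\<Sum>i\<in>UNIV. \<Sum>j\<in>UNIV. ?a i j * mean (\<lambda>h. b' i h * w j h + b h * w' i j h))"
  proof -
    have c: "continuous_on UNIV (\<lambda>h. b' i h * w j h + b h * w' i j h)" for i j
      by (intro continuous_intros b(1) cb' cw cw')
    show ?thesis
      by (simp add: mean_sum mean_cmult c continuous_on_sum continuous_on_mult_left)
  qed
  also have "\<dots> = 0" by (simp add: zero)
  finally have mQ: "mean Q = 0" .
  have Qeq: "Q h = vec_lambda (\<lambda>i. w i h) \<bullet> (inverse_metric *v vec_lambda (\<lambda>i. w i h)) / ((f1 x h)\<^sup>2 + (f2 x h)\<^sup>2)" for h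
    by (simp add: Q_def b'_def inner_vec_def matrix_vector_mult_def sum_distrib_left sum_divide_distrib mult_ac)
  have Q0: "Q h \<ge> 0" for h
    unfolding Qeq using inverse_metric_pos[of "vec_lambda (\<lambda>i. w i h)"] N[of h]
    by (cases "vec_lambda (\<lambda>i. w i h) = 0") (auto intro!: divide_nonneg_pos less_imp_le)
  have cQ: "continuous_on UNIV Q" unfolding Q_def[abs_def] by (intro continuous_intros cb' cw)
  have w0: "w i h = 0" for i h
  proof -
    have "vec_lambda (\<lambda>i. w i h) = 0"
    proof (rule ccontr)
      assume "vec_lambda (\<lambda>i. w i h) \<noteq> 0"
      then have "Q h > 0" unfolding Qeq using inverse_metric_pos N[of h] by (intro divide_pos_pos)
      then show False using mean_pos[OF cQ Q0] mQ by (metis less_irrefl)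
    qed
    then show ?thesis by (metis vec_lambda_beta zero_index)
  qed
  have parallel: "f1 x h * f2 x \<one> = f2 x h * f1 x \<one>" for h
    unfolding f1_def f2_def
    by (rule rep_wronskian_zero_imp_parallel[OF R \<phi>1 \<phi>2]) (use Fnz w0 in \<open>simp_all add: F_def w_def f1_def f2_def\<close>)
  define \<alpha> where "\<alpha> = f1 x \<one>"
  define \<beta> where "\<beta> = f2 x \<one>"
  \<comment> \<open>\<open>g h\<close> is the real part of \<open>F h\<close> times the conjugate of
    \<open>F \<one>\<close>. As \<open>F h\<close> is a nonzero real multiple of
    \<open>F \<one>\<close>, it has no zero, and it is positive at the unit.\<close>
  define g where "g h = \<alpha> * f1 x h + \<beta> * f2 x h" for h
  have cg: "continuous_on UNIV g" unfolding g_def[abs_def] by (intro continuous_intros c1 c2)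
  have gnz: "g h \<noteq> 0" for h
  proof
    assume g: "g h = 0"
    have p: "f1 x h * \<beta> - f2 x h * \<alpha> = 0" using parallel[of h] by (simp add: \<alpha>_def \<beta>_def)
    have "(\<alpha>\<^sup>2 + \<beta>\<^sup>2) * f1 x h = \<alpha> * g h + \<beta> * (f1 x h * \<beta> - f2 x h * \<alpha>)"
      "(\<alpha>\<^sup>2 + \<beta>\<^sup>2) * f2 x h = \<beta> * g h - \<alpha> * (f1 x h * \<beta> - f2 x h * \<alpha>)"
      by (simp_all add: g_def power2_eq_square algebra_simps)
    then have "(\<alpha>\<^sup>2 + \<beta>\<^sup>2) * f1 x h = 0" "(\<alpha>\<^sup>2 + \<beta>\<^sup>2) * f2 x h = 0" by (simp_all only: g p mult_zero_right add_0_right diff_0_right)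
    moreover have "\<alpha>\<^sup>2 + \<beta>\<^sup>2 \<noteq> 0" unfolding \<alpha>_def \<beta>_def by (rule N0)
    ultimately have "f1 x h = 0" "f2 x h = 0" by (metis mult_eq_0_iff)+
    then show False using N[of h] by simp
  qed
  have g1: "g \<one> > 0" using N[of \<one>] by (simp add: g_def \<alpha>_def \<beta>_def power2_eq_square)
  have gpos: "g h > 0" for h
  proof (rule ccontr)
    assume "\<not> g h > 0"
    then have "g h \<le> 0" by simp
    have "connected (range g)" by (rule connected_continuous_image[OF cg connected])
    then have "0 \<in> range g" using g1 \<open>g h \<le> 0\<close>
      unfolding connected_iff_interval by (metis less_imp_le rangeI)
    then show False using gnz by (metis rangeE)
  qed
  have "mean g > 0" by (rule mean_pos[OF cg less_imp_le[OF gpos] gpos])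
  \<comment> \<open>The Casimir sum consists of derivatives along left-invariant fields, which have
    mean 0, while it equals \<open>l\<close> times the function.\<close>
  moreover have "l * mean g = 0"
  proof -
    have m1: "mean (f1 (?E i y)) = 0" and m2: "mean (f2 (?E i y)) = 0" for i y
      using mean_unif_deriv[OF c1 c1 u1] mean_unif_deriv[OF c2 c2 u2] by blast+
    have "l * mean (f1 x) = mean (\<lambda>h. \<Sum>i\<in>UNIV. \<Sum>j\<in>UNIV. ?a i j * f1 (?E i (?E j x)) h)"
      unfolding l1 by (rule mean_cmult[OF c1, symmetric])
    also have "\<dots> = 0"
      by (simp add: mean_sum mean_cmult c1 continuous_on_sum continuous_on_mult_left m1)
    finally have 1: "l * mean (f1 x) = 0" .
    have "l * mean (f2 x) = mean (\<lambda>h. \<Sum>i\<in>UNIV. \<Sum>j\<in>UNIV. ?a i j * f2 (?E i (?E j x)) h)"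
      unfolding l2 by (rule mean_cmult[OF c2, symmetric])
    also have "\<dots> = 0"
      by (simp add: mean_sum mean_cmult c2 continuous_on_sum continuous_on_mult_left m2)
    finally have 2: "l * mean (f2 x) = 0" .
    have "mean g = \<alpha> * mean (f1 x) + \<beta> * mean (f2 x)"
      unfolding g_def[abs_def] by (simp add: mean_add mean_cmult c1 c2 continuous_on_mult_left)
    then show ?thesis using 1 2 l by simp
  qed
  ultimately show False using l by simp
qed

end

theorem corollary2:
  fixes G :: "'g::{t2_space, second_countable_topology} monoid"
    and A :: "('g, 'n::finite) chart set"
    and \<rho> :: "'g \<Rightarrow> (('g \<Rightarrow> real) \<Rightarrow> real) \<Rightarrow> (('g \<Rightarrow> real) \<Rightarrow> real) \<Rightarrow> real"
    and \<sigma> :: "'g \<Rightarrow> 'v::euclidean_space \<Rightarrow> 'v"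
    and B :: "'v \<Rightarrow> 'v \<Rightarrow> real"
    and l :: real
    and x :: 'v
    and L :: "'v set"
  assumes "semisimple_lie_group G A"
    and "compact (UNIV :: 'g set)"
    and "connected (UNIV :: 'g set)"
    and "riemannian_metric A \<rho>"
    and "bi_invariant G A \<rho>"
    and "group_representation G \<sigma>"
    and "invariant_inner_product \<sigma> B"
    and "spectrum_on (laplace_beltrami A \<rho>) (matrix_elements \<sigma> B) = {l}"
    and "l \<noteq> 0"
    and "subspace L"
    and "dim L + 2 = DIM('v)"
  shows "{\<sigma> g x |g. g \<in> carrier G} \<inter> L \<noteq> {}"
proof -
  have lie: "lie_group G A" using assms(1) by (simp add: semisimple_lie_group_def)
  interpret lie_grp G A by (rule lie_grp.intro[OF lie])
  interpret semisimple_compact_lie_group G A \<rho>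
    by unfold_locales (use assms in simp_all)
  define R where "R g = Blinfun (\<sigma> g)" for g
  have \<sigma>: "group_action G UNIV \<sigma>" "\<And>g. linear (\<sigma> g)" "\<And>x. continuous_on UNIV (\<lambda>g. \<sigma> g x)"
    using assms(6) by (auto simp: group_representation_def)
  have ap: "blinfun_apply (R g) = \<sigma> g" for g
    unfolding R_def by (rule bounded_linear_Blinfun_apply) (use \<sigma>(2) linear_conv_bounded_linear in blast)
  have R: "blinfun_rep R"
    unfolding blinfun_rep_def
  proof (intro conjI allI)
    show "R (g \<otimes>\<^bsub>G\<^esub> h) = R g o\<^sub>L R h" for g h
      by (rule blinfun_eqI) (simp add: ap group_action.composition_rule[OF \<sigma>(1)])
    have "\<sigma> \<one>\<^bsub>G\<^esub> = (\<lambda>x. x)" using group_action.id_eq_one[OF \<sigma>(1)] by (simp add: fun_eq_iff)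
    then show "R \<one>\<^bsub>G\<^esub> = id_blinfun" by (intro blinfun_eqI) (simp add: ap)
    show "continuous_on UNIV R" by (rule continuous_on_blinfun_componentwise) (simp add: ap \<sigma>(3))
  qed
  have B: "bilinear B" "\<And>x y. B x y = B y x" "\<And>x. x \<noteq> 0 \<Longrightarrow> B x x > 0" "\<And>g x y. B (\<sigma> g x) (\<sigma> g y) = B x y"
    using assms(7) unfolding invariant_inner_product_def by blast+
  have bb: "bounded_bilinear B" by (rule bilinear_conv_bounded_bilinear[THEN iffD1, OF B(1)])
  have cas: "casimir R y = l *\<^sub>R y" for y
  proof (rule symmetric_operator_single_eigenvalue[OF B(1,2,3) linear_casimir])
    show "B (casimir R x) y = B x (casimir R y)" for x y
      by (rule casimir_sym[OF R bb]) (simp add: ap B(4))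
    fix \<mu> v assume v: "v \<noteq> 0" "casimir R v = \<mu> *\<^sub>R v"
    \<comment> \<open>The diagonal matrix element of an eigenvector of the Casimir operator is an
      eigenfunction of the Laplacian for the same value; it is nonzero because its value at the unit
      is \<open>B v v\<close>.\<close>
    let ?u = "matrix_element \<sigma> B v v"
    have bl: "bounded_linear (\<lambda>y. B y v)" by (rule bounded_bilinear.bounded_linear_left[OF bb])
    have u: "?u = (\<lambda>g. B (blinfun_apply (R g) v) v)" by (simp add: matrix_element_def ap)
    have "laplace_beltrami A \<rho> ?u = (\<lambda>g. \<mu> * ?u g)"
      unfolding u laplace_beltrami_rep[OF R bl] v(2)
      by (simp add: blinfun.scaleR_right linear_cmul[OF bounded_linear.linear[OF bl]])
    moreover have "?u \<in> matrix_elements \<sigma> B"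
      unfolding matrix_elements_def
      by (intro CollectI exI[of _ 1] exI[of _ "\<lambda>_. 1"] exI[of _ "\<lambda>_. v"]) simp
    moreover have "?u \<one>\<^bsub>G\<^esub> \<noteq> 0" using B(3)[OF v(1)] by (simp add: u rep_one[OF R])
    then have "?u \<noteq> (\<lambda>g. 0)" by metis
    ultimately have "\<mu> \<in> spectrum_on (laplace_beltrami A \<rho>) (matrix_elements \<sigma> B)"
      unfolding spectrum_on_def by blast
    then show "\<mu> = l" using assms(8) by simp
  qed
  obtain p q where pq: "\<And>y. y \<bullet> p = 0 \<Longrightarrow> y \<bullet> q = 0 \<Longrightarrow> y \<in> L"
    using codim2_orthogonal[OF assms(10,11)] by blast
  obtain h where "\<sigma> h x \<bullet> p = 0" "\<sigma> h x \<bullet> q = 0"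
    using eigen_pair_common_zero[OF R bounded_linear_inner_left bounded_linear_inner_left cas assms(9)]
    unfolding ap by blast
  then have "\<sigma> h x \<in> L" by (rule pq)
  then show ?thesis by auto
qed

end
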